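(* Let $d\in\mathbb{N}$, a sparsity parameter $s\in\mathbb{N}$, a frequency candidate set $\Gamma\subset\mathbb{Z}^d$ with $|\Gamma|<\infty$, a number $G\in\mathbb{N}$ and a failure probability $\delta\in(0,1)$ be given. Define $$N_\Gamma:=\max_{j=1,\dots,d}\Big\{\max_{\boldsymbol{k}\in\Gamma}k_j-\min_{\boldsymbol{l}\in\Gamma}l_j\Big\}.$$ Then there exists a randomized sampling strategy (based on random rank-1 lattices) generating a set $S\subset\mathbb{T}^d$ of sampling locations with cardinality $$|S|\in\mathcal{O}\Big(d\,s\,\max(s,N_\Gamma)\,\log^2\frac{d\,s\,G\,N_\Gamma}{\delta}+\max(sG,N_\Gamma)\,\log\frac{d\,s\,G}{\delta}\Big)$$ such that the following holds. Consider $G$ arbitrary multivariate trigonometric polynomials $p^{(g)}(\boldsymbol{y})=\sum_{\boldsymbol{k}\in I_g}\hat p^{(g)}_{\boldsymbol{k}}\,e^{2\pi i\,\boldsymbol{k}\cdot\boldsymbol{y}}$, $g=1,\dots,G$, where $I_g\subset\Gamma$, $|I_g|\le s$ and $\min_{\boldsymbol{k}\in I_g}|\hat p^{(g)}_{\boldsymbol{k}}|>0$ for each $g=1,\dots,G$. Generate a random set $S$ via this sampling strategy. Then, with probability at least $1-\delta$, all frequencies $\boldsymbol{k}\in I_g$ and all Fourier coefficients $\hat p^{(g)}_{\boldsymbol{k}}$, $\boldsymbol{k}\in I_g$, of all the polynomials $p^{(g)}$, $g=1,\dots,G$, can be reconstructed from the values of the polynomials at the sampling locations in $S$. Moreover,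 the simultaneous identification of all the frequencies and the computation of all the Fourier coefficients can be realized by the uniform sparse FFT (the algorithm described in the context), with a random rank-1 lattice method in the role of its subroutine $\operatorname{A}$; the resulting method has a computational complexity of $$\mathcal{O}\Big(d^2\,s^2\,G^2\,N_\Gamma\,\log^3\frac{d\,s\,G\,N_\Gamma}{\delta}\Big)$$ with probability at least $1-\delta$, and of $$\mathcal{O}\Big(d^2\,s^3\,G^2\,N_\Gamma\,\log^3\frac{d\,s\,G\,N_\Gamma}{\delta}\Big)$$ in the worst case.
   Context: $\mathbb{T}\simeq[0,1)$ is the one-dimensional torus. The frequency sets $I_g$ are unknown to the method and need not share any elements. Access to the polynomials is by sampling: at each chosen location $\boldsymbol{y}\in S$, a single call to a black box returns all $G$ values $p^{(1)}(\boldsymbol{y}),\dots,p^{(G)}(\boldsymbol{y})$; $|S|$ counts locations, not values. The sampling strategy is the randomized, adaptive one implicit in the algorithm below: locations used in later steps may depend on frequency sets detected from values at earlier locations. Computational complexity is the number of arithmetic operations, excluding the cost of obtaining the samples. $\mathcal{O}$ is ordinary asymptotic notation in the parameters $d,s,G,N_\Gamma,1/\delta$, with implied constants not depending on $d,s,G,\Gamma,\delta$ or the polynomials (degenerate cases such as $N_\Gamma=0$ or logarithms close to $0$ are disregarded, as is customary). Rank-1 lattice: for a generating vector $\boldsymbol{z}\in\mathbb{Z}^d$ and size $M\in\mathbb{N}$, $\Lambda(\boldsymbol{z},M)=\{\frac{i}{M}\boldsymbol{z}\bmod\boldsymbol{1}: i=0,\dots,M-1\}$, where $\boldsymbol{1}=(1,\dots,1)$;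 the random rank-1 lattice method samples along unions of randomly chosen rank-1 lattices. For $J\subset\mathbb{Z}^d$ write $\mathcal{P}_t(J)=\{k_t:\boldsymbol{k}\in J\}$ and $\mathcal{P}_{(1,\dots,t)}(J)=\{(k_1,\dots,k_t):\boldsymbol{k}\in J\}$. The uniform sparse FFT. Inputs: $\Gamma$; black-box access to $p^{(1)},\dots,p^{(G)}$; sparsity parameters $s\le s_{\mathrm{local}}$ in $\mathbb{N}$; an absolute threshold $\theta>0$; a number $r\in\mathbb{N}$ of detection iterations; and an efficient subroutine $\operatorname{A}$ which, for a given finite candidate set of frequencies, uses samples on a suitable sampling set to identify, with high probability, the frequency support of each $s_{\mathrm{local}}$-sparse trigonometric polynomial supported in the candidate set, and computes its Fourier coefficients. Step 1 (single components). For $t=1,\dots,d$: let $K_t=\max\mathcal{P}_t(\Gamma)-\min\mathcal{P}_t(\Gamma)+1$ and $I^{(t)}=\emptyset$. Repeat $r$ times: choose $y_j'\in\mathbb{T}$, $j\ne t$, uniformly at random; let $\boldsymbol{y}^{(\ell)}$, $\ell=0,\dots,K_t-1$, have $t$-th component $\ell/K_t$ and $j$-th component $y_j'$ for $j\neq t$; for each $g$ compute $c_{k,g}=\frac1{K_t}\sum_{\ell=0}^{K_t-1}p^{(g)}(\boldsymbol{y}^{(\ell)})e^{-2\pi i\ell k/K_t}$, $k\in\mathcal{P}_t(\Gamma)$, by an FFT, and add to $I^{(t)}$ all $k$ for which $c_{k,g}$ is among the $s_{\mathrm{local}}$ largest in absolute value and $|c_{k,g}|\ge\theta$. Step 2 (coupling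 components). Start with $I^{(1)}$ from Step 1. For $t=2,\dots,d$: set $\tilde r=r$, $\tilde s=s_{\mathrm{local}}$ if $t<d$, and $\tilde r=1$, $\tilde s=s$ if $t=d$. Put $I^{(1,\dots,t)}=\emptyset$ and $J_t=(I^{(1,\dots,t-1)}\times I^{(t)})\cap\mathcal{P}_{(1,\dots,t)}(\Gamma)$. Generate a sampling set $\mathcal{X}\subset\mathbb{T}^t$ for $J_t$ that allows the application of $\operatorname{A}$. Repeat $\tilde r$ times: choose $y'_{t+1},\dots,y'_d\in\mathbb{T}$ uniformly at random, sample all $p^{(g)}$ at the nodes $(\tilde{\boldsymbol{y}},y'_{t+1},\dots,y'_d)$, $\tilde{\boldsymbol{y}}\in\mathcal{X}$, and for each $g$ use $\operatorname{A}$ on these samples to obtain the set of frequencies in $J_t$ belonging to the at most $\tilde s$ largest (projected) Fourier coefficients, each larger than $\theta$ in absolute value; add this set to $I^{(1,\dots,t)}$. Step 3 (coefficients). Generate a suitable sampling set $\mathcal{Y}\subset\mathbb{T}^d$ (a union of several rank-1 lattices) for the frequency set $I^{(1,\dots,d)}$, sample all $p^{(g)}$ on $\mathcal{Y}$, and compute from these samples, for each $g$, the Fourier coefficients of $p^{(g)}$ for all $\boldsymbol{k}\in I^{(1,\dots,d)}$. Output: $I^{(1,\dots,d)}$ and these coefficients. *)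

theory Defs
  imports "HOL-Probability.Probability" "HOL-Library.Monad_Syntax"
begin

section \<open>Sparse trigonometric polynomials\<close>

text \<open>Multi-indices in \<open>\<int>\<^sup>d\<close> and points of \<open>\<real>\<^sup>d\<close> are lists of length \<open>d\<close>, since the algorithm
  below works with prefixes of varying length.  Components are numbered from 0.\<close>

type_synonym freq = "int list"
type_synonym point = "real list"

definition torus :: "nat \<Rightarrow> point set" where
  "torus d = {y. length y = d \<and> set y \<subseteq> {0..<1}}"

definition trig_poly :: "freq set \<Rightarrow> (freq \<Rightarrow> complex) \<Rightarrow> point \<Rightarrow> complex" where
  "trig_poly I c y =
     (\<Sum>k\<in>I. c k * exp (2 * of_real pi * \<i> * of_real (\<Sum>j<length k. of_int (k ! j) * y ! j)))"

definition sparse_family ::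
    "nat \<Rightarrow> nat \<Rightarrow> freq set \<Rightarrow> (nat \<Rightarrow> freq set) \<Rightarrow> (nat \<Rightarrow> freq \<Rightarrow> complex) \<Rightarrow> bool" where
  "sparse_family s G \<Gamma> I c \<longleftrightarrow>
     (\<forall>g<G. I g \<subseteq> \<Gamma> \<and> card (I g) \<le> s \<and> (\<forall>k\<in>I g. cmod (c g k) > 0))"

text \<open>One call returns the values of all \<open>G\<close> polynomials.\<close>

definition black_box ::
    "nat \<Rightarrow> (nat \<Rightarrow> freq set) \<Rightarrow> (nat \<Rightarrow> freq \<Rightarrow> complex) \<Rightarrow> point \<Rightarrow> complex list" where
  "black_box G I c y = map (\<lambda>g. trig_poly (I g) (c g) y) [0..<G]"

definition proj :: "nat \<Rightarrow> freq set \<Rightarrow> int set" where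
  "proj t J = (\<lambda>k. k ! t) ` J"

definition proj_prefix :: "nat \<Rightarrow> freq set \<Rightarrow> freq set" where
  "proj_prefix n J = take n ` J"

definition width :: "nat \<Rightarrow> freq set \<Rightarrow> int" where
  "width d \<Gamma> = Max ((\<lambda>j. Max (proj j \<Gamma>) - Min (proj j \<Gamma>)) ` {..<d})"


section \<open>Programs with black-box access and operation count\<close>

text \<open>A program reaches the polynomials only through \<open>Sample\<close>, so its sampling locations may depend on
  the answers obtained so far.  \<open>Charge n\<close> accounts for \<open>n\<close> operations.  Counted are the arithmetic
  operations on complex, real and integer numbers (an absolute value or an exponential is one
  operation) and the comparisons of such numbers.  Obtaining samples, bookkeeping of finite
  frequency sets and list access are free.\<close>

datatype 'a prog =
    Return 'a
  | Sample point "complex list \<Rightarrow> 'a prog"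
  | Charge nat "'a prog"

primrec bind_prog :: "'a prog \<Rightarrow> ('a \<Rightarrow> 'b prog) \<Rightarrow> 'b prog" where
  "bind_prog (Return x) f = f x"
| "bind_prog (Sample y h) f = Sample y (\<lambda>v. bind_prog (h v) f)"
| "bind_prog (Charge n P) f = Charge n (bind_prog P f)"

adhoc_overloading Monad_Syntax.bind \<rightleftharpoons> bind_prog

primrec result :: "'a prog \<Rightarrow> (point \<Rightarrow> complex list) \<Rightarrow> 'a" where
  "result (Return x) F = x"
| "result (Sample y h) F = result (h (F y)) F"
| "result (Charge n P) F = result P F"

primrec locations :: "'a prog \<Rightarrow> (point \<Rightarrow> complex list) \<Rightarrow> point set" where
  "locations (Return x) F = {}"
| "locations (Sample y h) F = insert y (locations (h (F y)) F)"
| "locations (Charge n P) F = locations P F"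

primrec operations :: "'a prog \<Rightarrow> (point \<Rightarrow> complex list) \<Rightarrow> nat" where
  "operations (Return x) F = 0"
| "operations (Sample y h) F = operations (h (F y)) F"
| "operations (Charge n P) F = n + operations P F"

text \<open>Throughout, \<open>n\<close> in \<open>charged n e\<close> bounds the number of operations visible in \<open>e\<close>.\<close>

definition charged :: "nat \<Rightarrow> 'a \<Rightarrow> 'a prog" where
  "charged n x = Charge n (Return x)"

definition sample :: "point \<Rightarrow> complex list prog" where
  "sample y = Sample y Return"

primrec mapP :: "('a \<Rightarrow> 'b prog) \<Rightarrow> 'a list \<Rightarrow> 'b list prog" where
  "mapP f [] = Return []"
| "mapP f (x # xs) = do { y \<leftarrow> f x; ys \<leftarrow> mapP f xs; Return (y # ys) }"

primrec foldP :: "('a \<Rightarrow> 'b \<Rightarrow> 'b prog) \<Rightarrow> 'a list \<Rightarrow> 'b \<Rightarrow> 'b prog" where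
  "foldP f [] b = Return b"
| "foldP f (x # xs) b = do { b' \<leftarrow> f x b; foldP f xs b' }"


section \<open>Elementary subroutines\<close>

fun inner_prod :: "int list \<Rightarrow> int list \<Rightarrow> int prog" where
  "inner_prod (a # as) (b # bs) =
     do { p \<leftarrow> charged 1 (a * b); q \<leftarrow> inner_prod as bs; charged 1 (p + q) }"
| "inner_prod _ _ = Return 0"

text \<open>Merge sort, decreasing with respect to the second component.\<close>

fun merge_desc :: "('k \<times> real) list \<Rightarrow> ('k \<times> real) list \<Rightarrow> ('k \<times> real) list prog" where
  "merge_desc [] ys = Return ys"
| "merge_desc (x # xs) [] = Return (x # xs)"
| "merge_desc (x # xs) (y # ys) =
     do { b \<leftarrow> charged 1 (snd x \<ge> snd y);
          if b then do { zs \<leftarrow> merge_desc xs (y # ys); Return (x # zs) }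
          else do { zs \<leftarrow> merge_desc (x # xs) ys; Return (y # zs) } }"

fun sort_desc :: "('k \<times> real) list \<Rightarrow> ('k \<times> real) list prog" where
  "sort_desc xs =
     (let n = length xs in
      if n \<le> 1 then Return xs
      else do { as \<leftarrow> sort_desc (take (n div 2) xs);
                bs \<leftarrow> sort_desc (drop (n div 2) xs);
                merge_desc as bs })"

text \<open>The keys of (at most) \<open>n\<close> coefficients largest in absolute value, as far as these absolute
  values pass the threshold test.\<close>

definition select_largest :: "nat \<Rightarrow> (real \<Rightarrow> bool) \<Rightarrow> ('k \<times> complex) list \<Rightarrow> 'k list prog" where
  "select_largest n test cs = do {
     ms \<leftarrow> mapP (\<lambda>(k, c). charged 1 (k, cmod c)) cs;
     srt \<leftarrow> sort_desc ms;
     bs \<leftarrow> mapP (\<lambda>(k, a). charged 1 (test a)) (take n srt);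
     Return [k. ((k, a), b) \<leftarrow> zip (take n srt) bs, b] }"

text \<open>Radix-2 FFT: for \<open>w\<close> a primitive \<open>2^m\<close>-th root of unity and \<open>xs\<close> of length \<open>2^m\<close>, the result
  has entries \<open>\<Sum>l. xs ! l * w ^ (l * k)\<close>.\<close>

fun butterfly ::
    "complex \<Rightarrow> complex \<Rightarrow> complex list \<Rightarrow> complex list \<Rightarrow> (complex list \<times> complex list) prog" where
  "butterfly w t (e # es) (x # xs) = do {
     u \<leftarrow> charged 1 (t * x);
     a \<leftarrow> charged 1 (e + u);
     b \<leftarrow> charged 1 (e - u);
     t' \<leftarrow> charged 1 (t * w);
     (as, bs) \<leftarrow> butterfly w t' es xs;
     Return (a # as, b # bs) }"
| "butterfly w t _ _ = Return ([], [])"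

fun fft_pow2 :: "nat \<Rightarrow> complex \<Rightarrow> complex list \<Rightarrow> complex list prog" where
  "fft_pow2 0 w xs = Return xs"
| "fft_pow2 (Suc m) w xs = do {
     w2 \<leftarrow> charged 1 (w * w);
     es \<leftarrow> fft_pow2 m w2 (map (\<lambda>i. xs ! (2 * i)) [0..<2 ^ m]);
     os \<leftarrow> fft_pow2 m w2 (map (\<lambda>i. xs ! (2 * i + 1)) [0..<2 ^ m]);
     (as, bs) \<leftarrow> butterfly w 1 es os;
     Return (as @ bs) }"

text \<open>FFT of arbitrary length \<open>n\<close> (chirp transform): the entries of the result are
  \<open>\<Sum>l<n. xs ! l * exp (- 2 * pi * i * l * k / n)\<close>, written by means of
  \<open>2 * l * k = l^2 + k^2 - (k - l)^2\<close> as a cyclic convolution of length \<open>2^m \<ge> 2 * n\<close>.\<close>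

definition fft :: "complex list \<Rightarrow> complex list prog" where
  "fft xs =
     (let n = length xs; m = (LEAST m. 2 * n \<le> 2 ^ m); N = 2 ^ m in do {
        ch \<leftarrow> mapP (\<lambda>j. charged 5 (cis (- pi * real (j * j) / real n))) [0..<n];
        a \<leftarrow> mapP (\<lambda>j. charged 1 (xs ! j * ch ! j)) [0..<n];
        b \<leftarrow> mapP (\<lambda>j. charged 1 (cnj (ch ! j))) [0..<n];
        w \<leftarrow> charged 4 (cis (- 2 * pi / real N));
        fa \<leftarrow> fft_pow2 m w (a @ replicate (N - n) 0);
        fb \<leftarrow> fft_pow2 m w (b @ replicate (N - 2 * n + 1) 0 @ rev (tl b));
        fc \<leftarrow> mapP (\<lambda>(x, y). charged 1 (x * y)) (zip fa fb);
        w' \<leftarrow> charged 1 (cnj w);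
        cc \<leftarrow> fft_pow2 m w' fc;
        mapP (\<lambda>k. charged 2 (ch ! k * cc ! k / of_nat N)) [0..<n] })"

text \<open>Majority vote: a value occurring in more than half of the list entries is returned.\<close>

fun majority :: "complex \<Rightarrow> nat \<Rightarrow> complex list \<Rightarrow> complex prog" where
  "majority c n [] = Return c"
| "majority c n (x # xs) =
     Charge 3 (if n = 0 then majority x 1 xs
               else if x = c then majority c (n + 1) xs
               else majority c (n - 1) xs)"


section \<open>Random rank-1 lattices\<close>

definition rank1_lattice :: "freq \<Rightarrow> nat \<Rightarrow> point list" where
  "rank1_lattice z M = map (\<lambda>i. map (\<lambda>a. frac (real i / real M * real_of_int a)) z) [0..<M]"

text \<open>For \<open>u\<close> with independent entries uniformly distributed in \<open>[0,1)\<close>, this yields \<open>L\<close> independent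
  generating vectors uniformly distributed in \<open>{0..<M}^n\<close>.\<close>

definition generators :: "nat \<Rightarrow> nat \<Rightarrow> nat \<Rightarrow> (nat \<Rightarrow> nat \<Rightarrow> real) \<Rightarrow> freq list prog" where
  "generators M L n u =
     mapP (\<lambda>l. mapP (\<lambda>j. charged 2 \<lfloor>real M * u l j\<rfloor>) [0..<n]) [0..<L]"

definition lattice_union :: "nat \<Rightarrow> freq list \<Rightarrow> point list prog" where
  "lattice_union M zs =
     Charge (\<Sum>z\<leftarrow>zs. 3 * M * length z) (Return (concat (map (\<lambda>z. rank1_lattice z M) zs)))"

definition bin :: "nat \<Rightarrow> freq \<Rightarrow> freq \<Rightarrow> nat prog" where
  "bin M k z = do { p \<leftarrow> inner_prod k z; charged 1 (nat (p mod int M)) }"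

text \<open>\<open>vs\<close> lists the sampled values lattice by lattice; entry \<open>b\<close> of the result for lattice \<open>z\<close> is the
  sum of the Fourier coefficients of all frequencies \<open>k\<close> with \<open>bin M k z = b\<close>.\<close>

definition lattice_ffts :: "nat \<Rightarrow> nat \<Rightarrow> complex list \<Rightarrow> complex list list prog" where
  "lattice_ffts M L vs =
     mapP (\<lambda>l. do { X \<leftarrow> fft (take M (drop (l * M) vs));
                     mapP (\<lambda>x. charged 1 (x / of_nat M)) X }) [0..<L]"

text \<open>The type of the subroutine A.  Given a dimension \<open>n\<close>, a candidate set \<open>J \<subseteq> \<int>\<^sup>n\<close> and random
  numbers, it generates a sampling set in \<open>\<bbbT>\<^sup>n\<close> together with a procedure that computes from the
  samples of one polynomial a coefficient for every \<open>k \<in> J\<close>.\<close>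

type_synonym subroutine =
  "nat \<Rightarrow> freq list \<Rightarrow> (nat \<Rightarrow> nat \<Rightarrow> real) \<Rightarrow>
     (point list \<times> (complex list \<Rightarrow> (freq \<times> complex) list prog)) prog"

definition random_rank1_method :: "nat \<Rightarrow> nat \<Rightarrow> subroutine" where
  "random_rank1_method M L n J u = do {
     zs \<leftarrow> generators M L n u;
     X \<leftarrow> lattice_union M zs;
     bins \<leftarrow> mapP (\<lambda>k. mapP (bin M k) zs) J;
     Return (X, \<lambda>vs. do {
       cs \<leftarrow> lattice_ffts M L vs;
       mapP (\<lambda>(k, bs). do {
               c \<leftarrow> majority 0 0 (map (\<lambda>l. cs ! l ! (bs ! l)) [0..<L]);
               Return (k, c) }) (zip J bins) }) }"


section \<open>The uniform sparse FFT\<close>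

text \<open>All random numbers are independent and uniform in \<open>[0,1)\<close>; they are indexed by the place of
  their use: \<open>Shift1 t i j\<close> and \<open>Shift2 n i j\<close> are the components \<open>y'\<^sub>j\<close> in iteration \<open>i\<close> for
  component \<open>t\<close>, respectively prefix length \<open>n\<close>; \<open>GenA n l j\<close> and \<open>GenY l j\<close> produce component
  \<open>j\<close> of the \<open>l\<close>-th generating vector of the sampling sets \<open>\<X>\<close> and \<open>\<Y>\<close>.\<close>

datatype draw = Shift1 nat nat nat | Shift2 nat nat nat | GenA nat nat nat | GenY nat nat

type_synonym seed = "draw \<Rightarrow> real"

definition seed_space :: "seed measure" where
  "seed_space = PiM UNIV (\<lambda>_. restrict_space lborel {0..<1})"

definition step1 ::
    "nat \<Rightarrow> nat \<Rightarrow> freq set \<Rightarrow> nat \<Rightarrow> real \<Rightarrow> nat \<Rightarrow> seed \<Rightarrow> nat \<Rightarrow> int list prog" where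
  "step1 d G \<Gamma> s_loc \<theta> r \<omega> t =
     (let K = nat (Max (proj t \<Gamma>) - Min (proj t \<Gamma>) + 1) in do {
        detected \<leftarrow> mapP (\<lambda>i. do {
          let y' = map (\<lambda>j. \<omega> (Shift1 t i j)) [0..<d];
          vals \<leftarrow> mapP (\<lambda>l. sample (y'[t := real l / real K])) [0..<K];
          found \<leftarrow> mapP (\<lambda>g. do {
            X \<leftarrow> fft (map (\<lambda>v. v ! g) vals);
            cs \<leftarrow> mapP (\<lambda>k. charged 2 (k, X ! nat (k mod int K) / of_nat K))
                     (sorted_list_of_set (proj t \<Gamma>));
            select_largest s_loc (\<lambda>a. a \<ge> \<theta>) cs }) [0..<G];
          Return (concat found) }) [0..<r];
        Return (remdups (concat detected)) })"

text \<open>\<open>I\<close> and \<open>I1\<close> are the detected sets for the components \<open>1,\<dots>,n-1\<close> and for the \<open>n\<close>-th one.\<close>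

definition step2 ::
    "nat \<Rightarrow> nat \<Rightarrow> freq set \<Rightarrow> nat \<Rightarrow> nat \<Rightarrow> real \<Rightarrow> nat \<Rightarrow> subroutine \<Rightarrow> seed \<Rightarrow>
       nat \<Rightarrow> int list \<Rightarrow> freq list \<Rightarrow> freq list prog" where
  "step2 d G \<Gamma> s s_loc \<theta> r A \<omega> n I1 I =
     (let r' = (if n < d then r else 1);
          s' = (if n < d then s_loc else s);
          J = [k @ [l]. k \<leftarrow> I, l \<leftarrow> I1, k @ [l] \<in> proj_prefix n \<Gamma>] in do {
        (X, decode) \<leftarrow> A n J (\<lambda>l j. \<omega> (GenA n l j));
        detected \<leftarrow> mapP (\<lambda>i. do {
          vals \<leftarrow> mapP (\<lambda>y. sample (y @ map (\<lambda>j. \<omega> (Shift2 n i j)) [n..<d])) X;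
          found \<leftarrow> mapP (\<lambda>g. do {
            cs \<leftarrow> decode (map (\<lambda>v. v ! g) vals);
            select_largest s' (\<lambda>a. a > \<theta>) cs }) [0..<G];
          Return (concat found) }) [0..<r'];
        Return (remdups (concat detected)) })"

text \<open>The coefficient of the \<open>a\<close>-th frequency is read off from the first lattice in which no other
  frequency of the given set shares its bin (and set to 0 if there is none).\<close>

definition alias_free :: "nat list list \<Rightarrow> nat \<Rightarrow> nat \<Rightarrow> bool" where
  "alias_free bins a l \<longleftrightarrow> (\<forall>b<length bins. b \<noteq> a \<longrightarrow> bins ! b ! l \<noteq> bins ! a ! l)"

definition step3 ::
    "nat \<Rightarrow> nat \<Rightarrow> nat \<Rightarrow> nat \<Rightarrow> seed \<Rightarrow> freq list \<Rightarrow> (freq list \<times> complex list list) prog" where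
  "step3 d G M L \<omega> I = do {
     zs \<leftarrow> generators M L d (\<lambda>l j. \<omega> (GenY l j));
     Y \<leftarrow> lattice_union M zs;
     bins \<leftarrow> mapP (\<lambda>k. mapP (bin M k) zs) I;
     sel \<leftarrow> charged (L * length I) (map (\<lambda>a. find (alias_free bins a) [0..<L]) [0..<length I]);
     vals \<leftarrow> mapP sample Y;
     cfs \<leftarrow> mapP (\<lambda>g. do {
       cs \<leftarrow> lattice_ffts M L (map (\<lambda>v. v ! g) vals);
       Return (map (\<lambda>a. case sel ! a of None \<Rightarrow> 0 | Some l \<Rightarrow> cs ! l ! (bins ! a ! l))
                 [0..<length I]) }) [0..<G];
     Return (I, cfs) }"

text \<open>\<open>M'\<close> and \<open>L'\<close> are the size and the number of the rank-1 lattices forming the set \<open>\<Y>\<close>.\<close>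

definition uniform_sparse_fft ::
    "nat \<Rightarrow> nat \<Rightarrow> freq set \<Rightarrow> nat \<Rightarrow> nat \<Rightarrow> real \<Rightarrow> nat \<Rightarrow> subroutine \<Rightarrow> nat \<Rightarrow> nat \<Rightarrow> seed \<Rightarrow>
       (freq list \<times> complex list list) prog" where
  "uniform_sparse_fft d G \<Gamma> s s_loc \<theta> r A M' L' \<omega> = do {
     Is \<leftarrow> mapP (step1 d G \<Gamma> s_loc \<theta> r \<omega>) [0..<d];
     I \<leftarrow> foldP (\<lambda>n. step2 d G \<Gamma> s s_loc \<theta> r A \<omega> n (Is ! (n - 1))) [2..<d + 1]
            (map (\<lambda>k. [k]) (Is ! 0));
     step3 d G M' L' \<omega> I }"

text \<open>An output \<open>(J, cfs)\<close> assigns to the polynomial \<open>g\<close> the coefficient \<open>cfs ! g ! a\<close> at the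
  frequency \<open>J ! a\<close>; the frequencies of a single polynomial are those with nonzero coefficient.\<close>

definition recovers ::
    "nat \<Rightarrow> (nat \<Rightarrow> freq set) \<Rightarrow> (nat \<Rightarrow> freq \<Rightarrow> complex) \<Rightarrow>
       freq list \<times> complex list list \<Rightarrow> bool" where
  "recovers G I c out \<longleftrightarrow>
     (case out of (J, cfs) \<Rightarrow> distinct J \<and>
        (\<forall>g<G. I g = {J ! a | a. a < length J \<and> cfs ! g ! a \<noteq> 0} \<and>
               (\<forall>a<length J. J ! a \<in> I g \<longrightarrow> cfs ! g ! a = c g (J ! a))))"

text \<open>For sets of seeds that are not known to be measurable: some event contained in \<open>Q\<close> has
  probability at least \<open>p\<close>.  For measurable \<open>Q\<close> this is \<open>measure M Q \<ge> p\<close>.\<close>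

definition with_prob_at_least :: "'a measure \<Rightarrow> real \<Rightarrow> ('a \<Rightarrow> bool) \<Rightarrow> bool" where
  "with_prob_at_least M p Q \<longleftrightarrow> (\<exists>E\<in>sets M. measure M E \<ge> p \<and> (\<forall>x\<in>E. Q x))"

end

theory Submission
  imports Defs
begin

text \<open>
  The strategy is the uniform sparse FFT itself, with one detection iteration
  (\<open>r = 1\<close>), \<open>s_loc = s\<close>, lattices of prime sizes \<open>M = O(max s N)\<close> for the subroutine and
  \<open>M' = O(max (s * G) N)\<close> for the final coefficients, and \<open>L = O(log x)\<close> lattices in either place,
  where \<open>x = d * s * G / \<delta>\<close> and \<open>N\<close> is the width of \<open>\<Gamma>\<close>.  If no detection or decoding step goes wrong,
  the run is exact (\<open>run_recovers\<close>); such a seed is called good, and only two kinds of events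
  prevent a seed from being good.

  \<^emph>\<open>A projected coefficient is small at the random shift.\<close>  As a function of the shift it is a
  trigonometric polynomial with frequencies from \<open>\<Gamma>\<close>, one of whose coefficients has modulus at
  least \<open>m\<close>.  Such polynomials have small values with small probability, uniformly over all of them:
  for every \<open>\<epsilon>\<close> there is \<open>\<theta> > 0\<close>, depending on \<open>\<Gamma>\<close>, \<open>m\<close> and \<open>\<epsilon>\<close> only, with \<open>P(modulus \<le> \<theta>) \<le> \<epsilon>\<close>
  (\<open>trig_poly_small_ball\<close>).  In one variable this follows by splitting off a factor \<open>X - z\<close> at a point
  where the polynomial is small and induction on the degree; in several variables, by resampling one
  variable at a time.  Hence a single iteration detects all frequencies with high
  probability if the threshold is small compared to \<open>m\<close>, and threshold \<open>0\<close> serves every family of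
  polynomials, with \<open>m\<close> its smallest coefficient modulus.

  \<^emph>\<open>A candidate shares its bin with another frequency in half of the lattices.\<close>  Modulo a prime
  \<open>M > N\<close> distinct frequencies remain distinct, so two of them fall into the same bin of a random
  lattice with probability at most \<open>1 / M\<close>.  If \<open>M \<ge> 16 * s\<close>, a given candidate is hit in one lattice
  with probability at most \<open>1 / 16\<close>, hence in half of \<open>L\<close> independent lattices with probability at most
  \<open>2 ^ L * (1 / 16) ^ (L / 2) = 2 ^ - L\<close> (\<open>majority_collisions_bound\<close>); otherwise the majority vote
  returns the exact coefficient (\<open>majority_decoder_result\<close>).  The candidate sets met by a good
  run are determined by the polynomials and not by the seed, so a union bound over at most
  \<open>d * G * (s * G)^2\<close> pairs of a candidate and a polynomial applies; the same argument with
  \<open>M' \<ge> 16 * s * G\<close> covers the last step.  It remains to take \<open>2 ^ L \<ge> 3 * x ^ 3\<close>.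

  Primes of the required size come from a Chebyshev type argument
  (\<open>prime_in_multiplicative_interval\<close>): the least common multiple of \<open>1, ..., N\<close> is at least about
  \<open>2 ^ N\<close>, whereas without primes in \<open>(n, N]\<close> it would be at most about \<open>4 ^ n\<close>.

  The costs are counted for every seed and not only for the good ones: with one iteration, each
  step detects at most \<open>s * G\<close> frequencies whatever the samples are, so a candidate list has at most
  \<open>s * G * (N + 1)\<close> entries (\<open>worst_case\<close>).  The operation count so obtained is of the order
  \<open>d^2 * s^2 * G^2 * N * log^3\<close> for all seeds, which yields both complexity claims at once.
\<close>


section \<open>Programs, sorting and majority votes\<close>

lemma result_bind [simp]: "result (bind_prog P f) F = result (f (result P F)) F"
  by (induction P) auto

lemma locations_bind [simp]:
  "locations (bind_prog P f) F = locations P F \<union> locations (f (result P F)) F"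
  by (induction P) auto

lemma operations_bind [simp]:
  "operations (bind_prog P f) F = operations P F + operations (f (result P F)) F"
  by (induction P) auto

lemma charged_simps [simp]:
  "result (charged n x) F = x" "locations (charged n x) F = {}" "operations (charged n x) F = n"
  by (simp_all add: charged_def)

lemma sample_simps [simp]:
  "result (sample y) F = F y" "locations (sample y) F = {y}" "operations (sample y) F = 0"
  by (simp_all add: sample_def)

lemma mapP_simps [simp]:
  "result (mapP f xs) F = map (\<lambda>x. result (f x) F) xs"
  "locations (mapP f xs) F = (\<Union>x\<in>set xs. locations (f x) F)"
  "operations (mapP f xs) F = (\<Sum>x\<leftarrow>xs. operations (f x) F)"
  by (induction xs) auto

lemma inner_prod_result:
  "length a = length b \<Longrightarrow> result (inner_prod a b) F = (\<Sum>j<length a. a ! j * b ! j)"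
  by (induction a b rule: list_induct2) (simp_all add: sum.lessThan_Suc_shift del: sum.lessThan_Suc)

lemma inner_prod_locations [simp]: "locations (inner_prod a b) F = {}"
  by (induction a b rule: inner_prod.induct) auto

lemma inner_prod_operations: "operations (inner_prod a b) F \<le> 2 * length b"
  by (induction a b rule: inner_prod.induct) auto


lemma merge_desc_mset: "mset (result (merge_desc xs ys) F) = mset xs + mset ys"
  by (induction xs ys rule: merge_desc.induct) auto

lemma merge_desc_set: "set (result (merge_desc xs ys) F) = set xs \<union> set ys"
  using arg_cong[OF merge_desc_mset, of set_mset] by simp

lemma merge_desc_locations [simp]: "locations (merge_desc xs ys) F = {}"
  by (induction xs ys rule: merge_desc.induct) auto

lemma merge_desc_operations: "operations (merge_desc xs ys) F \<le> length xs + length ys"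
  by (induction xs ys rule: merge_desc.induct) auto

abbreviation decreasing :: "('k \<times> real) list \<Rightarrow> bool" where
  "decreasing \<equiv> sorted_wrt (\<lambda>x y. snd x \<ge> snd y)"

lemma merge_desc_decreasing:
  "decreasing xs \<Longrightarrow> decreasing ys \<Longrightarrow> decreasing (result (merge_desc xs ys) F)"
proof (induction xs ys rule: merge_desc.induct)
  case (3 x xs y ys)
  then show ?case by (fastforce simp: merge_desc_set)
qed auto

text \<open>On ties \<open>merge_desc\<close> prefers its first argument, which in \<open>sort_desc\<close> is the front part of the list.\<close>

lemma merge_desc_stable:
  "decreasing xs \<Longrightarrow> decreasing ys \<Longrightarrow>
    filter (\<lambda>x. snd x = a) (result (merge_desc xs ys) F) =
      filter (\<lambda>x. snd x = a) xs @ filter (\<lambda>x. snd x = a) ys"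
proof (induction xs ys rule: merge_desc.induct)
  case (3 x xs y ys)
  show ?case
  proof (cases "snd x \<ge> snd y")
    case True
    with 3 show ?thesis by auto
  next
    case False
    \<comment> \<open>As x is smaller than y, no entry of the first list ties with y.\<close>
    have "filter (\<lambda>z. snd z = a) (x # xs) = []" if "snd y = a"
      using 3(3) False that by (auto simp: filter_empty_conv)
    with False 3 show ?thesis by auto
  qed
qed auto

declare sort_desc.simps [simp del]

lemma sort_desc_mset: "mset (result (sort_desc xs) F) = mset xs"
proof (induction xs rule: sort_desc.induct)
  case (1 xs)
  have "mset (take (length xs div 2) xs) + mset (drop (length xs div 2) xs) = mset xs"
    by (metis append_take_drop_id mset_append)
  with 1 show ?case by (subst sort_desc.simps) (simp add: Let_def merge_desc_mset)
qed

lemma sort_desc_locations [simp]: "locations (sort_desc xs) F = {}"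
  by (induction xs rule: sort_desc.induct) (subst sort_desc.simps, simp add: Let_def)

lemma sort_desc_decreasing: "decreasing (result (sort_desc xs) F)"
proof (induction xs rule: sort_desc.induct)
  case (1 xs)
  have "decreasing xs" if "length xs \<le> 1"
    using that by (cases xs) auto
  with 1 show ?case by (subst sort_desc.simps) (simp add: Let_def merge_desc_decreasing)
qed

lemma sort_desc_stable:
  "filter (\<lambda>x. snd x = a) (result (sort_desc xs) F) = filter (\<lambda>x. snd x = a) xs"
proof (induction xs rule: sort_desc.induct)
  case (1 xs)
  have "filter (\<lambda>x. snd x = a) (take (length xs div 2) xs) @
      filter (\<lambda>x. snd x = a) (drop (length xs div 2) xs) = filter (\<lambda>x. snd x = a) xs"
    by (metis append_take_drop_id filter_append)
  with 1 show ?case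
    by (subst sort_desc.simps) (simp add: Let_def merge_desc_stable sort_desc_decreasing)
qed

lemma sort_desc_length: "length (result (sort_desc xs) F) = length xs"
  using arg_cong[OF sort_desc_mset, of size] by simp

text \<open>There are at most \<open>m\<close> levels of recursion, and each of them merges every entry once.\<close>

lemma sort_desc_operations:
  "length xs \<le> 2 ^ m \<Longrightarrow> operations (sort_desc xs) F \<le> length xs * m"
proof (induction m arbitrary: xs)
  case 0
  then show ?case by (subst sort_desc.simps) (simp add: Let_def)
next
  case (Suc m)
  let ?h = "length xs div 2"
  show ?case
  proof (cases "length xs \<le> 1")
    case True
    then show ?thesis by (subst sort_desc.simps) (simp add: Let_def)
  next
    case False
    define as where "as = result (sort_desc (take ?h xs)) F"
    define bs where "bs = result (sort_desc (drop ?h xs)) F"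
    have len: "length (take ?h xs) = ?h"
      by simp
    have "operations (sort_desc (take ?h xs)) F \<le> ?h * m"
      using Suc.IH[of "take ?h xs", unfolded len] Suc.prems by simp
    moreover have "operations (sort_desc (drop ?h xs)) F \<le> (length xs - ?h) * m"
      using Suc.IH[of "drop ?h xs"] Suc.prems by simp
    moreover have "operations (merge_desc as bs) F \<le> length xs"
      using merge_desc_operations[of as bs F] by (simp add: as_def bs_def sort_desc_length)
    moreover have "operations (sort_desc xs) F = operations (sort_desc (take ?h xs)) F +
        (operations (sort_desc (drop ?h xs)) F + operations (merge_desc as bs) F)"
      using False by (subst sort_desc.simps) (simp add: Let_def as_def bs_def)
    moreover have "?h * m + (length xs - ?h) * m = length xs * m"
      by (simp flip: add_mult_distrib)
    ultimately show ?thesis by simp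
  qed
qed

text \<open>The sorted list does not depend on the black box; an arbitrary one is fixed.\<close>

definition sorted_moduli :: "('k \<times> complex) list \<Rightarrow> ('k \<times> real) list" where
  "sorted_moduli cs = result (sort_desc (map (\<lambda>(k, c). (k, cmod c)) cs)) (\<lambda>_. [])"

lemma sort_desc_result_cong: "result (sort_desc xs) F = result (sort_desc xs) F'"
proof (induction xs rule: sort_desc.induct)
  case (1 xs)
  have m: "result (merge_desc as bs) F = result (merge_desc as bs) F'" for as bs :: "('a \<times> real) list"
    by (induction as bs rule: merge_desc.induct) auto
  show ?case using 1 by (subst (1 2) sort_desc.simps) (simp add: Let_def m)
qed

lemma select_largest_result:
  "result (select_largest n test cs) F = map fst (filter (\<lambda>x. test (snd x)) (take n (sorted_moduli cs)))"
proof -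
  have *: "result (sort_desc (map (\<lambda>x. (fst x, cmod (snd x))) cs)) F = sorted_moduli cs"
    by (simp add: sorted_moduli_def case_prod_unfold sort_desc_result_cong[of _ F "\<lambda>_. []"])
  have "concat (map (\<lambda>((k, a), b). if b then [k] else []) (zip xs (map (\<lambda>x. test (snd x)) xs)))
     = map fst (filter (\<lambda>x. test (snd x)) xs)" for xs :: "('a \<times> real) list"
    by (induction xs) auto
  then show ?thesis
    by (simp add: select_largest_def * case_prod_beta)
qed

lemma sorted_moduli_mset: "mset (sorted_moduli cs) = mset (map (\<lambda>(k, c). (k, cmod c)) cs)"
  by (simp add: sorted_moduli_def sort_desc_mset)

lemma sorted_moduli_set: "set (sorted_moduli cs) = (\<lambda>(k, c). (k, cmod c)) ` set cs"
  using arg_cong[OF sorted_moduli_mset, of set_mset] by auto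

lemma select_largest_locations [simp]: "locations (select_largest n test cs) F = {}"
  by (simp add: select_largest_def case_prod_beta)

lemma select_largest_length: "length (result (select_largest n test cs) F) \<le> n"
  using length_filter_le[of "\<lambda>x. test (snd x)" "take n (sorted_moduli cs)"]
  by (simp add: select_largest_result)

lemma select_largest_subset: "set (result (select_largest n test cs) F) \<subseteq> fst ` set cs"
  by (force simp: select_largest_result sorted_moduli_set dest!: in_set_takeD)

lemma select_largest_operations:
  assumes "length cs \<le> 2 ^ m"
  shows "operations (select_largest n test cs) F \<le> length cs * (m + 2)"
proof -
  let ?ms = "map (\<lambda>x. result (case x of (k, c) \<Rightarrow> charged 1 (k, cmod c)) F) cs"
  have s: "operations (sort_desc ?ms) F \<le> length cs * m"
    using sort_desc_operations[of ?ms m F] assms by simp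
  have "length (take n (result (sort_desc ?ms) F)) \<le> length cs"
    by (simp add: sort_desc_length)
  with s show ?thesis
    by (simp add: select_largest_def case_prod_beta sum_list_triv)
qed

lemma decreasing_split:
  "decreasing xs \<Longrightarrow> xs = filter (\<lambda>x. snd x > a) xs @ filter (\<lambda>x. snd x \<le> a) xs"
proof (induction xs)
  case (Cons x xs)
  show ?case
  proof (cases "snd x > a")
    case True
    with Cons show ?thesis by simp
  next
    case False
    with Cons.prems have "filter (\<lambda>x. snd x > a) xs = []" "filter (\<lambda>x. snd x \<le> a) xs = xs"
      by (auto simp: filter_empty_conv filter_id_conv)
    with False show ?thesis by simp
  qed
qed simp

text \<open>By stability the zeros end up at the end of the list in their original order.\<close>

lemma sorted_moduli_split:
  "sorted_moduli cs = filter (\<lambda>x. snd x > 0) (sorted_moduli cs) @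
     map (\<lambda>(k, c). (k, cmod c)) (filter (\<lambda>x. snd x = 0) cs)"
proof -
  have nn: "snd x \<ge> 0" if "x \<in> set (sorted_moduli cs)" for x
    using that by (auto simp: sorted_moduli_set)
  have "filter (\<lambda>x. snd x \<le> 0) (sorted_moduli cs) = filter (\<lambda>x. snd x = 0) (sorted_moduli cs)"
    using nn by (intro filter_cong) (auto intro: antisym)
  also have "\<dots> = filter (\<lambda>x. snd x = 0) (map (\<lambda>(k, c). (k, cmod c)) cs)"
    by (simp add: sorted_moduli_def sort_desc_stable)
  also have "\<dots> = map (\<lambda>(k, c). (k, cmod c)) (filter (\<lambda>x. snd x = 0) cs)"
    by (simp add: filter_map comp_def case_prod_beta)
  finally show ?thesis
    using decreasing_split[of "sorted_moduli cs" 0]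
    by (simp add: sorted_moduli_def sort_desc_decreasing)
qed

lemma sorted_moduli_nonzero:
  "length (filter (\<lambda>x. snd x > 0) (sorted_moduli cs)) = length (filter (\<lambda>x. snd x \<noteq> 0) cs)"
  "set (filter (\<lambda>x. snd x > 0) (sorted_moduli cs)) =
     (\<lambda>(k, c). (k, cmod c)) ` set (filter (\<lambda>x. snd x \<noteq> 0) cs)"
proof -
  have "mset (filter (\<lambda>x. snd x > 0) (sorted_moduli cs)) =
      mset (filter (\<lambda>x. snd x > 0) (map (\<lambda>(k, c). (k, cmod c)) cs))"
    by (simp add: mset_filter sorted_moduli_mset flip: mset_map)
  also have "filter (\<lambda>x. snd x > 0) (map (\<lambda>(k, c). (k, cmod c)) cs) =
      map (\<lambda>(k, c). (k, cmod c)) (filter (\<lambda>x. snd x \<noteq> 0) cs)"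
    by (simp add: filter_map comp_def case_prod_beta)
  finally have *: "mset (filter (\<lambda>x. snd x > 0) (sorted_moduli cs)) =
    mset (map (\<lambda>(k, c). (k, cmod c)) (filter (\<lambda>x. snd x \<noteq> 0) cs))" .
  show "length (filter (\<lambda>x. snd x > 0) (sorted_moduli cs)) = length (filter (\<lambda>x. snd x \<noteq> 0) cs)"
    using arg_cong[OF *, of size] by (simp only: size_mset length_map)
  show "set (filter (\<lambda>x. snd x > 0) (sorted_moduli cs)) =
     (\<lambda>(k, c). (k, cmod c)) ` set (filter (\<lambda>x. snd x \<noteq> 0) cs)"
    using arg_cong[OF *, of set_mset] by (metis list.set_map set_mset_mset)
qed

lemma select_largest_strict:
  assumes "0 \<le> \<theta>" and few: "length (filter (\<lambda>x. snd x \<noteq> 0) cs) \<le> n"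
    and gap: "\<And>k c. (k, c) \<in> set cs \<Longrightarrow> c \<noteq> 0 \<Longrightarrow> cmod c > \<theta>"
  shows "set (result (select_largest n (\<lambda>a. a > \<theta>) cs) F) = fst ` set (filter (\<lambda>x. snd x \<noteq> 0) cs)"
proof -
  let ?S = "filter (\<lambda>x. snd x > 0) (sorted_moduli cs)"
  have "take n (sorted_moduli cs) = ?S @ take (n - length ?S)
      (map (\<lambda>(k, c). (k, cmod c)) (filter (\<lambda>x. snd x = 0) cs))"
    using few by (subst sorted_moduli_split) (simp add: sorted_moduli_nonzero)
  moreover have "filter (\<lambda>x. snd x > \<theta>) ?S = ?S"
  proof (subst filter_id_conv, rule ballI)
    fix x assume "x \<in> set ?S"
    then show "snd x > \<theta>"
      unfolding sorted_moduli_nonzero using gap by auto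
  qed
  moreover have "filter (\<lambda>x. snd x > \<theta>) (take (n - length ?S)
      (map (\<lambda>(k, c). (k, cmod c)) (filter (\<lambda>x. snd x = 0) cs))) = []"
    using \<open>0 \<le> \<theta>\<close> by (auto simp: filter_empty_conv dest!: in_set_takeD)
  ultimately have "set (result (select_largest n (\<lambda>a. a > \<theta>) cs) F) = fst ` set ?S"
    by (simp add: select_largest_result)
  also have "\<dots> = fst ` set (filter (\<lambda>x. snd x \<noteq> 0) cs)"
    unfolding sorted_moduli_nonzero by (force simp: image_iff)
  finally show ?thesis .
qed

text \<open>For \<open>\<theta> = 0\<close> the test lets vanishing coefficients pass; which of them fill up the list is
  decided by stability of the sort, hence does not depend on the values of the other coefficients.\<close>

lemma select_largest_weak:
  assumes "0 \<le> \<theta>" and few: "length (filter (\<lambda>x. snd x \<noteq> 0) cs) \<le> n"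
    and gap: "\<And>k c. (k, c) \<in> set cs \<Longrightarrow> c \<noteq> 0 \<Longrightarrow> cmod c > \<theta>"
  shows "set (result (select_largest n (\<lambda>a. a \<ge> \<theta>) cs) F) = fst ` set (filter (\<lambda>x. snd x \<noteq> 0) cs) \<union>
    (if \<theta> = 0 then set (take (n - length (filter (\<lambda>x. snd x \<noteq> 0) cs))
       (map fst (filter (\<lambda>x. snd x = 0) cs))) else {})"
proof -
  let ?S = "filter (\<lambda>x. snd x > 0) (sorted_moduli cs)"
  let ?Z = "take (n - length ?S) (map (\<lambda>(k, c). (k, cmod c)) (filter (\<lambda>x. snd x = 0) cs))"
  have 1: "take n (sorted_moduli cs) = ?S @ ?Z"
    using few by (subst sorted_moduli_split) (simp add: sorted_moduli_nonzero)
  have 2: "filter (\<lambda>x. snd x \<ge> \<theta>) ?S = ?S"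
  proof (subst filter_id_conv, rule ballI)
    fix x assume "x \<in> set ?S"
    then show "snd x \<ge> \<theta>"
      unfolding sorted_moduli_nonzero using gap by (auto intro: less_imp_le)
  qed
  have 3: "filter (\<lambda>x. snd x \<ge> \<theta>) ?Z = (if \<theta> = 0 then ?Z else [])"
    using \<open>0 \<le> \<theta>\<close> by (auto simp: filter_empty_conv filter_id_conv dest!: in_set_takeD)
  have 4: "fst ` set ?S = fst ` set (filter (\<lambda>x. snd x \<noteq> 0) cs)"
    unfolding sorted_moduli_nonzero by (force simp: image_iff)
  have 5: "map fst ?Z = take (n - length ?S) (map fst (filter (\<lambda>x. snd x = 0) cs))"
    by (simp add: take_map case_prod_beta comp_def)
  have "set (result (select_largest n (\<lambda>a. a \<ge> \<theta>) cs) F) =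
      fst ` set ?S \<union> (if \<theta> = 0 then set (map fst ?Z) else {})"
    by (simp only: select_largest_result 1 filter_append 2 3) (simp add: image_Un)
  then show ?thesis unfolding 4 5 by (simp add: sorted_moduli_nonzero)
qed

lemma majority_locations [simp]: "locations (majority c n xs) F = {}"
  by (induction c n xs rule: majority.induct) auto

lemma majority_operations: "operations (majority c n xs) F \<le> 3 * length xs"
  by (induction c n xs rule: majority.induct) auto

text \<open>Invariant of the Boyer-Moore vote: the \<open>n\<close> uncancelled copies of the current candidate, followed by
  the remaining entries, still form a list in which \<open>v\<close> has the majority, since each cancellation
  removes two different values.\<close>

lemma majority_result_aux:
  "length (filter (\<lambda>y. y = v) xs) * 2 + (if c = v then n else 0) * 2 > length xs + n \<Longrightarrow>
    result (majority c n xs) F = v"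
  by (induction c n xs rule: majority.induct) (auto split: if_splits)

lemma majority_result:
  "2 * length (filter (\<lambda>y. y = v) xs) > length xs \<Longrightarrow> result (majority 0 0 xs) F = v"
  by (rule majority_result_aux) auto


section \<open>The fast Fourier transform\<close>

lemma operations_bind_le:
  "operations P F \<le> a \<Longrightarrow> operations (f (result P F)) F \<le> b \<Longrightarrow> operations (bind_prog P f) F \<le> a + b"
  by simp

lemma butterfly_locations [simp]: "locations (butterfly w t es xs) F = {}"
  by (induction w t es xs rule: butterfly.induct) (auto split: prod.split)

lemma butterfly_operations: "operations (butterfly w t es xs) F \<le> 4 * length es"
  by (induction w t es xs rule: butterfly.induct) (auto split: prod.split)

lemma butterfly_result:
  "length es = n \<Longrightarrow> length os = n \<Longrightarrow>
    result (butterfly w t es os) F =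
      (map (\<lambda>k. es ! k + t * w ^ k * os ! k) [0..<n], map (\<lambda>k. es ! k - t * w ^ k * os ! k) [0..<n])"
proof (induction n arbitrary: t es os)
  case (Suc n)
  obtain e es' x os' where eq: "es = e # es'" "os = x # os'"
    using Suc.prems by (cases es; cases os) auto
  have upt: "[0..<Suc n] = 0 # map Suc [0..<n]"
    by (simp add: map_Suc_upt upt_conv_Cons del: upt_Suc)
  have "result (butterfly w (t * w) es' os') F =
      (map (\<lambda>k. es' ! k + t * w * w ^ k * os' ! k) [0..<n],
       map (\<lambda>k. es' ! k - t * w * w ^ k * os' ! k) [0..<n])"
    using Suc.prems by (intro Suc.IH) (simp_all add: eq)
  then show ?case
    unfolding eq upt by (simp add: comp_def mult.assoc)
qed simp

lemma fft_pow2_locations [simp]: "locations (fft_pow2 m w xs) F = {}"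
  by (induction m w xs rule: fft_pow2.induct) (auto split: prod.split)

lemma fft_pow2_result:
  assumes "length xs = 2 ^ m" and "m > 0 \<Longrightarrow> w ^ (2 ^ (m - 1)) = - 1"
  shows "result (fft_pow2 m w xs) F = map (\<lambda>k. \<Sum>l<2 ^ m. xs ! l * w ^ (l * k)) [0..<2 ^ m]"
  using assms
proof (induction m arbitrary: w xs)
  case 0
  then show ?case by (simp add: list_eq_iff_nth_eq)
next
  case (Suc m)
  let ?n = "2 ^ m :: nat"
  have wn: "w ^ ?n = -1" using Suc.prems by simp
  have w2: "(w * w) ^ (2 ^ (m - 1)) = - 1" if "m > 0"
  proof -
    have "(w * w) ^ (2 ^ (m - 1)) = w ^ (2 * 2 ^ (m - 1))"
      by (simp add: power_mult power2_eq_square)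
    also have "2 * 2 ^ (m - 1) = ?n" using that by (simp flip: power_Suc)
    finally show ?thesis using wn by simp
  qed
  define E where "E k = (\<Sum>l<?n. xs ! (2 * l) * w ^ (2 * l * k))" for k
  define D where "D k = (\<Sum>l<?n. xs ! (2 * l + 1) * w ^ (2 * l * k))" for k
  have sq: "(w * w) ^ j = w ^ (2 * j)" for j
    by (simp add: power_mult power2_eq_square)
  have es: "result (fft_pow2 m (w * w) (map (\<lambda>i. xs ! (2 * i)) [0..<?n])) F = map E [0..<?n]"
    using w2 by (subst Suc.IH) (auto simp: E_def sq mult.assoc)
  have os: "result (fft_pow2 m (w * w) (map (\<lambda>i. xs ! (2 * i + 1)) [0..<?n])) F = map D [0..<?n]"
    using w2 by (subst Suc.IH) (auto simp: D_def sq mult.assoc)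
  have by_parity: "(\<Sum>l<2 * ?n. xs ! l * w ^ (l * k)) = E k + w ^ k * D k" for k
  proof -
    have halves: "(\<Sum>l<2 * j. f l) = (\<Sum>l<j. f (2 * l)) + (\<Sum>l<j. f (2 * l + 1))"
      for f :: "nat \<Rightarrow> complex" and j
      by (induction j) auto
    show ?thesis
      by (subst halves) (simp add: E_def D_def sum_distrib_left power_add algebra_simps)
  qed
  have w2n: "w ^ (2 * ?n) = 1"
    by (simp add: mult.commute[of 2] power_mult wn)
  have per: "E (?n + k) = E k" "D (?n + k) = D k" for k
  proof -
    have "w ^ (2 * l * (?n + k)) = w ^ (2 * l * k)" for l
    proof -
      have "2 * l * (?n + k) = (2 * ?n) * l + 2 * l * k" by (simp add: algebra_simps)
      then show ?thesis by (simp add: power_add power_mult[of w "2 * ?n" l] w2n)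
    qed
    then show "E (?n + k) = E k" "D (?n + k) = D k" by (simp_all add: E_def D_def)
  qed
  have "result (fft_pow2 (Suc m) w xs) F =
      map (\<lambda>k. E k + w ^ k * D k) [0..<?n] @ map (\<lambda>k. E k - w ^ k * D k) [0..<?n]"
    by (simp add: es os[simplified] butterfly_result[of _ ?n] cong: map_cong)
  also have "\<dots> = map (\<lambda>k. E k + w ^ k * D k) [0..<2 * ?n]"
  proof (rule nth_equalityI)
    fix i assume "i < length (map (\<lambda>k. E k + w ^ k * D k) [0..<?n] @ map (\<lambda>k. E k - w ^ k * D k) [0..<?n])"
    then have i: "i < 2 * ?n" by simp
    show "(map (\<lambda>k. E k + w ^ k * D k) [0..<?n] @ map (\<lambda>k. E k - w ^ k * D k) [0..<?n]) ! i
        = map (\<lambda>k. E k + w ^ k * D k) [0..<2 * ?n] ! i"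
    proof (cases "i < ?n")
      case False
      then obtain j where j: "i = ?n + j" using le_Suc_ex by (metis not_less)
      then show ?thesis using i by (simp add: nth_append per power_add wn)
    qed (simp add: nth_append)
  qed simp
  finally show ?case by (simp add: by_parity del: upt_Suc)
qed

lemma fft_pow2_length: "length xs = 2 ^ m \<Longrightarrow> length (result (fft_pow2 m w xs) F) = 2 ^ m"
proof (induction m arbitrary: w xs)
  case (Suc m)
  then show ?case by (simp add: butterfly_result[of _ "2^m"])
qed simp

text \<open>The recursion \<open>a(m+1) = 2 * a(m) + 4 * 2^m + 1\<close> has the additive term 1 absorbed by the shift
  \<open>a(m) + 1\<close>.\<close>

lemma fft_pow2_operations: "operations (fft_pow2 m w xs) F + 1 \<le> 2 ^ m * (2 * m + 1)"
proof (induction m arbitrary: w xs)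
  case (Suc m)
  define es where "es = result (fft_pow2 m (w * w) (map (\<lambda>i. xs ! (2 * i)) [0..<2 ^ m])) F"
  define os where "os = result (fft_pow2 m (w * w) (map (\<lambda>i. xs ! Suc (2 * i)) [0..<2 ^ m])) F"
  have "length es = 2 ^ m"
    unfolding es_def by (rule fft_pow2_length) simp
  then have "operations (butterfly w 1 es os) F \<le> 4 * 2 ^ m"
    using butterfly_operations[of w 1 es os F] by simp
  moreover have "operations (fft_pow2 (Suc m) w xs) F =
      1 + operations (fft_pow2 m (w * w) (map (\<lambda>i. xs ! (2 * i)) [0..<2 ^ m])) F +
      operations (fft_pow2 m (w * w) (map (\<lambda>i. xs ! Suc (2 * i)) [0..<2 ^ m])) F +
      operations (butterfly w 1 es os) F"
    by (simp add: es_def os_def split: prod.split)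
  moreover have "2 ^ Suc m * (2 * Suc m + 1) = 2 * (2 ^ m * (2 * m + 1)) + 4 * 2 ^ m"
    by (simp add: algebra_simps)
  ultimately show ?case
    using Suc[of "w * w" "map (\<lambda>i. xs ! (2 * i)) [0..<2 ^ m]"]
      Suc[of "w * w" "map (\<lambda>i. xs ! Suc (2 * i)) [0..<2 ^ m]"] by linarith
qed simp


lemma cis_multiple_2pi [simp]: "cis (2 * pi * of_int j) = 1"
  by (simp add: complex_eq_iff cos_int_2pin sin_int_2pin)

lemma cis_period: "cis (x + 2 * pi * of_int j) = cis x"
  by (simp flip: cis_mult)

lemma cis_eq_1_iff: "cis x = 1 \<longleftrightarrow> (\<exists>j::int. x = 2 * pi * of_int j)"
proof
  assume "cis x = 1"
  then have "cos x = 1" by (simp add: complex_eq_iff)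
  then show "\<exists>j::int. x = 2 * pi * of_int j"
    by (auto simp: cos_one_2pi_int)
qed auto

lemma sum_roots_of_unity:
  fixes j :: int
  assumes "N > 0"
  shows "(\<Sum>k<N. cis (2 * pi * real k * of_int j / real N)) = (if int N dvd j then of_nat N else 0)"
proof -
  let ?z = "cis (2 * pi * of_int j / real N)"
  have z: "cis (2 * pi * real k * of_int j / real N) = ?z ^ k" for k
    by (subst Complex.DeMoivre) (simp add: mult_ac)
  have "?z ^ N = 1"
    using assms by (simp add: Complex.DeMoivre)
  have "?z = 1 \<longleftrightarrow> int N dvd j"
  proof
    assume "?z = 1"
    then obtain m :: int where "2 * pi * of_int j / real N = 2 * pi * of_int m"
      by (auto simp: cis_eq_1_iff)
    then have "real_of_int j = of_int m * real N" using assms by (simp add: field_simps)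
    then have "j = m * int N" by (metis of_int_eq_iff of_int_mult of_int_of_nat_eq)
    then show "int N dvd j" by simp
  next
    assume "int N dvd j"
    then obtain m where "j = int N * m" by blast
    then have "2 * pi * of_int j / real N = 2 * pi * of_int m" using assms by simp
    then show "?z = 1" by simp
  qed
  moreover have "(\<Sum>k<N. ?z ^ k) = 0" if "?z \<noteq> 1"
    using that \<open>?z ^ N = 1\<close> by (simp add: geometric_sum)
  moreover have "(\<Sum>k<N. ?z ^ k) = of_nat N" if "?z = 1"
    by (simp only: that) simp
  ultimately show ?thesis unfolding z by auto
qed

text \<open>Convolution theorem: after expanding the products, the sum over \<open>i\<close> is a sum of roots of unity
  which vanishes unless \<open>l + j\<close> is congruent to \<open>k\<close>.\<close>

lemma cyclic_convolution:
  fixes A B :: "nat \<Rightarrow> complex"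
  assumes "N > 0" "k < N" and w: "w = cis (- 2 * pi / real N)"
  shows "(\<Sum>i<N. ((\<Sum>l<N. A l * w ^ (l * i)) * (\<Sum>j<N. B j * w ^ (j * i))) * cnj w ^ (i * k)) =
    of_nat N * (\<Sum>l<N. A l * B (if l \<le> k then k - l else N + k - l))" (is "?L = _")
proof -
  have pw: "w ^ (l * i) * w ^ (j * i) * cnj w ^ (i * k) =
      cis (2 * pi * real i * of_int (int k - int l - int j) / real N)" for l j i
  proof -
    have "w ^ (l * i) * w ^ (j * i) * cnj w ^ (i * k) =
      cis (real (l * i) * (- 2 * pi / real N) + real (j * i) * (- 2 * pi / real N)
        + real (i * k) * (2 * pi / real N))"
      by (simp add: w cis_cnj Complex.DeMoivre cis_mult)
    also have "real (l * i) * (- 2 * pi / real N) + real (j * i) * (- 2 * pi / real N)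
        + real (i * k) * (2 * pi / real N) = 2 * pi * real i * of_int (int k - int l - int j) / real N"
      using assms by (simp add: field_simps)
    finally show ?thesis .
  qed
  have product: "(\<Sum>l<N. f l) * (\<Sum>j<N. g j) * c = (\<Sum>l<N. \<Sum>j<N. f l * g j * c)"
    for f g :: "nat \<Rightarrow> complex" and c
    by (subst sum_product) (simp add: sum_distrib_right)
  have "?L = (\<Sum>i<N. \<Sum>l<N. \<Sum>j<N. A l * B j * (w ^ (l * i) * w ^ (j * i) * cnj w ^ (i * k)))"
    unfolding product by (simp add: mult_ac)
  also have "\<dots> = (\<Sum>l<N. \<Sum>i<N. \<Sum>j<N. A l * B j * (w ^ (l * i) * w ^ (j * i) * cnj w ^ (i * k)))"
    by (rule sum.swap)
  also have "\<dots> = (\<Sum>l<N. \<Sum>j<N. \<Sum>i<N. A l * B j * (w ^ (l * i) * w ^ (j * i) * cnj w ^ (i * k)))"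
    by (intro sum.cong refl sum.swap)
  also have "\<dots> = (\<Sum>l<N. \<Sum>j<N. A l * B j * (if int N dvd (int k - int l - int j) then of_nat N else 0))"
    unfolding pw sum_distrib_left[symmetric] by (simp only: sum_roots_of_unity[OF \<open>N > 0\<close>])
  also have "\<dots> = (\<Sum>l<N. of_nat N * (A l * B (if l \<le> k then k - l else N + k - l)))"
  proof (rule sum.cong[OF refl])
    fix l assume "l \<in> {..<N}"
    then have l: "l < N" by simp
    let ?j = "if l \<le> k then k - l else N + k - l"
    have "int N dvd (int k - int l - int j) \<longleftrightarrow> j = ?j" if "j < N" for j
    proof
      assume "int N dvd (int k - int l - int j)"
      then obtain m where m: "int k - int l - int j = int N * m" by blast
      \<comment> \<open>The difference lies strictly between -2 N and N, so m is 0 or -1.\<close>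
      have "m < 1"
        using m \<open>k < N\<close> \<open>N > 0\<close> by (smt (verit) mult_le_cancel_left1 of_nat_0_le_iff of_nat_less_iff)
      moreover have "m > - 2"
      proof (rule ccontr)
        assume "\<not> m > - 2"
        then have "int N * m \<le> int N * (- 2)" by (intro mult_left_mono) auto
        with m l that show False by linarith
      qed
      ultimately have "m = 0 \<or> m = - 1" by linarith
      then show "j = ?j" using m l that \<open>k < N\<close> by auto
    next
      assume "j = ?j"
      then show "int N dvd (int k - int l - int j)"
        using l \<open>k < N\<close> by (auto simp: of_nat_diff)
    qed
    moreover have "?j < N" using \<open>k < N\<close> l by auto
    ultimately have "(\<Sum>j<N. A l * B j * (if int N dvd (int k - int l - int j) then of_nat N else 0)) =
        (\<Sum>j<N. if j = ?j then of_nat N * (A l * B ?j) else 0)"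
      by (intro sum.cong) auto
    also have "\<dots> = of_nat N * (A l * B ?j)"
      using \<open>?j < N\<close> by (subst sum.delta) auto
    finally show "(\<Sum>j<N. A l * B j * (if int N dvd (int k - int l - int j) then of_nat N else 0)) =
      of_nat N * (A l * B ?j)" .
  qed
  finally show ?thesis by (simp add: sum_distrib_left)
qed

text \<open>This is \<open>2 * l * k = l^2 + k^2 - (k - l)^2\<close>, with \<open>\<bar>k - l\<bar>\<close> written in terms of the truncated
  subtraction.\<close>

lemma chirp_identity:
  assumes "n > 0"
  shows "cis (- pi * real (k * k) / real n) * cis (- pi * real (l * l) / real n)
     * cnj (cis (- pi * real ((if l \<le> k then k - l else l - k) * (if l \<le> k then k - l else l - k)) / real n))
     = cis (- 2 * pi * real (l * k) / real n)"
proof -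
  have "real ((if l \<le> k then k - l else l - k) * (if l \<le> k then k - l else l - k)) = (real k - real l)\<^sup>2"
    by (auto simp: of_nat_diff power2_eq_square algebra_simps)
  then have "cis (- pi * real (k * k) / real n) * cis (- pi * real (l * l) / real n)
     * cnj (cis (- pi * real ((if l \<le> k then k - l else l - k) * (if l \<le> k then k - l else l - k)) / real n))
     = cis (- pi * real (k * k) / real n + - pi * real (l * l) / real n + pi * (real k - real l)\<^sup>2 / real n)"
    by (simp add: cis_cnj cis_mult)
  also have "- pi * real (k * k) / real n + - pi * real (l * l) / real n + pi * (real k - real l)\<^sup>2 / real n
     = - 2 * pi * real (l * k) / real n"
    using assms by (simp add: field_simps power2_eq_square)
  finally show ?thesis .
qed

text \<open>By \<open>chirp_identity\<close> the transform is a chirp times the convolution of \<open>a\<close> and \<open>b\<close>.  A cyclic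
  convolution of length \<open>N \<ge> 2 * n\<close> computes it: \<open>b'\<close> stores \<open>b (l - k)\<close> for \<open>l > k\<close> at the positions
  \<open>N + k - l\<close>, and the zeros between both halves keep them apart.\<close>

lemma fft_result:
  assumes "length xs = n" "n > 0"
  shows "result (fft xs) F =
    map (\<lambda>k. \<Sum>l<n. xs ! l * cis (- 2 * pi * real (l * k) / real n)) [0..<n]"
proof -
  define m where "m = (LEAST m. 2 * n \<le> 2 ^ m)"
  define N :: nat where "N = 2 ^ m"
  have "2 * n \<le> 2 ^ (2 * n)" by (simp add: less_imp_le)
  then have N2: "2 * n \<le> N" unfolding N_def m_def by (rule LeastI)
  then have "N > 1" "N > 0" using assms by auto
  then have "m > 0" by (auto simp: N_def intro!: Nat.gr0I)
  define ch where "ch j = cis (- pi * real (j * j) / real n)" for j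
  define w where "w = cis (- 2 * pi / real N)"
  have wh: "w ^ (2 ^ (m - 1)) = - 1"
  proof -
    have "real N = 2 * 2 ^ (m - 1)"
      using \<open>m > 0\<close> by (simp add: N_def flip: power_Suc)
    then have "w ^ (2 ^ (m - 1)) = cis (- pi)"
      by (simp add: w_def Complex.DeMoivre)
    then show ?thesis by (simp add: complex_eq_iff)
  qed
  then have wh': "cnj w ^ (2 ^ (m - 1)) = - 1"
    by (metis complex_cnj_power complex_cnj_minus complex_cnj_one)
  define a where "a = map (\<lambda>j. xs ! j * ch j) [0..<n] @ replicate (N - n) 0"
  define b where "b = map (\<lambda>j. cnj (ch j)) [0..<n]"
  define b' where "b' = b @ replicate (N - 2 * n + 1) 0 @ rev (tl b)"
  have la: "length a = 2 ^ m" using N2 by (simp add: a_def N_def)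
  have lb: "length b' = 2 ^ m" using N2 assms by (simp add: b'_def b_def N_def)
  define fa where "fa = map (\<lambda>k. \<Sum>l<N. a ! l * w ^ (l * k)) [0..<N]"
  define fb where "fb = map (\<lambda>k. \<Sum>l<N. b' ! l * w ^ (l * k)) [0..<N]"
  define cc where "cc = map (\<lambda>k. \<Sum>i<N. (fa ! i * fb ! i) * cnj w ^ (i * k)) [0..<N]"
  have fa: "result (fft_pow2 m w a) F = fa"
    unfolding fa_def N_def by (rule fft_pow2_result[OF la wh])
  have fb: "result (fft_pow2 m w b') F = fb"
    unfolding fb_def N_def by (rule fft_pow2_result[OF lb wh])
  have z: "map (\<lambda>x. result (case x of (x, y) \<Rightarrow> charged 1 (x * y)) F) (zip fa fb)
      = map (\<lambda>i. fa ! i * fb ! i) [0..<N]"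
    by (rule nth_equalityI) (auto simp: fa_def fb_def)
  have cc: "result (fft_pow2 m (cnj w) (map (\<lambda>i. fa ! i * fb ! i) [0..<N])) F = cc"
    unfolding cc_def N_def by (subst fft_pow2_result) (use wh' in auto)
  have chm: "map (\<lambda>j. xs ! j * map (\<lambda>j. ch j) [0..<n] ! j) [0..<n] = map (\<lambda>j. xs ! j * ch j) [0..<n]"
    "map (\<lambda>j. cnj (map (\<lambda>j. ch j) [0..<n] ! j)) [0..<n] = b"
    by (auto simp: b_def)
  have "result (fft xs) F = map (\<lambda>k. map (\<lambda>j. ch j) [0..<n] ! k * cc ! k / of_nat N) [0..<n]"
    unfolding fft_def Let_def assms(1) m_def[symmetric] N_def[symmetric]
    by (simp only: result_bind mapP_simps charged_simps ch_def[symmetric] chm a_def[symmetric]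
        b'_def[symmetric] w_def[symmetric] fa fb z cc)
  also have "\<dots> = map (\<lambda>k. \<Sum>l<n. xs ! l * cis (- 2 * pi * real (l * k) / real n)) [0..<n]"
  proof (rule map_cong[OF refl])
    fix k assume "k \<in> set [0..<n]"
    then have k: "k < n" by simp
    with N2 have kN: "k < N" by simp
    have "cc ! k = of_nat N * (\<Sum>l<N. a ! l * b' ! (if l \<le> k then k - l else N + k - l))"
      using cyclic_convolution[OF \<open>N > 0\<close> kN w_def, of "\<lambda>l. a ! l" "\<lambda>l. b' ! l"] kN
      by (simp add: cc_def fa_def fb_def)
    also have "(\<Sum>l<N. a ! l * b' ! (if l \<le> k then k - l else N + k - l)) =
        (\<Sum>l<n. a ! l * b' ! (if l \<le> k then k - l else N + k - l))"
      using N2 by (intro sum.mono_neutral_right) (auto simp: a_def nth_append)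
    also have "\<dots> = (\<Sum>l<n. xs ! l * ch l * cnj (ch (if l \<le> k then k - l else l - k)))"
    proof (rule sum.cong[OF refl])
      fix l assume "l \<in> {..<n}"
      then have l: "l < n" by simp
      have "b' ! (k - l) = cnj (ch (k - l))" if "l \<le> k"
        using k by (simp add: b'_def b_def nth_append)
      moreover have "b' ! (N + k - l) = cnj (ch (l - k))" if "\<not> l \<le> k"
      proof -
        have len: "length (b @ replicate (N - 2 * n + 1) 0) = N - n + 1"
          using N2 by (simp add: b_def)
        have "\<not> N + k - l < N - n + 1" "N + k - l - (N - n + 1) = n - 1 - (l - k)"
          using that l k N2 by auto
        then have "b' ! (N + k - l) = rev (tl b) ! (n - 1 - (l - k))"
          unfolding b'_def append_assoc[symmetric] nth_append[of "b @ _"] len by simp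
        also have "\<dots> = tl b ! (l - k - 1)"
          using that l k by (subst rev_nth) (auto simp: b_def intro!: arg_cong[of _ _ "(!) _"])
        also have "\<dots> = cnj (ch (l - k))"
          using that l k by (subst nth_tl) (auto simp: b_def Suc_diff_Suc)
        finally show ?thesis .
      qed
      ultimately show "a ! l * b' ! (if l \<le> k then k - l else N + k - l) =
          xs ! l * ch l * cnj (ch (if l \<le> k then k - l else l - k))"
        using l by (auto simp: a_def nth_append)
    qed
    finally have "ch k * cc ! k / of_nat N =
        ch k * (\<Sum>l<n. xs ! l * ch l * cnj (ch (if l \<le> k then k - l else l - k)))"
      using \<open>N > 0\<close> by simp
    also have "\<dots> = (\<Sum>l<n. xs ! l * (ch k * ch l * cnj (ch (if l \<le> k then k - l else l - k))))"
      by (simp add: sum_distrib_left mult_ac)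
    also have "\<dots> = (\<Sum>l<n. xs ! l * cis (- 2 * pi * real (l * k) / real n))"
      unfolding ch_def using chirp_identity[OF \<open>n > 0\<close>] by (simp only:)
    finally show "map (\<lambda>j. ch j) [0..<n] ! k * cc ! k / of_nat N =
        (\<Sum>l<n. xs ! l * cis (- 2 * pi * real (l * k) / real n))"
      using k by simp
  qed
  finally show ?thesis .
qed

lemma fft_locations [simp]: "locations (fft xs) F = {}"
  by (simp add: fft_def Let_def case_prod_beta)

text \<open>Three transforms of length \<open>N \<le> 4 * n\<close> contribute \<open>24 * n * m + 12 * n\<close>; the remaining steps are
  linear.\<close>

lemma fft_operations:
  assumes "length xs > 0" "2 * length xs \<le> 2 ^ e"
  shows "operations (fft xs) F \<le> length xs * (24 * e + 30)"
proof -
  let ?n = "length xs"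
  define m where "m = (LEAST m. 2 * ?n \<le> 2 ^ m)"
  define N :: nat where "N = 2 ^ m"
  have "m \<le> e" unfolding m_def using assms(2) by (rule Least_le)
  have "2 * ?n \<le> 2 ^ m" unfolding m_def using assms(2) by (rule LeastI)
  have "m > 0"
  proof (rule ccontr)
    assume "\<not> m > 0"
    with \<open>2 * ?n \<le> 2 ^ m\<close> have "2 * ?n \<le> 1" by simp
    with assms(1) show False by linarith
  qed
  have "\<not> 2 * ?n \<le> 2 ^ (m - 1)"
    using \<open>m > 0\<close> unfolding m_def by (intro not_less_Least) auto
  then have N4: "N \<le> 4 * ?n"
    using \<open>m > 0\<close> by (cases m) (auto simp: N_def)
  have p: "operations (fft_pow2 m w ys) F \<le> N * (2 * m + 1)" for w ys
    using fft_pow2_operations[of m w ys F] by (simp add: N_def)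
  have zl: "length (zip (result (fft_pow2 m w ys) F) zs) \<le> N" if "length ys = N" for w ys and zs :: "complex list"
    using fft_pow2_length[of ys m w F] that by (simp add: N_def)
  have zs: "(\<Sum>x\<leftarrow>zs. operations (case x of (x, y) \<Rightarrow> charged 1 (x * y)) F) = length zs"
    for zs :: "(complex \<times> complex) list"
    by (induction zs) auto
  have "operations (fft xs) F \<le> 5 * ?n + (?n + (?n + (4 + (N * (2 * m + 1) + (N * (2 * m + 1) +
      (N + (1 + (N * (2 * m + 1) + 2 * ?n))))))))"
    unfolding fft_def Let_def m_def[symmetric] N_def[symmetric]
    apply (intro operations_bind_le p)
    apply (simp_all only: mapP_simps(3) charged_simps(3) sum_list_triv length_upt zs)
    subgoal by simp
    subgoal by simp
    subgoal by simp
    subgoal by (rule zl) (use \<open>2 * ?n \<le> 2 ^ m\<close> in \<open>simp add: N_def\<close>)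
    by simp_all
  also have "\<dots> \<le> 9 * ?n + 5 + 4 * ?n * (6 * m + 4)"
  proof -
    have "3 * (N * (2 * m + 1)) + N = N * (6 * m + 4)" by (simp add: algebra_simps)
    moreover have "N * (6 * m + 4) \<le> 4 * ?n * (6 * m + 4)" by (intro mult_right_mono N4) auto
    ultimately show ?thesis by linarith
  qed
  also have "\<dots> \<le> ?n * (24 * m + 30)"
    using assms(1) by (simp add: algebra_simps Suc_le_eq)
  also have "\<dots> \<le> ?n * (24 * e + 30)" using \<open>m \<le> e\<close> by simp
  finally show ?thesis .
qed


section \<open>Primes in multiplicative intervals\<close>

lemma prod_primes_dvd:
  fixes x :: nat
  assumes "finite B" "\<And>p. p \<in> B \<Longrightarrow> prime p" "\<And>p. p \<in> B \<Longrightarrow> p dvd x"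
  shows "(\<Prod>p\<in>B. p) dvd x"
  using assms
proof (induction B rule: finite_induct)
  case (insert p B)
  have "coprime p (\<Prod>p\<in>B. p)"
    using insert by (intro prod_coprime_right primes_coprime) auto
  then show ?case using insert by (simp add: divides_mult)
qed simp

text \<open>Erdoes' induction: the primes in \<open>(k + 1, 2 * k + 1]\<close> divide the binomial coefficient
  \<open>(2 * k + 1) choose k\<close>, which is at most \<open>4 ^ k\<close> because it occurs twice in a row with sum
  \<open>2 * 4 ^ k\<close>.\<close>

lemma primorial_bound: "(\<Prod>p | prime p \<and> p \<le> n. p) \<le> (4::nat) ^ n"
proof (induction n rule: less_induct)
  case (less n)
  \<comment> \<open>An even number above 2 is not prime, so only odd n need the binomial coefficient.\<close>
  consider "n \<le> 1" | "n = 2" | "n > 2" "even n" | k where "k \<ge> 1" "n = 2 * k + 1"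
  proof (cases "even n")
    case True
    then show thesis using that(1-3) by (cases "n \<le> 1"; cases "n = 2") auto
  next
    case False
    then obtain k where "n = 2 * k + 1" by (elim oddE)
    then show thesis using that(1) that(4)[of k] by (cases "k = 0") auto
  qed
  then show ?case
  proof cases
    case 1
    then have "{p. prime p \<and> p \<le> n} = {}" by (auto dest!: prime_ge_2_nat)
    then show ?thesis by (simp only: prod.empty) simp
  next
    case 2
    have "{p. prime p \<and> p \<le> (2::nat)} = {2}" using prime_ge_2_nat by (auto intro: antisym)
    with 2 show ?thesis by simp
  next
    case 3
    then have "\<not> prime n" using prime_odd_nat by blast
    then have "prime p \<and> p \<le> n \<longleftrightarrow> prime p \<and> p \<le> n - 1" for p
      using le_antisym[of p n] by (cases "p = n") (blast, linarith)
    then have eq: "{p. prime p \<and> p \<le> n} = {p. prime p \<and> p \<le> n - 1}"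
      by (rule Collect_cong)
    have "(\<Prod>p | prime p \<and> p \<le> n. p) \<le> 4 ^ (n - 1)"
      unfolding eq by (rule less) (use 3 in simp)
    also have "\<dots> \<le> 4 ^ n" by (rule power_increasing) auto
    finally show ?thesis .
  next
    case 4
    let ?A = "{p. prime p \<and> p \<le> k + 1}" and ?B = "{p::nat. prime p \<and> k + 1 < p \<and> p \<le> 2 * k + 1}"
    have fin: "finite ?A" "finite ?B" by auto
    have "(\<Prod>p\<in>?B. p) dvd ((2 * k + 1) choose k)"
    proof (rule prod_primes_dvd)
      fix p assume "p \<in> ?B"
      then have p: "prime p" "k + 1 < p" "p \<le> 2 * k + 1" by auto
      have "p dvd fact (2 * k + 1)" using p by (simp only: prime_dvd_fact_iff)
      also have "fact (2 * k + 1) = fact k * fact (k + 1) * ((2 * k + 1) choose k)"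
        using binomial_fact_lemma[of k "2 * k + 1"] by (simp add: mult_ac)
      finally have "p dvd fact k \<or> p dvd fact (k + 1) \<or> p dvd ((2 * k + 1) choose k)"
        by (simp only: prime_dvd_mult_iff[OF p(1)] disj_assoc)
      moreover have "\<not> p dvd fact k" "\<not> p dvd fact (k + 1)"
        using p(2) by (simp_all add: prime_dvd_fact_iff[OF p(1)] del: fact_Suc)
      ultimately show "p dvd ((2 * k + 1) choose k)" by blast
    qed auto
    then have "(\<Prod>p\<in>?B. p) \<le> ((2 * k + 1) choose k)" by (rule dvd_imp_le) simp
    also have "\<dots> \<le> 4 ^ k"
    proof -
      have "2 * k + 1 - k = k + 1" "k \<le> 2 * k + 1" by simp_all
      then have sym: "(2 * k + 1) choose (k + 1) = (2 * k + 1) choose k"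
        using binomial_symmetric[of k "2 * k + 1"] by (simp only:)
      have "(\<Sum>i\<in>{k, k + 1}. f i) = f k + f (k + 1)" for f :: "nat \<Rightarrow> nat" by simp
      then have "2 * ((2 * k + 1) choose k) = (\<Sum>i\<in>{k, k + 1}. (2 * k + 1) choose i)"
        by (simp only: sym mult_2[of "(2 * k + 1) choose k"])
      also have "\<dots> \<le> (\<Sum>i\<le>2 * k + 1. (2 * k + 1) choose i)"
        by (rule sum_mono2) auto
      also have "\<dots> = 2 * 4 ^ k" unfolding choose_row_sum by (simp add: power_mult)
      finally show ?thesis by simp
    qed
    finally have B: "(\<Prod>p\<in>?B. p) \<le> 4 ^ k" .
    have "p \<le> n \<longleftrightarrow> p \<le> k + 1 \<or> k + 1 < p \<and> p \<le> 2 * k + 1" for p using 4 by linarith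
    then have union: "{p. prime p \<and> p \<le> n} = ?A \<union> ?B" by blast
    have "(\<Prod>p | prime p \<and> p \<le> n. p) = (\<Prod>p\<in>?A. p) * (\<Prod>p\<in>?B. p)"
      unfolding union by (rule prod.union_disjoint[OF fin]) auto
    also have "\<dots> \<le> 4 ^ (k + 1) * 4 ^ k"
    proof (rule mult_mono[OF _ B])
      show "(\<Prod>p\<in>?A. p) \<le> 4 ^ (k + 1)" by (rule less) (use 4 in linarith)
    qed auto
    also have "\<dots> = 4 ^ (k + 1 + k)" by (rule power_add[symmetric])
    also have "k + 1 + k = n" using 4 by simp
    finally show ?thesis .
  qed
qed

text \<open>The numbers \<open>1 / ((n + 1) * (n choose k))\<close> form Leibniz' harmonic triangle, where every entry is a
  difference of two entries closer to the boundary.  By induction from the boundary \<open>1 / (n + 1)\<close>, all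
  entries up to row \<open>N - 1\<close> have denominators dividing \<open>lcm(1, ..., N)\<close>.\<close>

lemma binomial_dvd_lcm:
  assumes "k \<le> n" "n < N"
  shows "real (Lcm {1..N}) / (real (n + 1) * real (n choose k)) \<in> \<int>"
  using assms
proof (induction k arbitrary: n)
  case 0
  then have "n + 1 dvd Lcm {1..N}" by (intro dvd_Lcm) auto
  then obtain c where "Lcm {1..N} = (n + 1) * c" by blast
  then have "real (Lcm {1..N}) = real (n + 1) * real c" by (simp only: of_nat_mult)
  then show ?case by simp
next
  case (Suc k)
  then obtain n' where n: "n = Suc n'" by (cases n) auto
  let ?T = "real (Lcm {1..N})"
  have "?T / (real (n + 1) * real (n choose Suc k)) =
      ?T / (real (n' + 1) * real (n' choose k)) - ?T / (real (n + 1) * real (n choose k))"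
  proof -
    have pos: "real (n choose Suc k) > 0"
      using Suc.prems by (simp only: of_nat_0_less_iff zero_less_binomial)
    have "Suc k * (n choose Suc k) = n * (n' choose k)"
      using binomial_absorption[of k n] by (simp only: n diff_Suc_1)
    then have 2: "real (Suc k) * real (n choose Suc k) = real n * real (n' choose k)"
      by (simp only: of_nat_mult[symmetric])
    have "(n - k) * (n choose k) = n * (n' choose k)"
      using binomial_absorb_comp[of n k] by (simp only: n diff_Suc_1)
    then have 1: "real (Suc k) * real (n choose Suc k) = real (n - k) * real (n choose k)"
      unfolding 2 by (simp only: of_nat_mult[symmetric])
    have k: "real (n - k) = real n - real k" using Suc.prems by (simp add: of_nat_diff)
    define a b c where "a = real (n choose Suc k)" and "b = real (n choose k)" and "c = real (n' choose k)"
    have nn: "real (n' + 1) = real n" using n by simp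
    have "real n - real k > 0" "real n > 0" using Suc.prems by auto
    have b: "b = (real k + 1) * a / (real n - real k)" and c: "c = (real k + 1) * a / real n"
      using 1 2 \<open>real n - real k > 0\<close> \<open>real n > 0\<close> unfolding k a_def b_def c_def
      by (simp_all add: field_simps)
    have "a > 0" using pos by (simp add: a_def)
    have "?T / (real (n + 1) * a) = ?T / (real n * c) - ?T / (real (n + 1) * b)"
      unfolding b c using \<open>a > 0\<close> \<open>real n - real k > 0\<close> \<open>real n > 0\<close>
      by (simp add: divide_simps) (simp add: algebra_simps)
    then show ?thesis by (simp only: a_def b_def c_def nn)
  qed
  moreover have "?T / (real (n' + 1) * real (n' choose k)) \<in> \<int>"
    using Suc n by (intro Suc.IH) auto
  moreover have "?T / (real (n + 1) * real (n choose k)) \<in> \<int>"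
    using Suc.prems by (intro Suc.IH) auto
  ultimately show ?case by simp
qed

text \<open>The central entry of row \<open>2 * m\<close> of the harmonic triangle: its denominator
  \<open>(2 * m + 1) * ((2 * m) choose m)\<close> divides the least common multiple, and the central binomial
  coefficient is at least \<open>4 ^ m / (2 * m)\<close>.\<close>

lemma lcm_lower_bound: "4 ^ m \<le> Lcm {1..2 * m + 1 :: nat}"
proof (cases "m = 0")
  case False
  let ?T = "Lcm {1..2 * m + 1 :: nat}"
  let ?a = "(2 * m + 1) * ((2 * m) choose m)"
  have "real ?T / (real (2 * m + 1) * real ((2 * m) choose m)) \<in> \<int>"
    by (rule binomial_dvd_lcm) auto
  then obtain z where z: "real ?T / real ?a = of_int z" by (auto elim!: Ints_cases simp only: of_nat_mult)
  have "?T \<noteq> 0" by (simp add: Lcm_0_iff)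
  have "?a > 0" by (simp only: nat_0_less_mult_iff zero_less_binomial_iff) simp
  then have a: "real ?a > 0" by (simp only: of_nat_0_less_iff)
  have "real ?T > 0" using \<open>?T \<noteq> 0\<close> by (simp only: of_nat_0_less_iff neq0_conv)
  then have "real_of_int z > 0" unfolding z[symmetric] using a by (rule divide_pos_pos)
  then have "real_of_int z \<ge> 1" by simp
  then have "real ?a \<le> real ?T" unfolding z[symmetric] using a by (simp add: le_divide_eq_1_pos)
  have "4 ^ m / real (2 * m) \<le> real ((2 * m) choose m)"
    using central_binomial_lower_bound[of m] False by simp
  then have "4 ^ m \<le> real (2 * m) * real ((2 * m) choose m)"
    using False by (simp add: field_simps)
  also have "\<dots> \<le> real ?a" unfolding of_nat_mult by (intro mult_right_mono) auto
  also have "\<dots> \<le> real ?T" by fact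
  finally have "real (4 ^ m) \<le> real ?T" by simp
  then show ?thesis by (simp only: of_nat_le_iff)
qed auto

lemma multiplicity_Lcm_upto:
  fixes p N :: nat
  assumes "prime p" "N \<ge> 1"
  shows "p ^ multiplicity p (Lcm {1..N}) \<le> N"
  using assms(2)
proof (induction N rule: dec_induct)
  case base
  then show ?case by simp
next
  case (step N)
  have "{1..Suc N} = insert (Suc N) {1..N}" using step by auto
  then have L: "Lcm {1..Suc N} = lcm (Suc N) (Lcm {1..N})" by simp
  have "Lcm {1..N} \<noteq> 0" by (auto simp: Lcm_0_iff)
  then have "multiplicity p (Lcm {1..Suc N}) = max (multiplicity p (Suc N)) (multiplicity p (Lcm {1..N}))"
    unfolding L by (intro multiplicity_lcm) (use assms(1) in auto)
  moreover have "p ^ multiplicity p (Suc N) \<le> Suc N"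
    by (rule dvd_imp_le[OF multiplicity_dvd]) simp
  ultimately show ?case using step.IH by (auto simp: max_def)
qed

text \<open>A prime above \<open>sqrt N\<close> divides the least common multiple exactly once, so these primes, all at most
  \<open>n\<close>, contribute at most the primorial of \<open>n\<close>.  Each of the at most \<open>sqrt N\<close> others contributes a
  power not exceeding \<open>N\<close>.\<close>

lemma lcm_upper_bound:
  fixes n N :: nat
  assumes no_prime: "\<And>p. prime p \<Longrightarrow> n < p \<Longrightarrow> p \<le> N \<Longrightarrow> False" and "N \<ge> 1"
  shows "real (Lcm {1..N}) \<le> 4 ^ n * real N powr (sqrt N)"
proof -
  let ?T = "Lcm {1..N}"
  have T0: "?T \<noteq> 0" by (auto simp: Lcm_0_iff)
  have fac: "prime p" "p \<le> N" "p ^ multiplicity p ?T \<le> N" if "p \<in> prime_factors ?T" for p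
  proof -
    show p: "prime p" using that by auto
    show le: "p ^ multiplicity p ?T \<le> N" by (rule multiplicity_Lcm_upto[OF p \<open>N \<ge> 1\<close>])
    have "multiplicity p ?T \<ge> 1" using that unfolding prime_factors_multiplicity by auto
    then have "p ^ 1 \<le> p ^ multiplicity p ?T"
      using prime_gt_0_nat[OF p] by (intro power_increasing) auto
    then show "p \<le> N" using le by simp
  qed
  let ?S = "{p \<in> prime_factors ?T. p\<^sup>2 \<le> N}" and ?L = "{p \<in> prime_factors ?T. \<not> p\<^sup>2 \<le> N}"
  have "?T = (\<Prod>p\<in>prime_factors ?T. p ^ multiplicity p ?T)"
    using prod_prime_factors[OF T0] by simp
  also have "prime_factors ?T = ?S \<union> ?L" by auto
  also have "(\<Prod>p\<in>?S \<union> ?L. p ^ multiplicity p ?T) =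
      (\<Prod>p\<in>?S. p ^ multiplicity p ?T) * (\<Prod>p\<in>?L. p ^ multiplicity p ?T)"
    by (rule prod.union_disjoint) auto
  finally have T: "?T = \<dots>" .
  have sub: "?L \<subseteq> {p. prime p \<and> p \<le> n}"
  proof
    fix p assume "p \<in> ?L"
    then have "p \<in> prime_factors ?T" by blast
    then have "prime p" "p \<le> N" by (rule fac)+
    then show "p \<in> {p. prime p \<and> p \<le> n}" using no_prime[of p] by (cases "n < p") auto
  qed
  have "(\<Prod>p\<in>?L. p ^ multiplicity p ?T) \<le> (\<Prod>p\<in>?L. p)"
  proof (rule prod_mono, intro conjI)
    fix p assume p: "p \<in> ?L"
    then have "p > 0" using fac(1)[of p] prime_gt_0_nat by blast
    have "multiplicity p ?T < 2"
    proof (rule ccontr)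
      assume "\<not> ?thesis"
      then have "p ^ 2 \<le> p ^ multiplicity p ?T"
        using \<open>p > 0\<close> by (intro power_increasing) auto
      moreover have "p ^ multiplicity p ?T \<le> N" "\<not> p\<^sup>2 \<le> N" using fac(3)[of p] p by blast+
      ultimately show False by linarith
    qed
    then show "p ^ multiplicity p ?T \<le> p"
      using \<open>p > 0\<close> power_increasing[of "multiplicity p ?T" 1 p] by simp
  qed auto
  also have "(\<Prod>p\<in>?L. p) dvd (\<Prod>p | prime p \<and> p \<le> n. p)"
    by (rule prod_dvd_prod_subset[OF _ sub]) simp
  then have "(\<Prod>p\<in>?L. p) \<le> (\<Prod>p | prime p \<and> p \<le> n. p)"
    by (rule dvd_imp_le) (auto intro: prod_pos prime_gt_0_nat)
  also have "\<dots> \<le> 4 ^ n" by (rule primorial_bound)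
  finally have L: "real (\<Prod>p\<in>?L. p ^ multiplicity p ?T) \<le> real (4 ^ n)"
    by (simp only: of_nat_le_iff)
  have "(\<Prod>p\<in>?S. p ^ multiplicity p ?T) \<le> (\<Prod>p\<in>?S. N)"
  proof (intro prod_mono conjI)
    fix p assume "p \<in> ?S"
    then have "p \<in> prime_factors ?T" by blast
    then show "p ^ multiplicity p ?T \<le> N" by (rule fac)
  qed auto
  also have "\<dots> = N ^ card ?S" by simp
  finally have "real (\<Prod>p\<in>?S. p ^ multiplicity p ?T) \<le> real (N ^ card ?S)"
    by (simp only: of_nat_le_iff)
  also have "\<dots> = real N powr real (card ?S)" using \<open>N \<ge> 1\<close> by (simp add: powr_realpow)
  also have "\<dots> \<le> real N powr sqrt N"
  proof (rule powr_mono)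
    have "?S \<subseteq> {1..nat \<lfloor>sqrt N\<rfloor>}"
    proof
      fix p assume p: "p \<in> ?S"
      then have "real p \<le> sqrt N" by (auto intro!: real_le_rsqrt simp flip: of_nat_power)
      then show "p \<in> {1..nat \<lfloor>sqrt N\<rfloor>}"
        using p prime_ge_1_nat by (auto simp: le_nat_iff le_floor_iff)
    qed
    then have "card ?S \<le> nat \<lfloor>sqrt N\<rfloor>" using card_mono[of "{1..nat \<lfloor>sqrt N\<rfloor>}" ?S] by simp
    then have "real (card ?S) \<le> real (nat \<lfloor>sqrt N\<rfloor>)" by (rule of_nat_mono)
    also have "\<dots> \<le> sqrt N" by simp
    finally show "real (card ?S) \<le> sqrt N" .
  qed (use \<open>N \<ge> 1\<close> in auto)
  finally have S: "real (\<Prod>p\<in>?S. p ^ multiplicity p ?T) \<le> real N powr sqrt N" .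
  have "real ?T = real (\<Prod>p\<in>?S. p ^ multiplicity p ?T) * real (\<Prod>p\<in>?L. p ^ multiplicity p ?T)"
    by (subst T) (rule of_nat_mult)
  also have "\<dots> \<le> real N powr sqrt N * real (4 ^ n)" by (intro mult_mono S L of_nat_0_le_iff powr_ge_zero)
  finally show ?thesis by (simp add: mult.commute)
qed

text \<open>With \<open>x^4 = 4 * n + 1\<close> and \<open>ln x \<le> x\<close>, the logarithm of the left-hand side is at most \<open>4 * x^3\<close>, which
  is below \<open>x^4 / 5 \<le> n\<close> once \<open>x > 20\<close>; the bound 40000 ensures \<open>4 * n + 1 > 20^4\<close>.\<close>

lemma powr_sqrt_less_exponential:
  assumes "n \<ge> 40000"
  shows "(4 * real n + 1) powr sqrt (4 * real n + 1) < 4 powr real n"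
proof -
  define x where "x = sqrt (sqrt (4 * real n + 1))"
  have x2: "x\<^sup>2 = sqrt (4 * real n + 1)" by (simp add: x_def)
  have "x ^ 4 = (x\<^sup>2)\<^sup>2" by simp
  then have x4: "x ^ 4 = 4 * real n + 1" by (simp add: x2)
  have "(20::real) ^ 4 < x ^ 4" using assms by (simp add: x4)
  then have "x > 20" by (rule power_less_imp_less_base) (simp add: x_def)
  have "x\<^sup>2 * ln (x ^ 4) = 4 * x\<^sup>2 * ln x"
    using \<open>x > 20\<close> by (simp add: ln_realpow)
  also have "\<dots> \<le> 4 * x\<^sup>2 * x"
    using \<open>x > 20\<close> ln_bound[of x] by (intro mult_left_mono) auto
  also have "\<dots> < x ^ 4 / 5"
    using \<open>x > 20\<close> by (simp add: power2_eq_square power4_eq_xxxx field_simps)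
  also have "\<dots> \<le> real n" using assms by (simp add: x4)
  also have "\<dots> \<le> real n * ln 4"
  proof -
    have "(1::real) \<le> ln 4" using ln2_ge_two_thirds ln_realpow[of 2 2] by simp
    then show ?thesis using mult_left_mono[of 1 "ln 4" "real n"] by simp
  qed
  finally have "sqrt (4 * real n + 1) * ln (4 * real n + 1) < real n * ln 4"
    by (simp add: x2 x4)
  then show ?thesis by (simp add: powr_def)
qed

text \<open>If there were no prime in \<open>(n, 4 * n + 1]\<close>, then the bounds on \<open>lcm(1, ..., 4 * n + 1)\<close> would give
  \<open>4 ^ (2 * n) \<le> 4 ^ n * (4 * n + 1) powr sqrt (4 * n + 1)\<close>, which fails for large \<open>n\<close>.  A single prime
  \<open>q\<close> serves all small \<open>n\<close>.\<close>

theorem prime_in_multiplicative_interval: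
  "\<exists>C\<ge>1. \<forall>n\<ge>1. \<exists>p. prime p \<and> n < p \<and> p \<le> C * (n :: nat)"
proof -
  obtain n0 where n0: "\<And>n. n \<ge> n0 \<Longrightarrow> (4 * real n + 1) powr sqrt (4 * real n + 1) < 4 powr real n"
    using powr_sqrt_less_exponential by blast
  obtain q where q: "prime q" "n0 < q" using bigger_prime by blast
  show ?thesis
  proof (rule exI[of _ "5 + q"], intro conjI allI impI)
    fix n :: nat assume "n \<ge> 1"
    show "\<exists>p. prime p \<and> n < p \<and> p \<le> (5 + q) * n"
    proof (cases "n < n0")
      case True
      have "q * 1 \<le> (5 + q) * n" using \<open>n \<ge> 1\<close> by (intro mult_le_mono) auto
      then show ?thesis using True q by (intro exI[of _ q]) auto
    next
      case False
      have "\<exists>p. prime p \<and> n < p \<and> p \<le> 4 * n + 1"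
      proof (rule ccontr)
        assume "\<not> ?thesis"
        then have "real (Lcm {1..4 * n + 1}) \<le> 4 ^ n * real (4 * n + 1) powr (sqrt (4 * n + 1))"
          by (intro lcm_upper_bound) auto
        moreover have "4 ^ n * 4 ^ n \<le> real (Lcm {1..4 * n + 1})"
        proof -
          have "2 * (2 * n) + 1 = 4 * n + 1" by simp
          then have "real (4 ^ (2 * n)) \<le> real (Lcm {1..4 * n + 1})"
            using lcm_lower_bound[of "2 * n"] by (simp only: of_nat_le_iff)
          then show ?thesis by (simp only: mult_2 power_add of_nat_mult of_nat_power of_nat_numeral)
        qed
        ultimately have "4 ^ n * 4 ^ n \<le> 4 ^ n * (real (4 * n + 1) powr sqrt (real (4 * n + 1)))"
          by linarith
        then have "4 ^ n \<le> real (4 * n + 1) powr sqrt (real (4 * n + 1))"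
          by (subst (asm) mult_le_cancel_left_pos) simp_all
        then have "4 powr real n \<le> (4 * real n + 1) powr sqrt (4 * real n + 1)"
          by (simp add: powr_realpow add.commute)
        with n0[of n] False show False by simp
      qed
      then obtain p where p: "prime p" "n < p" "p \<le> 4 * n + 1" by blast
      have "4 * n + 1 \<le> 5 * n" using \<open>n \<ge> 1\<close> by simp
      also have "\<dots> \<le> (5 + q) * n" by (rule mult_right_mono) auto
      finally have "4 * n + 1 \<le> (5 + q) * n" .
      with p show ?thesis by (blast intro: le_trans)
    qed
  qed auto
qed


section \<open>Small values of random trigonometric polynomials\<close>

abbreviation unit_uniform :: "real measure" where
  "unit_uniform \<equiv> restrict_space lborel {0..<1}"

abbreviation uniform_seeds :: "('i \<Rightarrow> real) measure" where
  "uniform_seeds \<equiv> PiM UNIV (\<lambda>_. unit_uniform)"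

lemma prob_space_unit_uniform: "prob_space unit_uniform"
  by (rule prob_spaceI) (simp add: space_restrict_space emeasure_restrict_space)

interpretation unit_uniform: prob_space unit_uniform
  by (rule prob_space_unit_uniform)

interpretation uniform_seeds: prob_space "uniform_seeds :: ('i \<Rightarrow> real) measure"
  by (rule prob_space_PiM) (rule prob_space_unit_uniform)

lemma space_unit_uniform [simp]: "space unit_uniform = {0..<1}"
  by (simp add: space_restrict_space)

lemma measurable_unit_uniform [measurable]: "(\<lambda>x. x) \<in> borel_measurable unit_uniform"
  by (rule measurable_restrict_space1) simp

lemma measurable_seed [measurable]: "(\<lambda>\<sigma>. \<sigma> i) \<in> borel_measurable uniform_seeds"
  by (rule measurable_compose[OF measurable_component_singleton[of i] measurable_unit_uniform]) simp

lemma space_uniform_seeds: "space uniform_seeds = {\<sigma>. \<forall>i. \<sigma> i \<in> {0..<1}}"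
  by (auto simp: space_PiM PiE_def Pi_def)

lemma fun_upd_in_space [simp]:
  "\<sigma> \<in> space uniform_seeds \<Longrightarrow> x \<in> {0..<1} \<Longrightarrow> \<sigma>(i := x) \<in> space uniform_seeds"
  by (auto simp: space_uniform_seeds)

text \<open>Conditioning on all coordinates but one: replacing coordinate \<open>i\<close> by an independent uniform value
  preserves the product measure, and Fubini's theorem integrates the bound on the sections.  The
  hypothesis on \<open>F\<close> says that \<open>F\<close> does not depend on that coordinate, so that the bound factors and can
  be iterated over independent coordinates.\<close>

lemma resampling_bound:
  fixes E F :: "('i \<Rightarrow> real) set"
  assumes E [measurable]: "E \<in> sets uniform_seeds" and F [measurable]: "F \<in> sets uniform_seeds"
    and indep: "\<And>\<sigma> x. \<sigma> \<in> space uniform_seeds \<Longrightarrow> x \<in> {0..<1} \<Longrightarrow> \<sigma>(i := x) \<in> F \<Longrightarrow> \<sigma> \<in> F"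
    and section_bound: "\<And>\<sigma>. \<sigma> \<in> space uniform_seeds \<Longrightarrow>
      measure unit_uniform {x \<in> {0..<1}. \<sigma>(i := x) \<in> E} \<le> p"
    and "p \<ge> 0"
  shows "measure uniform_seeds (E \<inter> F) \<le> p * measure uniform_seeds F"
proof -
  let ?P = "uniform_seeds :: ('i \<Rightarrow> real) measure"
  let ?U = unit_uniform
  let ?f = "\<lambda>(x, \<sigma>). \<sigma>(i := x)"
  interpret pair_sigma_finite ?U ?P ..
  have distr: "distr (?U \<Otimes>\<^sub>M ?P) ?P ?f = ?P"
    using distr_pair_PiM_eq_PiM[of UNIV "\<lambda>_. ?U" i] prob_space_unit_uniform by simp
  have m: "?f \<in> measurable (?U \<Otimes>\<^sub>M ?P) ?P"
  proof -
    have "(\<lambda>x. (snd x)(i := fst x)) \<in> measurable (?U \<Otimes>\<^sub>M ?P) ?P"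
      using measurable_fun_upd[of UNIV UNIV i snd "?U \<Otimes>\<^sub>M ?P" "\<lambda>_. ?U" fst]
      by (simp add: measurable_snd measurable_fst)
    then show ?thesis by (simp add: case_prod_unfold)
  qed
  have sm: "(\<lambda>x. \<sigma>(i := x)) \<in> measurable ?U ?P" if "\<sigma> \<in> space ?P" for \<sigma>
    using measurable_compose[OF measurable_Pair2'[OF that, of ?U] m] by simp
  have "emeasure ?P (E \<inter> F) = emeasure (distr (?U \<Otimes>\<^sub>M ?P) ?P ?f) (E \<inter> F)"
    by (simp add: distr)
  also have "\<dots> = emeasure (?U \<Otimes>\<^sub>M ?P) (?f -` (E \<inter> F) \<inter> space (?U \<Otimes>\<^sub>M ?P))"
    using m by (intro emeasure_distr) auto
  also have "\<dots> = (\<integral>\<^sup>+\<sigma>. emeasure ?U ((\<lambda>x. (x, \<sigma>)) -` (?f -` (E \<inter> F) \<inter> space (?U \<Otimes>\<^sub>M ?P))) \<partial>?P)"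
    by (rule emeasure_pair_measure_alt2) (use m in measurable)
  also have "\<dots> \<le> (\<integral>\<^sup>+\<sigma>. ennreal p * indicator F \<sigma> \<partial>?P)"
  proof (rule nn_integral_mono)
    fix \<sigma> assume \<sigma>: "\<sigma> \<in> space ?P"
    let ?S = "(\<lambda>x. (x, \<sigma>)) -` (?f -` (E \<inter> F) \<inter> space (?U \<Otimes>\<^sub>M ?P))"
    show "emeasure ?U ?S \<le> ennreal p * indicator F \<sigma>"
    proof (cases "\<sigma> \<in> F")
      case True
      have meas: "{x \<in> {0..<1}. \<sigma>(i := x) \<in> E} \<in> sets ?U"
        using measurable_sets[OF sm[OF \<sigma>] E] by (simp add: vimage_def Int_def conj_commute)
      have "?S \<subseteq> {x \<in> {0..<1}. \<sigma>(i := x) \<in> E}"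
        by (auto simp: space_pair_measure)
      then have "emeasure ?U ?S \<le> emeasure ?U {x \<in> {0..<1}. \<sigma>(i := x) \<in> E}"
        by (rule emeasure_mono) (rule meas)
      also have "\<dots> \<le> ennreal p"
        using section_bound[OF \<sigma>] by (simp add: unit_uniform.emeasure_eq_measure ennreal_leI)
      finally show ?thesis using True by simp
    next
      case False
      then have "?S = {}" using indep[OF \<sigma>] by (fastforce simp: space_pair_measure)
      then show ?thesis by simp
    qed
  qed
  also have "\<dots> = ennreal p * emeasure ?P F"
    by (simp add: nn_integral_cmult)
  finally show ?thesis
    using \<open>p \<ge> 0\<close> by (simp add: uniform_seeds.emeasure_eq_measure flip: ennreal_mult)
qed

lemma sin_lower_bound:
  assumes "0 \<le> t" "t \<le> 1/2"
  shows "sin (pi * t) \<ge> t"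
proof (cases "t \<le> 1/3")
  case True
  have "pi * t \<le> pi / 3" using True by simp
  have "cos (pi * t) \<ge> cos (pi / 3)"
    using True assms by (intro cos_monotone_0_pi_le) auto
  then have c: "cos (pi * t) \<ge> 1/2" by (simp add: cos_60)
  have "pi * t < pi/2" using True by simp
  then have "pi * t \<le> tan (pi * t)"
    using abs_tan_ge[of "pi * t"] assms by (simp add: tan_pos_pi2_le)
  then have "pi * t * cos (pi * t) \<le> sin (pi * t)"
    using c by (simp add: tan_def field_simps)
  moreover have "pi * t * cos (pi * t) \<ge> 2 * t * (1/2)"
    using c assms pi_ge_two by (intro mult_mono) auto
  ultimately show ?thesis by simp
next
  case False
  have "sin (pi / 6) \<le> sin (pi * t)"
    using False assms by (intro sin_monotone_2pi_le) auto
  then show ?thesis using assms by (simp add: sin_30)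
qed

lemma cmod_cis_diff: "cmod (cis a - cis b) = 2 * \<bar>sin ((a - b) / 2)\<bar>"
proof (rule power2_eq_imp_eq)
  have odd: "sin ((b - a) / 2) = - sin ((a - b) / 2)"
    by (metis minus_diff_eq minus_divide_left sin_minus)
  have "(cmod (cis a - cis b))\<^sup>2 = (cos a - cos b)\<^sup>2 + (sin a - sin b)\<^sup>2"
    by (simp add: cmod_power2)
  also have "\<dots> = 4 * (sin ((a - b) / 2))\<^sup>2 * ((sin ((a + b) / 2))\<^sup>2 + (cos ((a + b) / 2))\<^sup>2)"
    unfolding cos_diff_cos sin_diff_sin odd by algebra
  finally show "(cmod (cis a - cis b))\<^sup>2 = (2 * \<bar>sin ((a - b) / 2)\<bar>)\<^sup>2"
    by (simp add: power_mult_distrib)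
qed auto

text \<open>A point of the circle near \<open>cis (2 * pi * y)\<close> has a parameter near \<open>y\<close> modulo 1: the chord
  has length \<open>2 * sin (pi * t)\<close> at distance \<open>t\<close>, and \<open>sin (pi * t) \<ge> t\<close> on \<open>[0, 1/2]\<close>.  The three intervals
  correspond to the differences 0, 1 and -1 of the parameters.\<close>

lemma arc_small_measure:
  assumes "\<epsilon> > 0"
  shows "\<exists>\<eta>>0. \<forall>y\<in>{0..<1}.
    measure unit_uniform {x \<in> {0..<1}. cmod (cis (2 * pi * x) - cis (2 * pi * y)) \<le> \<eta>} \<le> \<epsilon>"
proof (intro exI[of _ "\<epsilon> / 4"] conjI ballI)
  fix y :: real assume y: "y \<in> {0..<1}"
  let ?\<eta> = "\<epsilon> / 4"
  \<comment> \<open>The lengths \<open>2 * \<eta> + \<eta> + \<eta>\<close> add up to \<open>\<epsilon>\<close>.\<close>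
  let ?A = "{y - ?\<eta>..y + ?\<eta>}" and ?B = "{y + 1 - ?\<eta>..1 + y}" and ?C = "{y - 1..y - 1 + ?\<eta>}"
  have sub: "{x \<in> {0..<1}. cmod (cis (2 * pi * x) - cis (2 * pi * y)) \<le> ?\<eta>} \<subseteq> ?A \<union> ?B \<union> ?C"
  proof
    fix x assume "x \<in> {x \<in> {0..<1}. cmod (cis (2 * pi * x) - cis (2 * pi * y)) \<le> ?\<eta>}"
    then have x: "x \<in> {0..<1}" and c: "cmod (cis (2 * pi * x) - cis (2 * pi * y)) \<le> ?\<eta>" by auto
    let ?t = "\<bar>x - y\<bar>"
    have t: "?t < 1" using x y by auto
    have "cmod (cis (2 * pi * x) - cis (2 * pi * y)) = 2 * \<bar>sin (pi * ?t)\<bar>"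
    proof -
      have "(2 * pi * x - 2 * pi * y) / 2 = pi * (x - y)" by (simp add: field_simps)
      moreover have "\<bar>sin (pi * (x - y))\<bar> = \<bar>sin (pi * ?t)\<bar>"
        by (cases "x - y \<ge> 0") (auto simp only: abs_of_nonneg abs_of_neg not_le mult_minus_right sin_minus abs_minus_cancel)
      ultimately show ?thesis using cmod_cis_diff[of "2 * pi * x" "2 * pi * y"] by simp
    qed
    with c have s: "2 * \<bar>sin (pi * ?t)\<bar> \<le> ?\<eta>" by simp
    show "x \<in> ?A \<union> ?B \<union> ?C"
    proof (cases "?t \<le> 1/2")
      case True
      then have "?t \<le> sin (pi * ?t)" by (intro sin_lower_bound) auto
      with s show ?thesis by auto
    next
      case False
      then have "1 - ?t \<le> sin (pi * (1 - ?t))" using t by (intro sin_lower_bound) auto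
      also have "\<dots> = sin (pi * ?t)" by (simp add: algebra_simps sin_diff)
      finally show ?thesis using s x y False by (auto simp: abs_if split: if_splits)
    qed
  qed
  have "emeasure lborel {x \<in> {0..<1}. cmod (cis (2 * pi * x) - cis (2 * pi * y)) \<le> ?\<eta>} \<le> emeasure lborel (?A \<union> ?B \<union> ?C)"
    by (rule emeasure_mono[OF sub]) auto
  also have "\<dots> \<le> emeasure lborel ?A + emeasure lborel ?B + emeasure lborel ?C"
    by (intro order_trans[OF emeasure_subadditive] add_mono) auto
  also have "\<dots> = ennreal \<epsilon>"
    using assms by (simp flip: ennreal_plus)
  finally have "emeasure unit_uniform {x \<in> {0..<1}. cmod (cis (2 * pi * x) - cis (2 * pi * y)) \<le> ?\<eta>} \<le> ennreal \<epsilon>"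
    by (subst emeasure_restrict_space) auto
  then show "measure unit_uniform {x \<in> {0..<1}. cmod (cis (2 * pi * x) - cis (2 * pi * y)) \<le> ?\<eta>} \<le> \<epsilon>"
    using assms by (simp add: unit_uniform.emeasure_eq_measure)
qed (use assms in auto)


lemma measurable_cis [measurable]: "cis \<in> borel_measurable borel"
  by (intro borel_measurable_continuous_onI continuous_intros)

lemma measurable_poly [measurable]: "poly q \<in> borel_measurable borel" for q :: "complex poly"
  by (intro borel_measurable_continuous_onI continuous_intros)

text \<open>Induction on the degree.  If \<open>q\<close> is small at some point \<open>z\<close> of the circle, write
  \<open>q = (X - z) * r + q(z)\<close>.  Since \<open>\<bar>z\<bar> = 1\<close>, some coefficient of \<open>r\<close> is at least \<open>m / 4\<close>, and where \<open>q\<close> is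
  small, either the point is close to \<open>z\<close> or \<open>r\<close> is small.  Both have small probability, uniformly
  in \<open>q\<close>.\<close>

lemma poly_small_ball:
  assumes "m > 0" "\<epsilon> > 0"
  shows "\<exists>\<theta>>0. \<forall>q. degree q \<le> N \<longrightarrow> (\<exists>k. cmod (coeff q k) \<ge> m) \<longrightarrow>
    measure unit_uniform {x \<in> {0..<1}. cmod (poly q (cis (2 * pi * x))) \<le> \<theta>} \<le> \<epsilon>"
  using assms
proof (induction N arbitrary: m \<epsilon>)
  case 0
  have empty: "{x \<in> {0..<1}. cmod (poly q (cis (2 * pi * x))) \<le> m / 2} = {}"
    if "degree q = 0" "cmod (coeff q k) \<ge> m" for q :: "complex poly" and k
  proof -
    obtain a where "q = [:a:]" using \<open>degree q = 0\<close> by (rule degree_eq_zeroE)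
    then show ?thesis using that(2) \<open>m > 0\<close> by (auto simp: coeff_pCons split: nat.splits)
  qed
  show ?case
  proof (intro exI[of _ "m / 2"] conjI allI impI)
    fix q :: "complex poly" assume "degree q \<le> 0" "\<exists>k. cmod (coeff q k) \<ge> m"
    then obtain k where "degree q = 0" "cmod (coeff q k) \<ge> m" by auto
    then show "measure unit_uniform {x \<in> {0..<1}. cmod (poly q (cis (2 * pi * x))) \<le> m / 2} \<le> \<epsilon>"
      unfolding empty[OF \<open>degree q = 0\<close> \<open>cmod (coeff q k) \<ge> m\<close>] using 0 by simp
  qed (use 0 in simp)
next
  case (Suc N)
  obtain \<eta> where "\<eta> > 0" and \<eta>: "\<And>y. y \<in> {0..<1} \<Longrightarrow>
      measure unit_uniform {x \<in> {0..<1}. cmod (cis (2 * pi * x) - cis (2 * pi * y)) \<le> \<eta>} \<le> \<epsilon> / 2"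
    using arc_small_measure[of "\<epsilon> / 2"] Suc.prems by auto
  obtain \<theta>' where "\<theta>' > 0" and \<theta>': "\<And>q k. degree q \<le> N \<Longrightarrow> cmod (coeff q k) \<ge> m / 4 \<Longrightarrow>
      measure unit_uniform {x \<in> {0..<1}. cmod (poly q (cis (2 * pi * x))) \<le> \<theta>'} \<le> \<epsilon> / 2"
    using Suc.IH[of "m / 4" "\<epsilon> / 2"] Suc.prems by fastforce
  \<comment> \<open>The first bound makes \<open>q(z)\<close> small compared to \<open>m\<close>, the second one makes \<open>\<bar>w - z\<bar> * \<bar>r w\<bar> \<le> \<theta>' * \<eta>\<close>
    wherever \<open>q\<close> is at most \<open>\<theta>\<close>.\<close>
  define \<theta> where "\<theta> = min (m / 2) (\<theta>' * \<eta> / 2)"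
  have "\<theta> > 0" using Suc.prems \<open>\<eta> > 0\<close> \<open>\<theta>' > 0\<close> by (simp add: \<theta>_def)
  have "measure unit_uniform {x \<in> {0..<1}. cmod (poly q (cis (2 * pi * x))) \<le> \<theta>} \<le> \<epsilon>"
    if q: "degree q \<le> Suc N" and k: "cmod (coeff q k) \<ge> m" for q k
  proof (cases "{x \<in> {0..<1}. cmod (poly q (cis (2 * pi * x))) \<le> \<theta>} = {}")
    case True
    show ?thesis unfolding True using Suc.prems by simp
  next
    case False
    then obtain y where y: "y \<in> {0..<1}" "cmod (poly q (cis (2 * pi * y))) \<le> \<theta>" by auto
    define z where "z = cis (2 * pi * y)"
    define r where "r = synthetic_div q z"
    have qr: "q = [:- z, 1:] * r + [:poly q z:]"
      unfolding r_def by (rule synthetic_div_correct'[symmetric])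
    have "cmod z = 1" by (simp add: z_def)
    have "degree r \<le> N" using q by (simp add: r_def degree_synthetic_div)
    have "\<exists>j. cmod (coeff r j) \<ge> m / 4"
    proof (rule ccontr)
      assume "\<not> ?thesis"
      then have small: "cmod (coeff r j) < m / 4" for j by (meson not_le)
      have "coeff q k = (if k = 0 then poly q z else coeff r (k - 1)) - z * coeff r k"
        by (subst qr) (auto simp: coeff_pCons split: nat.splits)
      then have "cmod (coeff q k) \<le> cmod (if k = 0 then poly q z else coeff r (k - 1)) + cmod (z * coeff r k)"
        by (metis norm_triangle_ineq4)
      moreover have "cmod (if k = 0 then poly q z else coeff r (k - 1)) \<le> m / 2"
        using y(2) small[of "k - 1"] Suc.prems by (auto simp: z_def \<theta>_def)
      moreover have "cmod (z * coeff r k) < m / 4"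
        using small[of k] \<open>cmod z = 1\<close> by (simp add: norm_mult)
      ultimately show False using k Suc.prems by linarith
    qed
    then obtain j where "cmod (coeff r j) \<ge> m / 4" ..
    let ?A = "{x \<in> {0..<1}. cmod (cis (2 * pi * x) - cis (2 * pi * y)) \<le> \<eta>}"
    let ?B = "{x \<in> {0..<1}. cmod (poly r (cis (2 * pi * x))) \<le> \<theta>'}"
    have "{x \<in> {0..<1}. cmod (poly q (cis (2 * pi * x))) \<le> \<theta>} \<subseteq> ?A \<union> ?B"
    proof
      fix x assume "x \<in> {x \<in> {0..<1}. cmod (poly q (cis (2 * pi * x))) \<le> \<theta>}"
      then have x: "x \<in> {0..<1}" and c: "cmod (poly q (cis (2 * pi * x))) \<le> \<theta>" by auto
      define w where "w = cis (2 * pi * x)"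
      have "poly q w = (w - z) * poly r w + poly q z"
        by (subst qr) (simp add: algebra_simps)
      then have "cmod (w - z) * cmod (poly r w) = cmod (poly q w - poly q z)"
        by (simp add: norm_mult)
      also have "\<dots> \<le> \<theta> + \<theta>"
        using c y(2) by (intro order_trans[OF norm_triangle_ineq4] add_mono) (auto simp: w_def z_def)
      also have "\<dots> \<le> \<theta>' * \<eta>" by (simp add: \<theta>_def)
      finally have prod: "cmod (w - z) * cmod (poly r w) \<le> \<theta>' * \<eta>" .
      show "x \<in> ?A \<union> ?B"
      proof (rule ccontr)
        assume "x \<notin> ?A \<union> ?B"
        then have "cmod (w - z) > \<eta>" "cmod (poly r w) > \<theta>'"
          using x by (auto simp: w_def z_def)
        then have "\<eta> * \<theta>' < cmod (w - z) * cmod (poly r w)"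
          using \<open>\<eta> > 0\<close> \<open>\<theta>' > 0\<close> by (intro mult_strict_mono) auto
        with prod show False by (simp add: mult.commute)
      qed
    qed
    moreover have "{x \<in> space unit_uniform. cmod (cis (2 * pi * x) - cis (2 * pi * y)) \<le> \<eta>} \<in> sets unit_uniform"
      "{x \<in> space unit_uniform. cmod (poly r (cis (2 * pi * x))) \<le> \<theta>'} \<in> sets unit_uniform"
      by measurable
    then have meas: "?A \<in> sets unit_uniform" "?B \<in> sets unit_uniform"
      by (simp_all only: space_unit_uniform)
    ultimately have "measure unit_uniform {x \<in> {0..<1}. cmod (poly q (cis (2 * pi * x))) \<le> \<theta>}
        \<le> measure unit_uniform (?A \<union> ?B)"
      by (intro unit_uniform.finite_measure_mono) auto
    also have "\<dots> \<le> measure unit_uniform ?A + measure unit_uniform ?B"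
      by (intro measure_Un_le meas)
    also have "\<dots> \<le> \<epsilon> / 2 + \<epsilon> / 2"
      using \<eta>[OF y(1)] \<theta>'[OF \<open>degree r \<le> N\<close> \<open>cmod (coeff r j) \<ge> m / 4\<close>] by (rule add_mono)
    finally show ?thesis by simp
  qed
  with \<open>\<theta> > 0\<close> show ?case by blast
qed

text \<open>Multiplying by \<open>cis (2 * pi * b * x)\<close> shifts all frequencies into \<open>[0, 2 * b]\<close> and turns the sum into
  a polynomial on the unit circle, with the same moduli.\<close>

lemma trig_poly_1d_small_ball:
  fixes A :: "int set"
  assumes "finite A" "m > 0" "\<epsilon> > 0"
  shows "\<exists>\<theta>>0. \<forall>c. (\<exists>a\<in>A. cmod (c a) \<ge> m) \<longrightarrow>
    measure unit_uniform {x \<in> {0..<1}. cmod (\<Sum>a\<in>A. c a * cis (2 * pi * (of_int a * x))) \<le> \<theta>} \<le> \<epsilon>"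
proof -
  obtain b :: int where b: "\<And>a. a \<in> A \<Longrightarrow> \<bar>a\<bar> \<le> b"
    using \<open>finite A\<close> by (metis finite_imageI bdd_above_finite bdd_above.E imageI)
  obtain \<theta> where "\<theta> > 0" and \<theta>: "\<And>q k. degree q \<le> nat (2 * b) \<Longrightarrow> cmod (coeff q k) \<ge> m \<Longrightarrow>
    measure unit_uniform {x \<in> {0..<1}. cmod (poly q (cis (2 * pi * x))) \<le> \<theta>} \<le> \<epsilon>"
    using poly_small_ball[OF assms(2,3), of "nat (2 * b)"] by blast
  have "measure unit_uniform {x \<in> {0..<1}. cmod (\<Sum>a\<in>A. c a * cis (2 * pi * (of_int a * x))) \<le> \<theta>} \<le> \<epsilon>"
    if "a0 \<in> A" "cmod (c a0) \<ge> m" for c a0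
  proof -
    define q where "q = (\<Sum>a\<in>A. monom (c a) (nat (a + b)))"
    have "degree q \<le> nat (2 * b)"
      unfolding q_def
    proof (intro degree_sum_le \<open>finite A\<close>)
      fix a assume "a \<in> A"
      then have "nat (a + b) \<le> nat (2 * b)" using b[of a] by auto
      then show "degree (monom (c a) (nat (a + b))) \<le> nat (2 * b)"
        by (rule order_trans[OF degree_monom_le])
    qed
    moreover have "coeff q (nat (a0 + b)) = c a0"
    proof -
      have "nat (a + b) = nat (a0 + b) \<longleftrightarrow> a = a0" if "a \<in> A" for a
        using b[OF that] b[OF \<open>a0 \<in> A\<close>] by auto
      then have "coeff q (nat (a0 + b)) = (\<Sum>a\<in>A. if a = a0 then c a else 0)"
        by (simp add: q_def coeff_sum cong: sum.cong)
      then show ?thesis using assms that by simp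
    qed
    moreover have "cmod (poly q (cis (2 * pi * x))) = cmod (\<Sum>a\<in>A. c a * cis (2 * pi * (of_int a * x)))" for x
    proof -
      have "poly q (cis (2 * pi * x)) = (\<Sum>a\<in>A. cis (2 * pi * (of_int b * x)) * (c a * cis (2 * pi * (of_int a * x))))"
        unfolding q_def poly_sum
      proof (rule sum.cong[OF refl])
        fix a assume "a \<in> A"
        then have "a + b \<ge> 0" using b[of a] by auto
        then show "poly (monom (c a) (nat (a + b))) (cis (2 * pi * x)) =
            cis (2 * pi * (of_int b * x)) * (c a * cis (2 * pi * (of_int a * x)))"
          by (simp add: poly_monom Complex.DeMoivre cis_mult algebra_simps)
      qed
      then show ?thesis
        by (simp add: norm_mult flip: sum_distrib_left)
    qed
    ultimately show ?thesis using \<theta>[of q "nat (a0 + b)"] that by simp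
  qed
  with \<open>\<theta> > 0\<close> show ?thesis by blast
qed


text \<open>Induction on the number of variables.  Grouping by the frequency \<open>a\<close> of variable \<open>i\<close> gives a
  polynomial in \<open>cis (2 * pi * \<sigma> i)\<close> whose coefficients \<open>q c a \<sigma>\<close> are polynomials in the other variables.
  The one that inherits a large coefficient is below \<open>\<theta>'\<close> with probability at most \<open>\<epsilon> / 2\<close>; if it is
  not, resampling variable \<open>i\<close> and the case of one variable give the remaining \<open>\<epsilon> / 2\<close>.\<close>

lemma trig_poly_small_ball:
  fixes \<phi> :: "'k \<Rightarrow> 'i \<Rightarrow> int"
  assumes "finite D" "finite F" "m > 0" "\<epsilon> > 0"
    and "\<And>\<kappa> \<kappa>'. \<kappa> \<in> F \<Longrightarrow> \<kappa>' \<in> F \<Longrightarrow> (\<And>i. i \<in> D \<Longrightarrow> \<phi> \<kappa> i = \<phi> \<kappa>' i) \<Longrightarrow> \<kappa> = \<kappa>'"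
  shows "\<exists>\<theta>>0. \<forall>c. (\<exists>\<kappa>\<in>F. cmod (c \<kappa>) \<ge> m) \<longrightarrow>
    measure uniform_seeds {\<sigma> \<in> space uniform_seeds.
      cmod (\<Sum>\<kappa>\<in>F. c \<kappa> * cis (2 * pi * (\<Sum>i\<in>D. of_int (\<phi> \<kappa> i) * \<sigma> i))) \<le> \<theta>} \<le> \<epsilon>"
  using assms
proof (induction D arbitrary: F m \<epsilon> rule: finite_induct)
  case empty
  have none: "{\<sigma> \<in> space (uniform_seeds :: ('i \<Rightarrow> real) measure). cmod (\<Sum>\<kappa>\<in>F. c \<kappa> * cis (2 * pi * (\<Sum>i\<in>{}. of_int (\<phi> \<kappa> i) * \<sigma> i))) \<le> m / 2} = {}"
    if "\<kappa> \<in> F" "cmod (c \<kappa>) \<ge> m" for c \<kappa>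
  proof -
    have "F = {\<kappa>}" using empty that by auto
    then show ?thesis using that \<open>m > 0\<close> by auto
  qed
  show ?case
  proof (intro exI[of _ "m / 2"] conjI allI impI)
    fix c :: "'k \<Rightarrow> complex" assume "\<exists>\<kappa>\<in>F. cmod (c \<kappa>) \<ge> m"
    then obtain \<kappa> where "\<kappa> \<in> F" "cmod (c \<kappa>) \<ge> m" by blast
    then have "{\<sigma> \<in> space (uniform_seeds :: ('i \<Rightarrow> real) measure).
      cmod (\<Sum>\<kappa>\<in>F. c \<kappa> * cis (2 * pi * (\<Sum>i\<in>{}. of_int (\<phi> \<kappa> i) * \<sigma> i))) \<le> m / 2} = {}"
      by (rule none)
    with \<open>\<epsilon> > 0\<close> show "measure uniform_seeds {\<sigma> \<in> space (uniform_seeds :: ('i \<Rightarrow> real) measure).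
      cmod (\<Sum>\<kappa>\<in>F. c \<kappa> * cis (2 * pi * (\<Sum>i\<in>{}. of_int (\<phi> \<kappa> i) * \<sigma> i))) \<le> m / 2} \<le> \<epsilon>"
      by (simp only: measure_empty)
  qed (use \<open>m > 0\<close> in simp)
next
  case (insert i D)
  note fin_F = insert.prems(1) and pos = insert.prems(2,3)
  let ?P = "uniform_seeds :: ('i \<Rightarrow> real) measure"
  define A where "A = (\<lambda>\<kappa>. \<phi> \<kappa> i) ` F"
  define H where "H a = {\<kappa> \<in> F. \<phi> \<kappa> i = a}" for a
  define q where "q c a \<sigma> = (\<Sum>\<kappa>\<in>H a. c \<kappa> * cis (2 * pi * (\<Sum>i\<in>D. of_int (\<phi> \<kappa> i) * \<sigma> i)))"
    for c a and \<sigma> :: "'i \<Rightarrow> real"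
  have "finite A" using fin_F pos by (simp add: A_def)
  have "\<exists>\<theta>>0. \<forall>c. (\<exists>\<kappa>\<in>H a. cmod (c \<kappa>) \<ge> m) \<longrightarrow>
      measure ?P {\<sigma> \<in> space ?P. cmod (q c a \<sigma>) \<le> \<theta>} \<le> \<epsilon> / 2" for a
    unfolding q_def
  proof (rule insert.IH)
    fix \<kappa> \<kappa>' assume "\<kappa> \<in> H a" "\<kappa>' \<in> H a" "\<And>i. i \<in> D \<Longrightarrow> \<phi> \<kappa> i = \<phi> \<kappa>' i"
    then show "\<kappa> = \<kappa>'" by (intro insert.prems(4)[of \<kappa> \<kappa>']) (auto simp: H_def)
  qed (use fin_F pos in \<open>auto simp: H_def\<close>)
  then have "\<forall>a. \<exists>\<theta>. \<theta> > 0 \<and> (\<forall>c. (\<exists>\<kappa>\<in>H a. cmod (c \<kappa>) \<ge> m) \<longrightarrow>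
      measure ?P {\<sigma> \<in> space ?P. cmod (q c a \<sigma>) \<le> \<theta>} \<le> \<epsilon> / 2)"
    by (rule allI)
  from choice[OF this] obtain \<Theta> where \<Theta>_pos: "\<And>a. \<Theta> a > 0" and
    \<Theta>: "\<And>a c. \<exists>\<kappa>\<in>H a. cmod (c \<kappa>) \<ge> m \<Longrightarrow>
      measure ?P {\<sigma> \<in> space ?P. cmod (q c a \<sigma>) \<le> \<Theta> a} \<le> \<epsilon> / 2"
    by blast
  \<comment> \<open>The element 1 covers the case of an empty frequency set.\<close>
  define \<theta>' where "\<theta>' = Min (insert 1 (\<Theta> ` A))"
  have \<theta>'_le: "\<theta>' \<le> \<Theta> a" if "a \<in> A" for a
    using that \<open>finite A\<close> by (simp add: \<theta>'_def)
  have "\<theta>' > 0" using \<open>finite A\<close> \<Theta>_pos by (simp add: \<theta>'_def)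
  obtain \<theta> where "\<theta> > 0" and \<theta>: "\<And>c a. a \<in> A \<Longrightarrow> cmod (c a) \<ge> \<theta>' \<Longrightarrow>
    measure unit_uniform {x \<in> {0..<1}. cmod (\<Sum>a\<in>A. c a * cis (2 * pi * (of_int a * x))) \<le> \<theta>} \<le> \<epsilon> / 2"
    using trig_poly_1d_small_ball[OF \<open>finite A\<close> \<open>\<theta>' > 0\<close>, of "\<epsilon> / 2"] fin_F pos by auto
  define p where "p c \<sigma> = (\<Sum>\<kappa>\<in>F. c \<kappa> * cis (2 * pi * (\<Sum>i\<in>insert i D. of_int (\<phi> \<kappa> i) * \<sigma> i)))"
    for c and \<sigma> :: "'i \<Rightarrow> real"
  have p_eq: "p c \<sigma> = (\<Sum>a\<in>A. q c a \<sigma> * cis (2 * pi * (of_int a * \<sigma> i)))" for c \<sigma>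
  proof -
    have "p c \<sigma> = (\<Sum>a\<in>A. \<Sum>\<kappa>\<in>H a. c \<kappa> * cis (2 * pi * (\<Sum>i\<in>insert i D. of_int (\<phi> \<kappa> i) * \<sigma> i)))"
      unfolding p_def H_def
      by (rule sum.group[symmetric]) (use fin_F pos \<open>finite A\<close> in \<open>auto simp: A_def\<close>)
    also have "\<dots> = (\<Sum>a\<in>A. q c a \<sigma> * cis (2 * pi * (of_int a * \<sigma> i)))"
      unfolding q_def sum_distrib_right
      by (intro sum.cong refl) (use insert.hyps in \<open>auto simp: H_def distrib_left simp flip: cis_mult\<close>)
    finally show ?thesis .
  qed
  have q_upd: "q c a (\<sigma>(i := x)) = q c a \<sigma>" for c a \<sigma> x
  proof -
    have "(\<Sum>j\<in>D. of_int (\<phi> \<kappa> j) * (\<sigma>(i := x)) j) = (\<Sum>j\<in>D. of_int (\<phi> \<kappa> j) * \<sigma> j)" for \<kappa>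
      using insert.hyps by (intro sum.cong) auto
    then show ?thesis unfolding q_def by simp
  qed
  have [measurable]: "(\<lambda>\<sigma>. q c a \<sigma>) \<in> borel_measurable ?P" for c a
    unfolding q_def by measurable
  have [measurable]: "(\<lambda>\<sigma>. p c \<sigma>) \<in> borel_measurable ?P" for c
    unfolding p_def by measurable
  have "measure ?P {\<sigma> \<in> space ?P. cmod (p c \<sigma>) \<le> \<theta>} \<le> \<epsilon>" if "\<kappa> \<in> F" "cmod (c \<kappa>) \<ge> m" for c \<kappa>
  proof -
    define a where "a = \<phi> \<kappa> i"
    have a: "a \<in> A" "\<kappa> \<in> H a" using that by (auto simp: a_def A_def H_def)
    let ?B = "{\<sigma> \<in> space ?P. cmod (q c a \<sigma>) \<le> \<theta>'}"
    let ?E = "{\<sigma> \<in> space ?P. cmod (p c \<sigma>) \<le> \<theta> \<and> cmod (q c a \<sigma>) > \<theta>'}"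
    have "measure ?P ?B \<le> measure ?P {\<sigma> \<in> space ?P. cmod (q c a \<sigma>) \<le> \<Theta> a}"
      using \<theta>'_le[OF a(1)] by (intro uniform_seeds.finite_measure_mono) auto
    also have "\<dots> \<le> \<epsilon> / 2" by (rule \<Theta>) (use a(2) that(2) in blast)
    finally have B: "measure ?P ?B \<le> \<epsilon> / 2" .
    have "measure ?P (?E \<inter> space ?P) \<le> \<epsilon> / 2 * measure ?P (space ?P)"
    proof (rule resampling_bound[where i = i])
      fix \<sigma> assume \<sigma>: "\<sigma> \<in> space ?P"
      show "measure unit_uniform {x \<in> {0..<1}. \<sigma>(i := x) \<in> ?E} \<le> \<epsilon> / 2"
      proof (cases "cmod (q c a \<sigma>) > \<theta>'")
        case True
        have "{x \<in> {0..<1}. \<sigma>(i := x) \<in> ?E} =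
            {x \<in> {0..<1}. cmod (\<Sum>a\<in>A. q c a \<sigma> * cis (2 * pi * (of_int a * x))) \<le> \<theta>}"
          using True \<sigma> by (auto simp: p_eq q_upd)
        then show ?thesis using \<theta>[OF a(1), of "\<lambda>a. q c a \<sigma>"] True by simp
      next
        case False
        then have empty: "{x \<in> {0..<1}. \<sigma>(i := x) \<in> ?E} = {}" by (auto simp: q_upd)
        show ?thesis unfolding empty using fin_F pos by simp
      qed
    next
      show "?E \<in> sets ?P" by measurable
    qed (use pos in auto)
    then have E: "measure ?P ?E \<le> \<epsilon> / 2"
      by (simp add: uniform_seeds.prob_space Int_absorb2 Collect_restrict)
    have "measure ?P {\<sigma> \<in> space ?P. cmod (p c \<sigma>) \<le> \<theta>} \<le> measure ?P (?B \<union> ?E)"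
      by (intro uniform_seeds.finite_measure_mono) auto
    also have "\<dots> \<le> measure ?P ?B + measure ?P ?E"
      by (intro measure_Un_le) measurable
    also have "\<dots> \<le> \<epsilon> / 2 + \<epsilon> / 2" using B E by (rule add_mono)
    finally show ?thesis by simp
  qed
  with \<open>\<theta> > 0\<close> show ?case unfolding p_def by blast
qed


section \<open>Collisions in random rank-1 lattices\<close>

text \<open>In lattice number \<open>l\<close>, whose generating vector is read from the draws \<open>gen l j\<close>, some other frequency
  of \<open>K\<close> has the same bin as \<open>k\<close>.\<close>

definition collides :: "nat \<Rightarrow> nat \<Rightarrow> (nat \<Rightarrow> nat \<Rightarrow> 'i) \<Rightarrow> freq set \<Rightarrow> freq \<Rightarrow> ('i \<Rightarrow> real) \<Rightarrow> nat \<Rightarrow> bool" where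
  "collides M n gen K k \<sigma> l \<longleftrightarrow>
    (\<exists>k'\<in>K - {k}. int M dvd (\<Sum>j<n. (k' ! j - k ! j) * \<lfloor>real M * \<sigma> (gen l j)\<rfloor>))"

lemma measurable_lattice_sum [measurable]:
  "(\<lambda>\<sigma>. \<Sum>j<n. h j * \<lfloor>real M * \<sigma> (gen l j)\<rfloor>) \<in> measurable uniform_seeds (count_space UNIV)"
proof -
  have "(\<lambda>\<sigma>. \<lfloor>\<Sum>j<n. real_of_int (h j) * real_of_int \<lfloor>real M * \<sigma> (gen l j)\<rfloor>\<rfloor>)
      \<in> measurable uniform_seeds (count_space UNIV)"
  proof (rule measurable_compose[OF _ measurable_real_floor])
    have "(\<lambda>\<sigma>. real_of_int \<lfloor>real M * \<sigma> (gen l j)\<rfloor>) \<in> borel_measurable uniform_seeds" for j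
      by (rule measurable_compose[OF _ borel_measurable_real_floor]) measurable
    then show "(\<lambda>\<sigma>. \<Sum>j<n. real_of_int (h j) * real_of_int \<lfloor>real M * \<sigma> (gen l j)\<rfloor>)
        \<in> borel_measurable uniform_seeds"
      by (intro borel_measurable_sum borel_measurable_times borel_measurable_const)
  qed
  moreover have "(\<lambda>\<sigma>. \<lfloor>\<Sum>j<n. real_of_int (h j) * real_of_int \<lfloor>real M * \<sigma> (gen l j)\<rfloor>\<rfloor>) =
      (\<lambda>\<sigma>. \<Sum>j<n. h j * \<lfloor>real M * \<sigma> (gen l j)\<rfloor>)"
    by (simp flip: of_int_mult of_int_sum)
  ultimately show ?thesis by simp
qed

lemma measurable_collides [measurable]:
  "finite K \<Longrightarrow> Measurable.pred uniform_seeds (\<lambda>\<sigma>. collides M n gen K k \<sigma> l)"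
  unfolding collides_def by measurable

text \<open>For prime \<open>M\<close> the congruence determines the residue \<open>\<lfloor>M * x\<rfloor>\<close>, hence confines \<open>x\<close> to an interval of
  length \<open>1 / M\<close>.\<close>

lemma lattice_section_measure:
  fixes h :: int
  assumes "prime M" "\<not> int M dvd h"
  shows "measure unit_uniform {x \<in> {0..<1}. int M dvd (h * \<lfloor>real M * x\<rfloor> + b)} \<le> 1 / real M"
proof (cases "{x \<in> {0..<1}. int M dvd (h * \<lfloor>real M * x\<rfloor> + b)} = {}")
  case True
  show ?thesis unfolding True by simp
next
  case False
  have M: "M > 0" using prime_gt_0_nat[OF assms(1)] .
  from False obtain x0 where x0: "x0 \<in> {0..<1}" "int M dvd (h * \<lfloor>real M * x0\<rfloor> + b)" by auto
  define v where "v = \<lfloor>real M * x0\<rfloor>"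
  have range: "0 \<le> \<lfloor>real M * x\<rfloor>" "\<lfloor>real M * x\<rfloor> < int M" if "x \<in> {0..<1}" for x :: real
    using that M by (auto simp: floor_less_iff)
  have sub: "{x \<in> {0..<1}. int M dvd (h * \<lfloor>real M * x\<rfloor> + b)} \<subseteq> {v / real M..(v + 1) / real M}"
  proof
    fix x assume x: "x \<in> {x \<in> {0..<1}. int M dvd (h * \<lfloor>real M * x\<rfloor> + b)}"
    then have "int M dvd (h * \<lfloor>real M * x\<rfloor> + b) - (h * v + b)"
      using x0 by (intro dvd_diff) (auto simp: v_def)
    then have "int M dvd h * (\<lfloor>real M * x\<rfloor> - v)" by (simp add: algebra_simps)
    moreover have "prime (int M)" using assms(1) by simp
    ultimately have "int M dvd \<lfloor>real M * x\<rfloor> - v"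
      using assms(2) prime_dvd_mult_iff by blast
    moreover have "\<bar>\<lfloor>real M * x\<rfloor> - v\<bar> < int M"
    proof -
      have "x \<in> {0..<1}" using x by blast
      from range[OF this] range[OF x0(1)] show ?thesis unfolding v_def by linarith
    qed
    ultimately have "\<lfloor>real M * x\<rfloor> = v"
      by (metis dvd_imp_le_int not_le eq_iff_diff_eq_0 abs_of_nat)
    then have "v \<le> real M * x" "real M * x \<le> v + 1" by linarith+
    then show "x \<in> {v / real M..(v + 1) / real M}"
      using M by (simp add: field_simps)
  qed
  have "emeasure lborel {x \<in> {0..<1}. int M dvd (h * \<lfloor>real M * x\<rfloor> + b)} \<le> emeasure lborel {v / real M..(v + 1) / real M}"
    by (rule emeasure_mono[OF sub]) auto
  also have "\<dots> = ennreal (1 / real M)"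
    using M by (simp add: field_simps)
  finally have "emeasure unit_uniform {x \<in> {0..<1}. int M dvd (h * \<lfloor>real M * x\<rfloor> + b)} \<le> ennreal (1 / real M)"
    by (subst emeasure_restrict_space) auto
  then show ?thesis
    by (simp add: unit_uniform.emeasure_eq_measure)
qed

context
  fixes M n :: nat and gen :: "nat \<Rightarrow> nat \<Rightarrow> 'i" and K :: "freq set" and k :: freq
  assumes prime: "prime M" and fin: "finite K"
    and inj: "\<And>l j l' j'. gen l j = gen l' j' \<Longrightarrow> l = l' \<and> j = j'"
    and distinct: "\<And>k'. k' \<in> K - {k} \<Longrightarrow> \<exists>j<n. \<not> int M dvd (k' ! j - k ! j)"
begin

text \<open>For each of the other frequencies, resample a component of the generating vector in which the two
  frequencies differ modulo \<open>M\<close>.  The event \<open>F\<close>, independent of lattice \<open>l\<close>, will consist of the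
  collisions in other lattices.\<close>

lemma collision_bound:
  assumes F [measurable]: "F \<in> sets uniform_seeds"
    and indep: "\<And>\<sigma> j x. \<sigma> \<in> space uniform_seeds \<Longrightarrow> x \<in> {0..<1} \<Longrightarrow> \<sigma>(gen l j := x) \<in> F \<Longrightarrow> \<sigma> \<in> F"
  shows "measure uniform_seeds ({\<sigma> \<in> space uniform_seeds. collides M n gen K k \<sigma> l} \<inter> F)
    \<le> real (card (K - {k})) / real M * measure uniform_seeds F"
proof -
  let ?P = "uniform_seeds :: ('i \<Rightarrow> real) measure"
  let ?C = "\<lambda>k'. {\<sigma> \<in> space ?P. int M dvd (\<Sum>j<n. (k' ! j - k ! j) * \<lfloor>real M * \<sigma> (gen l j)\<rfloor>)}"
  have "measure ?P ({\<sigma> \<in> space ?P. collides M n gen K k \<sigma> l} \<inter> F) = measure ?P (\<Union>k'\<in>K - {k}. ?C k' \<inter> F)"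
    by (intro arg_cong[of _ _ "measure ?P"]) (auto simp: collides_def)
  also have "\<dots> \<le> (\<Sum>k'\<in>K - {k}. measure ?P (?C k' \<inter> F))"
    using fin by (intro uniform_seeds.finite_measure_subadditive_finite) auto
  also have "\<dots> \<le> (\<Sum>k'\<in>K - {k}. 1 / real M * measure ?P F)"
  proof (rule sum_mono)
    fix k' assume "k' \<in> K - {k}"
    then obtain j where j: "j < n" "\<not> int M dvd (k' ! j - k ! j)" using distinct by blast
    show "measure ?P (?C k' \<inter> F) \<le> 1 / real M * measure ?P F"
    proof (rule resampling_bound[where i = "gen l j", OF _ F indep])
      fix \<sigma> assume \<sigma>: "\<sigma> \<in> space ?P"
      define b where "b = (\<Sum>j'\<in>{..<n} - {j}. (k' ! j' - k ! j') * \<lfloor>real M * \<sigma> (gen l j')\<rfloor>)"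
      have "(\<Sum>j'<n. (k' ! j' - k ! j') * \<lfloor>real M * (\<sigma>(gen l j := x)) (gen l j')\<rfloor>)
          = (k' ! j - k ! j) * \<lfloor>real M * x\<rfloor> + b" for x
      proof -
        have "gen l j' = gen l j \<longleftrightarrow> j' = j" for j' using inj by blast
        then show ?thesis
          unfolding b_def using j(1) by (subst sum.remove[of _ j]) (auto intro!: sum.cong)
      qed
      then have "{x \<in> {0..<1}. \<sigma>(gen l j := x) \<in> ?C k'} =
          {x \<in> {0..<1}. int M dvd ((k' ! j - k ! j) * \<lfloor>real M * x\<rfloor> + b)}"
        using \<sigma> by auto
      then show "measure unit_uniform {x \<in> {0..<1}. \<sigma>(gen l j := x) \<in> ?C k'} \<le> 1 / real M"
        using lattice_section_measure[OF prime j(2), of b] by simp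
    next
      show "?C k' \<in> sets ?P" by measurable
    qed auto
  qed
  also have "\<dots> = real (card (K - {k})) / real M * measure ?P F" by simp
  finally show ?thesis .
qed

lemma repeated_collisions_bound:
  assumes "finite B"
  shows "measure uniform_seeds {\<sigma> \<in> space uniform_seeds. \<forall>l\<in>B. collides M n gen K k \<sigma> l}
    \<le> (real (card (K - {k})) / real M) ^ card B"
  using assms
proof (induction B rule: finite_induct)
  case (insert l B)
  let ?P = "uniform_seeds :: ('i \<Rightarrow> real) measure"
  let ?F = "{\<sigma> \<in> space ?P. \<forall>l\<in>B. collides M n gen K k \<sigma> l}"
  have "{\<sigma> \<in> space ?P. \<forall>l\<in>insert l B. collides M n gen K k \<sigma> l} =
      {\<sigma> \<in> space ?P. collides M n gen K k \<sigma> l} \<inter> ?F" by auto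
  moreover have "measure ?P ({\<sigma> \<in> space ?P. collides M n gen K k \<sigma> l} \<inter> ?F) \<le>
      real (card (K - {k})) / real M * measure ?P ?F"
  proof (rule collision_bound)
    show "?F \<in> sets ?P" using fin insert.hyps by measurable
    fix \<sigma> j and x :: real
    assume \<sigma>: "\<sigma> \<in> space ?P" and "x \<in> {0..<1}" "\<sigma>(gen l j := x) \<in> ?F"
    moreover have "collides M n gen K k (\<sigma>(gen l j := x)) l' = collides M n gen K k \<sigma> l'" if "l' \<in> B" for l'
    proof -
      have "gen l' j' \<noteq> gen l j" for j' using inj that insert.hyps by blast
      then show ?thesis by (simp add: collides_def)
    qed
    ultimately show "\<sigma> \<in> ?F" by auto
  qed
  moreover have "\<dots> \<le> real (card (K - {k})) / real M * (real (card (K - {k})) / real M) ^ card B"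
    by (intro mult_left_mono insert.IH) auto
  ultimately show ?case using insert.hyps by simp
qed (simp add: uniform_seeds.prob_space)

text \<open>Union bound over the at most \<open>2 ^ L\<close> sets \<open>B\<close> of at least \<open>L / 2\<close> lattices; in all lattices of \<open>B\<close> there
  is a collision with probability at most \<open>(1 / 16) ^ (L / 2) = (1 / 4) ^ L\<close>.\<close>

lemma majority_collisions_bound:
  assumes sparse: "16 * card (K - {k}) \<le> M"
  shows "measure uniform_seeds {\<sigma> \<in> space uniform_seeds. 2 * card {l. l < L \<and> collides M n gen K k \<sigma> l} \<ge> L}
    \<le> (1 / 2) ^ L"
proof -
  let ?P = "uniform_seeds :: ('i \<Rightarrow> real) measure"
  let ?p = "real (card (K - {k})) / real M"
  let ?\<B> = "{B. B \<subseteq> {..<L} \<and> L \<le> 2 * card B}"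
  have "M > 0" using prime_gt_0_nat[OF prime] .
  have "real (16 * card (K - {k})) \<le> real M" using sparse by (simp only: of_nat_le_iff)
  then have p: "?p \<le> 1 / 16" using \<open>M > 0\<close> by (simp add: field_simps)
  have "measure ?P {\<sigma> \<in> space ?P. 2 * card {l. l < L \<and> collides M n gen K k \<sigma> l} \<ge> L} \<le>
      measure ?P (\<Union>B\<in>?\<B>. {\<sigma> \<in> space ?P. \<forall>l\<in>B. collides M n gen K k \<sigma> l})"
  proof (rule uniform_seeds.finite_measure_mono)
    show "{\<sigma> \<in> space ?P. 2 * card {l. l < L \<and> collides M n gen K k \<sigma> l} \<ge> L} \<subseteq>
        (\<Union>B\<in>?\<B>. {\<sigma> \<in> space ?P. \<forall>l\<in>B. collides M n gen K k \<sigma> l})"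
    proof
      fix \<sigma> assume "\<sigma> \<in> {\<sigma> \<in> space ?P. 2 * card {l. l < L \<and> collides M n gen K k \<sigma> l} \<ge> L}"
      then show "\<sigma> \<in> (\<Union>B\<in>?\<B>. {\<sigma> \<in> space ?P. \<forall>l\<in>B. collides M n gen K k \<sigma> l})"
        by (intro UN_I[of "{l. l < L \<and> collides M n gen K k \<sigma> l}"]) auto
    qed
    show "(\<Union>B\<in>?\<B>. {\<sigma> \<in> space ?P. \<forall>l\<in>B. collides M n gen K k \<sigma> l}) \<in> sets ?P"
      using fin by (intro sets.finite_UN) (auto intro: finite_subset, measurable)
  qed
  also have "\<dots> \<le> (\<Sum>B\<in>?\<B>. measure ?P {\<sigma> \<in> space ?P. \<forall>l\<in>B. collides M n gen K k \<sigma> l})"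
    using fin by (intro uniform_seeds.finite_measure_subadditive_finite) (auto, measurable)
  also have "\<dots> \<le> (\<Sum>B\<in>?\<B>. (1 / 4) ^ L)"
  proof (rule sum_mono)
    fix B assume "B \<in> ?\<B>"
    then have B: "finite B" "L \<le> 2 * card B" by (auto intro: finite_subset)
    have "measure ?P {\<sigma> \<in> space ?P. \<forall>l\<in>B. collides M n gen K k \<sigma> l} \<le> ?p ^ card B"
      by (rule repeated_collisions_bound[OF B(1)])
    also have "\<dots> \<le> (1 / 16) ^ card B" by (intro power_mono p) auto
    also have "\<dots> = (1 / 4) ^ (2 * card B)" by (simp add: power_mult power_divide)
    also have "\<dots> \<le> (1 / 4) ^ L" by (intro power_decreasing B) auto
    finally show "measure ?P {\<sigma> \<in> space ?P. \<forall>l\<in>B. collides M n gen K k \<sigma> l} \<le> (1 / 4) ^ L" .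
  qed
  also have "\<dots> = real (card ?\<B>) * (1 / 4) ^ L" by simp
  also have "\<dots> \<le> 2 ^ L * (1 / 4) ^ L"
  proof (intro mult_right_mono)
    have "card ?\<B> \<le> card (Pow {..<L})" by (intro card_mono) auto
    then have "real (card ?\<B>) \<le> real (2 ^ L)" by (simp only: card_Pow finite_lessThan card_lessThan of_nat_le_iff)
    then show "real (card ?\<B>) \<le> 2 ^ L" by simp
  qed auto
  also have "\<dots> = (1 / 2) ^ L" by (simp flip: power_mult_distrib)
  finally show ?thesis .
qed

end


section \<open>Sampling along rank-1 lattices\<close>

lemma trig_poly_cis: "trig_poly I c y = (\<Sum>k\<in>I. c k * cis (2 * pi * (\<Sum>j<length k. of_int (k ! j) * y ! j)))"
  by (simp add: trig_poly_def cis_conv_exp mult_ac)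

lemma cis_cong_2pi: "x - y \<in> \<int> \<Longrightarrow> cis (2 * pi * x) = cis (2 * pi * y)"
proof -
  assume "x - y \<in> \<int>"
  then obtain m :: int where "x - y = of_int m" by (elim Ints_cases)
  then have "2 * pi * x = 2 * pi * y + 2 * pi * of_int m" by (simp add: algebra_simps)
  then show ?thesis by (simp only: cis_period)
qed

text \<open>Aliasing: a transform of length \<open>N\<close> adds up the coefficients of all frequencies in a residue class.\<close>

lemma dft_of_exponential_sum:
  fixes \<phi> :: "'k \<Rightarrow> int"
  assumes "finite S" "N > 0" "j < N"
  shows "result (fft (map (\<lambda>l. \<Sum>\<kappa>\<in>S. b \<kappa> * cis (2 * pi * (real l * of_int (\<phi> \<kappa>) / real N))) [0..<N])) F ! j / of_nat N
    = (\<Sum>\<kappa>\<in>{\<kappa> \<in> S. \<phi> \<kappa> mod int N = int j}. b \<kappa>)"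
proof -
  let ?v = "\<lambda>l. \<Sum>\<kappa>\<in>S. b \<kappa> * cis (2 * pi * (real l * of_int (\<phi> \<kappa>) / real N))"
  have *: "cis (2 * pi * (real l * of_int (\<phi> \<kappa>) / real N)) * cis (- 2 * pi * real (l * j) / real N)
      = cis (2 * pi * real l * of_int (\<phi> \<kappa> - int j) / real N)" for l \<kappa>
    using \<open>N > 0\<close> by (simp add: cis_mult field_simps)
  have "result (fft (map ?v [0..<N])) F ! j = (\<Sum>l<N. ?v l * cis (- 2 * pi * real (l * j) / real N))"
    using assms by (simp add: fft_result[of _ N])
  also have "\<dots> = (\<Sum>l<N. \<Sum>\<kappa>\<in>S. b \<kappa> * cis (2 * pi * real l * of_int (\<phi> \<kappa> - int j) / real N))"
    unfolding sum_distrib_right by (intro sum.cong refl) (simp only: mult.assoc[of "b _"] *)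
  also have "\<dots> = (\<Sum>\<kappa>\<in>S. \<Sum>l<N. b \<kappa> * cis (2 * pi * real l * of_int (\<phi> \<kappa> - int j) / real N))"
    by (rule sum.swap)
  also have "\<dots> = (\<Sum>\<kappa>\<in>S. b \<kappa> * (if int N dvd \<phi> \<kappa> - int j then of_nat N else 0))"
    by (simp only: sum_distrib_left[symmetric] sum_roots_of_unity[OF \<open>N > 0\<close>])
  also have "\<dots> = (\<Sum>\<kappa>\<in>S. of_nat N * (if \<phi> \<kappa> mod int N = int j then b \<kappa> else 0))"
  proof (rule sum.cong[OF refl])
    fix \<kappa> assume "\<kappa> \<in> S"
    have "int N dvd \<phi> \<kappa> - int j \<longleftrightarrow> \<phi> \<kappa> mod int N = int j mod int N"
      by (simp add: mod_eq_dvd_iff)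
    then have "int N dvd \<phi> \<kappa> - int j \<longleftrightarrow> \<phi> \<kappa> mod int N = int j"
      using \<open>j < N\<close> by simp
    then show "b \<kappa> * (if int N dvd \<phi> \<kappa> - int j then of_nat N else 0) =
        of_nat N * (if \<phi> \<kappa> mod int N = int j then b \<kappa> else 0)" by simp
  qed
  also have "\<dots> = of_nat N * (\<Sum>\<kappa>\<in>{\<kappa> \<in> S. \<phi> \<kappa> mod int N = int j}. b \<kappa>)"
    using \<open>finite S\<close> by (simp add: sum.inter_filter sum_distrib_left)
  finally show ?thesis using \<open>N > 0\<close> by simp
qed

definition dot :: "freq \<Rightarrow> freq \<Rightarrow> int" where
  "dot k z = (\<Sum>j<length k. k ! j * z ! j)"

lemma bin_simps [simp]:
  "length k = length z \<Longrightarrow> result (bin M k z) F = nat (dot k z mod int M)"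
  "locations (bin M k z) F = {}"
  by (simp_all add: bin_def inner_prod_result dot_def)

lemma bin_operations: "operations (bin M k z) F \<le> 2 * length z + 1"
  using inner_prod_operations[of k z F] by (simp add: bin_def)

text \<open>Reducing the nodes modulo 1 changes the phase by an integer, so along the lattice the polynomial is
  a univariate exponential sum with frequencies \<open>dot k z\<close>.\<close>

lemma trig_poly_on_lattice:
  assumes "\<And>k. k \<in> K \<Longrightarrow> length k = length z" "M > 0"
  shows "map (trig_poly K b) (rank1_lattice z M) =
    map (\<lambda>i. \<Sum>k\<in>K. b k * cis (2 * pi * (real i * of_int (dot k z) / real M))) [0..<M]"
  unfolding rank1_lattice_def map_map comp_def trig_poly_cis
proof (rule map_cong[OF refl], rule sum.cong[OF refl])
  fix i k assume k: "k \<in> K"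
  let ?y = "map (\<lambda>a. frac (real i / real M * real_of_int a)) z"
  have "(\<Sum>j<length k. of_int (k ! j) * ?y ! j) - real i * of_int (dot k z) / real M =
      (\<Sum>j<length k. of_int (k ! j) * ?y ! j - of_int (k ! j) * (real i / real M * of_int (z ! j)))"
    by (simp add: dot_def sum_subtractf sum_distrib_left sum_divide_distrib mult_ac)
  also have "\<dots> = (\<Sum>j<length k. of_int (- (k ! j) * \<lfloor>real i / real M * of_int (z ! j)\<rfloor>))"
    using assms(1)[OF k] by (intro sum.cong) (auto simp: frac_def algebra_simps)
  also have "\<dots> \<in> \<int>" by (intro Ints_sum Ints_of_int)
  finally show "b k * cis (2 * pi * (\<Sum>j<length k. of_int (k ! j) * ?y ! j)) =
      b k * cis (2 * pi * (real i * of_int (dot k z) / real M))"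
    by (simp only: cis_cong_2pi)
qed

lemma rank1_lattice_length [simp]: "length (rank1_lattice z M) = M"
  by (simp add: rank1_lattice_def)

lemma rank1_lattice_torus: "set (rank1_lattice z M) \<subseteq> torus (length z)"
  by (auto simp: rank1_lattice_def torus_def frac_ge_0 frac_lt_1)

lemma take_drop_concat:
  assumes "\<And>z. z \<in> set zs \<Longrightarrow> length (f z) = M" "l < length zs"
  shows "take M (drop (l * M) (concat (map f zs))) = f (zs ! l)"
  using assms
proof (induction zs arbitrary: l)
  case (Cons z zs)
  then show ?case by (cases l) auto
qed simp

lemma lattice_ffts_result:
  assumes vs: "vs = concat (map (\<lambda>z. map (trig_poly K b) (rank1_lattice z M)) zs)"
    and len: "\<And>z. z \<in> set zs \<Longrightarrow> length z = n" "\<And>k. k \<in> K \<Longrightarrow> length k = n"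
    and "finite K" "M > 0" "L = length zs" "l < L" "j < M"
  shows "result (lattice_ffts M L vs) F ! l ! j = (\<Sum>k\<in>{k \<in> K. nat (dot k (zs ! l) mod int M) = j}. b k)"
proof -
  let ?w = "map (\<lambda>i. \<Sum>k\<in>K. b k * cis (2 * pi * (real i * of_int (dot k (zs ! l)) / real M))) [0..<M]"
  have "take M (drop (l * M) vs) = map (trig_poly K b) (rank1_lattice (zs ! l) M)"
    unfolding vs by (rule take_drop_concat) (use assms in auto)
  also have "\<dots> = ?w"
    using assms by (intro trig_poly_on_lattice) auto
  finally have block: "take M (drop (l * M) vs) = ?w" .
  have "length (result (fft ?w) F) = M"
    by (subst fft_result[of _ M]) (use \<open>M > 0\<close> in simp_all)
  then have "result (lattice_ffts M L vs) F ! l ! j = result (fft ?w) F ! j / of_nat M"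
    unfolding lattice_ffts_def mapP_simps using \<open>l < L\<close> \<open>j < M\<close> by (simp add: block)
  also have "\<dots> = (\<Sum>k\<in>{k \<in> K. dot k (zs ! l) mod int M = int j}. b k)"
    by (rule dft_of_exponential_sum) (use assms in auto)
  also have "{k \<in> K. dot k (zs ! l) mod int M = int j} = {k \<in> K. nat (dot k (zs ! l) mod int M) = j}"
    using \<open>M > 0\<close> by (auto simp: nat_eq_iff)
  finally show ?thesis .
qed

lemma lattice_ffts_locations [simp]: "locations (lattice_ffts M L vs) F = {}"
  by (simp add: lattice_ffts_def)

lemma lattice_ffts_operations:
  assumes "length vs = L * M" "M > 0" "2 * M \<le> 2 ^ e"
  shows "operations (lattice_ffts M L vs) F \<le> L * (M * (24 * e + 31))"
proof -
  have "operations (fft (take M (drop (l * M) vs))) F + length (result (fft (take M (drop (l * M) vs))) F)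
      \<le> M * (24 * e + 31)" if "l < L" for l
  proof -
    have "l * M + M \<le> L * M" using that by (metis add.commute mult_Suc mult_le_mono1 Suc_leI)
    then have len: "length (take M (drop (l * M) vs)) = M" using assms by simp
    have "operations (fft (take M (drop (l * M) vs))) F \<le> M * (24 * e + 30)"
      using fft_operations[of "take M (drop (l * M) vs)" e F, unfolded len] assms(2,3) by blast
    moreover have "length (result (fft (take M (drop (l * M) vs))) F) = M"
      using fft_result[OF len \<open>M > 0\<close>] by simp
    ultimately show ?thesis by (simp add: algebra_simps)
  qed
  then have "operations (lattice_ffts M L vs) F \<le> (\<Sum>l\<leftarrow>[0..<L]. M * (24 * e + 31))"
    unfolding lattice_ffts_def mapP_simps
    by (intro sum_list_mono) (simp add: sum_list_triv)
  then show ?thesis by (simp add: sum_list_triv)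
qed

lemma generators_simps:
  "result (generators M L n u) F = map (\<lambda>l. map (\<lambda>j. \<lfloor>real M * u l j\<rfloor>) [0..<n]) [0..<L]"
  "locations (generators M L n u) F = {}"
  "operations (generators M L n u) F = 2 * L * n"
  by (simp_all add: generators_def sum_list_triv)

lemma lattice_union_simps:
  "result (lattice_union M zs) F = concat (map (\<lambda>z. rank1_lattice z M) zs)"
  "locations (lattice_union M zs) F = {}"
  "operations (lattice_union M zs) F = (\<Sum>z\<leftarrow>zs. 3 * M * length z)"
  by (simp_all add: lattice_union_def)

definition lattice_gens :: "nat \<Rightarrow> nat \<Rightarrow> nat \<Rightarrow> (nat \<Rightarrow> nat \<Rightarrow> real) \<Rightarrow> freq list" where
  "lattice_gens M L n u = map (\<lambda>l. map (\<lambda>j. \<lfloor>real M * u l j\<rfloor>) [0..<n]) [0..<L]"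

lemma lattice_gens_props [simp]:
  "length (lattice_gens M L n u) = L"
  "z \<in> set (lattice_gens M L n u) \<Longrightarrow> length z = n"
  "l < L \<Longrightarrow> length (lattice_gens M L n u ! l) = n"
  by (auto simp: lattice_gens_def)

lemma bins_collide_iff:
  assumes "length k = n" "length k' = n" "l < L" "M > 0"
  shows "nat (dot k' (lattice_gens M L n u ! l) mod int M) = nat (dot k (lattice_gens M L n u ! l) mod int M)
    \<longleftrightarrow> int M dvd (\<Sum>j<n. (k' ! j - k ! j) * \<lfloor>real M * u l j\<rfloor>)"
proof -
  have "dot k' (lattice_gens M L n u ! l) - dot k (lattice_gens M L n u ! l) =
      (\<Sum>j<n. (k' ! j - k ! j) * \<lfloor>real M * u l j\<rfloor>)"
    using assms by (simp add: dot_def lattice_gens_def sum_subtractf left_diff_distrib)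
  moreover have "nat (a mod int M) = nat (b mod int M) \<longleftrightarrow> int M dvd a - b" for a b
    using \<open>M > 0\<close> by (simp add: mod_eq_dvd_iff eq_nat_nat_iff)
  ultimately show ?thesis by simp
qed

text \<open>Without collision the bin of \<open>k\<close> contains no element of \<open>K\<close> but possibly \<open>k\<close> itself.\<close>

lemma bin_coefficient:
  assumes "finite K" "\<And>k. k \<in> K \<Longrightarrow> length k = n" "length k = n" "l < L" "M > 0"
    and no: "\<not> collides M n gen K k \<sigma> l"
  shows "(\<Sum>k'\<in>{k' \<in> K. nat (dot k' (lattice_gens M L n (\<lambda>l j. \<sigma> (gen l j)) ! l) mod int M) =
      nat (dot k (lattice_gens M L n (\<lambda>l j. \<sigma> (gen l j)) ! l) mod int M)}. b k') = (if k \<in> K then b k else 0)"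
proof -
  have eq: "{k' \<in> K. nat (dot k' (lattice_gens M L n (\<lambda>l j. \<sigma> (gen l j)) ! l) mod int M) =
      nat (dot k (lattice_gens M L n (\<lambda>l j. \<sigma> (gen l j)) ! l) mod int M)} = K \<inter> {k}"
    using no assms by (auto simp: bins_collide_iff collides_def)
  show ?thesis unfolding eq by (cases "k \<in> K") auto
qed

definition lattice_points :: "nat \<Rightarrow> freq list \<Rightarrow> point list" where
  "lattice_points M zs = concat (map (\<lambda>z. rank1_lattice z M) zs)"

lemma lattice_points_length: "length (lattice_points M zs) = length zs * M"
  by (simp add: lattice_points_def length_concat comp_def sum_list_triv)

lemma lattice_points_torus: "(\<And>z. z \<in> set zs \<Longrightarrow> length z = n) \<Longrightarrow> set (lattice_points M zs) \<subseteq> torus n"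
  using rank1_lattice_torus by (fastforce simp: lattice_points_def)

text \<open>The decoding procedure returned by \<open>random_rank1_method\<close>.\<close>

definition majority_decoder :: "nat \<Rightarrow> nat \<Rightarrow> freq list \<Rightarrow> nat list list \<Rightarrow> complex list \<Rightarrow> (freq \<times> complex) list prog" where
  "majority_decoder M L J bins vs = do {
       cs \<leftarrow> lattice_ffts M L vs;
       mapP (\<lambda>(k, bs). do {
               c \<leftarrow> majority 0 0 (map (\<lambda>l. cs ! l ! (bs ! l)) [0..<L]);
               Return (k, c) }) (zip J bins) }"

definition lattice_bins :: "nat \<Rightarrow> freq list \<Rightarrow> freq list \<Rightarrow> nat list list" where
  "lattice_bins M zs J = map (\<lambda>k. map (\<lambda>z. nat (dot k z mod int M)) zs) J"

lemma random_rank1_method_result: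
  assumes "\<And>k. k \<in> set J \<Longrightarrow> length k = n"
  shows "result (random_rank1_method M L n J u) F =
    (lattice_points M (lattice_gens M L n u),
     majority_decoder M L J (lattice_bins M (lattice_gens M L n u) J))"
proof -
  have "map (\<lambda>k. map (\<lambda>z. result (bin M k z) F) (lattice_gens M L n u)) J = lattice_bins M (lattice_gens M L n u) J"
    unfolding lattice_bins_def by (intro map_cong refl) (use assms in auto)
  then show ?thesis
    by (simp add: random_rank1_method_def generators_simps lattice_union_simps
        lattice_gens_def[symmetric] lattice_points_def majority_decoder_def[abs_def])
qed

lemma random_rank1_method_locations [simp]: "locations (random_rank1_method M L n J u) F = {}"
  by (simp add: random_rank1_method_def generators_simps lattice_union_simps)

lemma random_rank1_method_operations:
  "operations (random_rank1_method M L n J u) F \<le> 2 * L * n + 3 * M * n * L + length J * (L * (2 * n + 1))"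
proof -
  have "(\<Sum>z\<leftarrow>lattice_gens M L n u. 3 * M * length z) = 3 * M * n * L"
    by (simp add: lattice_gens_def sum_list_triv comp_def)
  moreover have "(\<Sum>k\<leftarrow>J. \<Sum>z\<leftarrow>lattice_gens M L n u. operations (bin M k z) F) \<le> length J * (L * (2 * n + 1))"
  proof -
    have "(\<Sum>z\<leftarrow>lattice_gens M L n u. operations (bin M k z) F) \<le> (\<Sum>z\<leftarrow>lattice_gens M L n u. 2 * n + 1)" for k
    proof (rule sum_list_mono)
      fix z assume "z \<in> set (lattice_gens M L n u)"
      then show "operations (bin M k z) F \<le> 2 * n + 1" using bin_operations[of M k z F] by simp
    qed
    then have "(\<Sum>k\<leftarrow>J. \<Sum>z\<leftarrow>lattice_gens M L n u. operations (bin M k z) F) \<le>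
        (\<Sum>k\<leftarrow>J. \<Sum>z\<leftarrow>lattice_gens M L n u. 2 * n + 1)" by (rule sum_list_mono)
    then show ?thesis by (simp add: sum_list_triv)
  qed
  ultimately show ?thesis
    by (simp add: random_rank1_method_def generators_simps lattice_union_simps
        lattice_gens_def[symmetric])
qed

lemma majority_decoder_locations [simp]: "locations (majority_decoder M L J bins vs) F = {}"
  by (simp add: majority_decoder_def case_prod_beta)

lemma majority_decoder_operations:
  assumes "length vs = L * M" "M > 0" "2 * M \<le> 2 ^ e"
  shows "operations (majority_decoder M L J bins vs) F \<le> L * (M * (24 * e + 31)) + length J * (3 * L)"
proof -
  define cs where "cs = result (lattice_ffts M L vs) F"
  have "(\<Sum>x\<leftarrow>zip J bins. operations (case x of (k, bs) \<Rightarrow>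
      (majority 0 0 (map (\<lambda>l. cs ! l ! (bs ! l)) [0..<L]) \<bind> (\<lambda>c. Return (k, c)))) F) \<le>
      (\<Sum>x\<leftarrow>zip J bins. 3 * L)"
  proof (rule sum_list_mono)
    fix x
    show "operations (case x of (k, bs) \<Rightarrow>
      (majority 0 0 (map (\<lambda>l. cs ! l ! (bs ! l)) [0..<L]) \<bind> (\<lambda>c. Return (k, c)))) F \<le> 3 * L"
      using majority_operations[of 0 0 "map (\<lambda>l. cs ! l ! (snd x ! l)) [0..<L]" F]
      by (simp add: case_prod_beta)
  qed
  also have "\<dots> \<le> length J * (3 * L)" by (simp add: sum_list_triv)
  finally show ?thesis
    using lattice_ffts_operations[OF assms, of F]
    by (simp add: majority_decoder_def cs_def)
qed

text \<open>Lattices without collision report the true coefficient of \<open>k\<close>, which is 0 for \<open>k\<close> outside \<open>K\<close>; being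
  more than half of the lattices, they win the vote.\<close>

lemma majority_decoder_result:
  assumes "finite K" "\<And>k. k \<in> K \<Longrightarrow> length k = n" "\<And>k. k \<in> set J \<Longrightarrow> length k = n" "M > 0"
    and maj: "\<And>k. k \<in> set J \<Longrightarrow> 2 * card {l. l < L \<and> collides M n gen K k \<sigma> l} < L"
    and zs: "zs = lattice_gens M L n (\<lambda>l j. \<sigma> (gen l j))"
    and vs: "vs = map (trig_poly K b) (lattice_points M zs)"
  shows "result (majority_decoder M L J (lattice_bins M zs J) vs) F = map (\<lambda>k. (k, if k \<in> K then b k else 0)) J"
proof -
  define cs where "cs = result (lattice_ffts M L vs) F"
  have coeff: "result (majority 0 0 (map (\<lambda>l. cs ! l ! (map (\<lambda>z. nat (dot k z mod int M)) zs ! l)) [0..<L])) F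
      = (if k \<in> K then b k else 0)" if k: "k \<in> set J" for k
  proof (rule majority_result)
    let ?xs = "map (\<lambda>l. cs ! l ! (map (\<lambda>z. nat (dot k z mod int M)) zs ! l)) [0..<L]"
    let ?v = "if k \<in> K then b k else 0"
    have good: "?xs ! l = ?v" if "l < L" "\<not> collides M n gen K k \<sigma> l" for l
    proof -
      have "?xs ! l = cs ! l ! nat (dot k (zs ! l) mod int M)"
        using that(1) by (simp add: zs)
      also have "\<dots> = (\<Sum>k'\<in>{k' \<in> K. nat (dot k' (zs ! l) mod int M) = nat (dot k (zs ! l) mod int M)}. b k')"
        unfolding cs_def
        by (rule lattice_ffts_result[where n = n])
          (use assms that in \<open>auto simp: lattice_points_def map_concat comp_def nat_less_iff\<close>)
      also have "\<dots> = ?v"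
        unfolding zs by (rule bin_coefficient) (use assms that k in auto)
      finally show ?thesis .
    qed
    have "card {l. l < L \<and> \<not> collides M n gen K k \<sigma> l} \<le> card {l. l < L \<and> ?xs ! l = ?v}"
      using good by (intro card_mono) auto
    also have "\<dots> = length (filter (\<lambda>y. y = ?v) ?xs)"
      unfolding length_filter_conv_card by (simp cong: conj_cong)
    finally have "card {l. l < L \<and> \<not> collides M n gen K k \<sigma> l} \<le> length (filter (\<lambda>y. y = ?v) ?xs)" .
    moreover have "card {l. l < L \<and> collides M n gen K k \<sigma> l} + card {l. l < L \<and> \<not> collides M n gen K k \<sigma> l} = L"
    proof -
      have "{..<L} = {l. l < L \<and> collides M n gen K k \<sigma> l} \<union> {l. l < L \<and> \<not> collides M n gen K k \<sigma> l}" by auto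
      then have "card {..<L} = card ({l. l < L \<and> collides M n gen K k \<sigma> l} \<union> {l. l < L \<and> \<not> collides M n gen K k \<sigma> l})"
        by (rule arg_cong)
      then show ?thesis by (subst (asm) card_Un_disjoint) auto
    qed
    ultimately show "length ?xs < 2 * length (filter (\<lambda>y. y = ?v) ?xs)"
      using maj[OF k] by simp
  qed
  have "result (majority_decoder M L J (lattice_bins M zs J) vs) F =
      map (\<lambda>(k, bs). (k, result (majority 0 0 (map (\<lambda>l. cs ! l ! (bs ! l)) [0..<L])) F)) (zip J (lattice_bins M zs J))"
    by (simp add: majority_decoder_def cs_def case_prod_unfold)
  also have "\<dots> = map (\<lambda>k. (k, if k \<in> K then b k else 0)) J"
    using coeff by (simp add: lattice_bins_def zip_map2 zip_same_conv_map)
  finally show ?thesis .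
qed


section \<open>Recovery from a good seed\<close>

text \<open>The coefficient at \<open>k\<close> of the univariate polynomial in component \<open>t\<close> that remains when the other
  components are fixed at the random shift of the first iteration.\<close>

definition comp_coeff :: "nat \<Rightarrow> freq set \<Rightarrow> (freq \<Rightarrow> complex) \<Rightarrow> seed \<Rightarrow> nat \<Rightarrow> int \<Rightarrow> complex" where
  "comp_coeff d I c \<omega> t k = (\<Sum>\<kappa>\<in>{\<kappa> \<in> I. \<kappa> ! t = k}.
     c \<kappa> * cis (2 * pi * (\<Sum>j\<in>{..<d} - {t}. of_int (\<kappa> ! j) * \<omega> (Shift1 t 0 j))))"

text \<open>The coefficient at \<open>k\<close> of the polynomial in the first \<open>n\<close> components that remains when the other
  components are fixed at the random shift.\<close>

definition prefix_coeff :: "nat \<Rightarrow> freq set \<Rightarrow> (freq \<Rightarrow> complex) \<Rightarrow> seed \<Rightarrow> nat \<Rightarrow> freq \<Rightarrow> complex" where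
  "prefix_coeff d I c \<omega> n k = (\<Sum>\<kappa>\<in>{\<kappa> \<in> I. take n \<kappa> = k}.
     c \<kappa> * cis (2 * pi * (\<Sum>j\<in>{n..<d}. of_int (\<kappa> ! j) * \<omega> (Shift2 n 0 j))))"

text \<open>The outcome of the detection in component \<open>t\<close>.  With a positive threshold these are the components
  of the true frequencies.  The test \<open>\<ge> \<theta>\<close> with \<open>\<theta> = 0\<close> also lets vanishing coefficients pass, and each
  list is filled up to \<open>s\<close> entries with the smallest candidates that do not belong to the polynomial.\<close>

definition comp_set :: "real \<Rightarrow> nat \<Rightarrow> nat \<Rightarrow> freq set \<Rightarrow> (nat \<Rightarrow> freq set) \<Rightarrow> nat \<Rightarrow> int set" where
  "comp_set \<theta> s G \<Gamma> I t = (\<Union>g<G. proj t (I g) \<union> (if \<theta> = 0 then set (take (s - card (proj t (I g)))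
     (filter (\<lambda>k. k \<notin> proj t (I g)) (sorted_list_of_set (proj t \<Gamma>)))) else {}))"

text \<open>From length 2 on, the strict test \<open>> \<theta>\<close> removes vanishing coefficients even for \<open>\<theta> = 0\<close>; for length 1
  the set is the outcome of the first step.\<close>

definition prefix_set :: "real \<Rightarrow> nat \<Rightarrow> nat \<Rightarrow> freq set \<Rightarrow> (nat \<Rightarrow> freq set) \<Rightarrow> nat \<Rightarrow> freq set" where
  "prefix_set \<theta> s G \<Gamma> I n =
     (if n \<le> 1 then (\<lambda>k. [k]) ` comp_set \<theta> s G \<Gamma> I 0 else \<Union>g<G. proj_prefix n (I g))"

definition cand_set :: "real \<Rightarrow> nat \<Rightarrow> nat \<Rightarrow> freq set \<Rightarrow> (nat \<Rightarrow> freq set) \<Rightarrow> nat \<Rightarrow> freq set" where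
  "cand_set \<theta> s G \<Gamma> I n = (\<lambda>(k, l). k @ [l]) `
     (prefix_set \<theta> s G \<Gamma> I (n - 1) \<times> comp_set \<theta> s G \<Gamma> I (n - 1)) \<inter> proj_prefix n \<Gamma>"

text \<open>The projected coefficients of all true frequencies pass the threshold, and collisions are in the
  minority for every candidate of a majority vote as well as for every frequency of the last step.
  The minority forces the correct vote, and it leaves a lattice without collision for the last step.\<close>

definition good_seed where
  "good_seed d s G \<Gamma> I c \<theta> M L M' L' \<omega> \<longleftrightarrow>
     (\<forall>t<d. \<forall>g<G. \<forall>k\<in>proj t (I g). cmod (comp_coeff d (I g) (c g) \<omega> t k) > \<theta>) \<and>
     (\<forall>n\<in>{2..d}. \<forall>g<G. \<forall>k\<in>proj_prefix n (I g). cmod (prefix_coeff d (I g) (c g) \<omega> n k) > \<theta>) \<and>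
     (\<forall>n\<in>{2..d}. \<forall>g<G. \<forall>k\<in>cand_set \<theta> s G \<Gamma> I n.
        2 * card {l. l < L \<and> collides M n (GenA n) (proj_prefix n (I g)) k \<omega> l} < L) \<and>
     (\<forall>k\<in>prefix_set \<theta> s G \<Gamma> I d.
        2 * card {l. l < L' \<and> collides M' d GenY (prefix_set \<theta> s G \<Gamma> I d) k \<omega> l} < L')"

lemma candidate_list_filter:
  "[k @ [l]. k \<leftarrow> I, l \<leftarrow> I1, P (k @ [l])] = filter P (map (\<lambda>(k, l). k @ [l]) (List.product I I1))"
proof (induction I)
  case (Cons k I)
  have "[k @ [l]. l \<leftarrow> I1, P (k @ [l])] = filter P (map (\<lambda>l. k @ [l]) I1)"
    by (induction I1) auto
  with Cons show ?case by (simp add: comp_def)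
qed simp

lemma black_box_nth [simp]: "g < G \<Longrightarrow> black_box G I c y ! g = trig_poly (I g) (c g) y"
  by (simp add: black_box_def)

lemma foldP_simps:
  "result (foldP f (xs @ [x]) b) F = result (f x (result (foldP f xs b) F)) F"
  "operations (foldP f (xs @ [x]) b) F = operations (foldP f xs b) F + operations (f x (result (foldP f xs b) F)) F"
  "locations (foldP f (xs @ [x]) b) F = locations (foldP f xs b) F \<union> locations (f x (result (foldP f xs b) F)) F"
  by (induction xs arbitrary: b) auto

text \<open>Frequencies with the same prefix collapse into one coefficient.\<close>

lemma trig_poly_append:
  assumes "finite I" "\<And>k. k \<in> I \<Longrightarrow> length k = d" "length y = n" "n \<le> d"
  shows "trig_poly I c (y @ map (\<lambda>j. \<omega> (Shift2 n 0 j)) [n..<d]) =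
    trig_poly (proj_prefix n I) (prefix_coeff d I c \<omega> n) y"
proof -
  let ?r = "\<lambda>\<kappa>. cis (2 * pi * (\<Sum>j\<in>{n..<d}. of_int (\<kappa> ! j) * \<omega> (Shift2 n 0 j)))"
  let ?e = "\<lambda>k. cis (2 * pi * (\<Sum>j<length k. of_int (k ! j) * y ! j))"
  have "trig_poly I c (y @ map (\<lambda>j. \<omega> (Shift2 n 0 j)) [n..<d]) = (\<Sum>\<kappa>\<in>I. c \<kappa> * ?r \<kappa> * ?e (take n \<kappa>))"
    unfolding trig_poly_cis
  proof (rule sum.cong[OF refl])
    fix \<kappa> assume "\<kappa> \<in> I"
    then have len: "length \<kappa> = d" using assms by blast
    let ?y = "y @ map (\<lambda>j. \<omega> (Shift2 n 0 j)) [n..<d]"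
    have "{..<d} = {..<n} \<union> {n..<d}" using \<open>n \<le> d\<close> by auto
    then have "(\<Sum>j<d. of_int (\<kappa> ! j) * ?y ! j) = (\<Sum>j<n. of_int (\<kappa> ! j) * ?y ! j) + (\<Sum>j\<in>{n..<d}. of_int (\<kappa> ! j) * ?y ! j)"
      by (metis (no_types, lifting) finite_lessThan finite_atLeastLessThan ivl_disj_int_one(2) sum.union_disjoint)
    also have "(\<Sum>j<n. of_int (\<kappa> ! j) * ?y ! j) = (\<Sum>j<length (take n \<kappa>). of_int (take n \<kappa> ! j) * y ! j)"
      using assms len by (intro sum.cong) (auto simp: nth_append)
    also have "(\<Sum>j\<in>{n..<d}. of_int (\<kappa> ! j) * ?y ! j) = (\<Sum>j\<in>{n..<d}. of_int (\<kappa> ! j) * \<omega> (Shift2 n 0 j))"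
      using assms by (intro sum.cong) (auto simp: nth_append)
    finally show "c \<kappa> * cis (2 * pi * (\<Sum>j<length \<kappa>. of_int (\<kappa> ! j) * ?y ! j)) = c \<kappa> * ?r \<kappa> * ?e (take n \<kappa>)"
      unfolding len by (simp add: distrib_left mult.assoc mult.commute[of "?r \<kappa>"] flip: cis_mult)
  qed
  also have "\<dots> = (\<Sum>k\<in>proj_prefix n I. \<Sum>\<kappa>\<in>{\<kappa> \<in> I. take n \<kappa> = k}. c \<kappa> * ?r \<kappa> * ?e (take n \<kappa>))"
    using assms(1) by (intro sum.group[symmetric]) (auto simp: proj_prefix_def)
  also have "\<dots> = trig_poly (proj_prefix n I) (prefix_coeff d I c \<omega> n) y"
    unfolding trig_poly_cis prefix_coeff_def sum_distrib_right
    by (intro sum.cong refl) auto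
  finally show ?thesis .
qed

lemma trig_poly_line:
  assumes "\<And>k. k \<in> I \<Longrightarrow> length k = d" "t < d"
  shows "trig_poly I c ((map (\<lambda>j. \<omega> (Shift1 t 0 j)) [0..<d])[t := x]) =
    (\<Sum>\<kappa>\<in>I. c \<kappa> * cis (2 * pi * (\<Sum>j\<in>{..<d} - {t}. of_int (\<kappa> ! j) * \<omega> (Shift1 t 0 j))) *
      cis (2 * pi * (of_int (\<kappa> ! t) * x)))"
  unfolding trig_poly_cis
proof (rule sum.cong[OF refl])
  fix \<kappa> assume "\<kappa> \<in> I"
  then have len: "length \<kappa> = d" using assms by blast
  let ?y = "(map (\<lambda>j. \<omega> (Shift1 t 0 j)) [0..<d])[t := x]"
  have "(\<Sum>j<d. of_int (\<kappa> ! j) * ?y ! j) = of_int (\<kappa> ! t) * ?y ! t + (\<Sum>j\<in>{..<d} - {t}. of_int (\<kappa> ! j) * ?y ! j)"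
    using \<open>t < d\<close> by (subst sum.remove[of _ t]) auto
  also have "?y ! t = x" using \<open>t < d\<close> by simp
  also have "(\<Sum>j\<in>{..<d} - {t}. of_int (\<kappa> ! j) * ?y ! j) = (\<Sum>j\<in>{..<d} - {t}. of_int (\<kappa> ! j) * \<omega> (Shift1 t 0 j))"
    by (intro sum.cong) auto
  finally show "c \<kappa> * cis (2 * pi * (\<Sum>j<length \<kappa>. of_int (\<kappa> ! j) * ?y ! j)) =
     c \<kappa> * cis (2 * pi * (\<Sum>j\<in>{..<d} - {t}. of_int (\<kappa> ! j) * \<omega> (Shift1 t 0 j))) *
      cis (2 * pi * (of_int (\<kappa> ! t) * x))"
    unfolding len by (simp add: distrib_left mult.assoc mult.commute flip: cis_mult)
qed

lemma sparse_family_props: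
  assumes fin: "finite \<Gamma>" and len: "\<forall>k\<in>\<Gamma>. length k = d"
    and fam: "sparse_family s G \<Gamma> I c" and "g < G"
  shows "I g \<subseteq> \<Gamma>" "card (I g) \<le> s" "k \<in> I g \<Longrightarrow> c g k \<noteq> 0" "finite (I g)" "k \<in> I g \<Longrightarrow> length k = d"
    "card (proj t (I g)) \<le> s" "card (proj_prefix n (I g)) \<le> s" "finite (proj t (I g))" "finite (proj_prefix n (I g))"
proof -
  show sub: "I g \<subseteq> \<Gamma>" and card: "card (I g) \<le> s" and "k \<in> I g \<Longrightarrow> c g k \<noteq> 0"
    using fam assms by (auto simp: sparse_family_def)
  show fin: "finite (I g)" using sub fin finite_subset by blast
  show "k \<in> I g \<Longrightarrow> length k = d" using sub len by blast
  show "finite (proj t (I g))" "finite (proj_prefix n (I g))"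
    using fin by (auto simp: proj_def proj_prefix_def)
  show "card (proj t (I g)) \<le> s" "card (proj_prefix n (I g)) \<le> s"
    unfolding proj_def proj_prefix_def using card_image_le[OF fin] card le_trans by blast+
qed

locale good_run =
  fixes d s G :: nat and \<Gamma> :: "freq set" and I :: "nat \<Rightarrow> freq set" and c :: "nat \<Rightarrow> freq \<Rightarrow> complex"
    and \<theta> :: real and M L M' L' :: nat and \<omega> :: seed
  assumes d: "d \<ge> 1" and fin: "finite \<Gamma>" and len: "\<And>k. k \<in> \<Gamma> \<Longrightarrow> length k = d"
    and fam: "sparse_family s G \<Gamma> I c" and \<theta>: "\<theta> \<ge> 0" and M: "M \<ge> 1" "M' \<ge> 1"
    and good: "good_seed d s G \<Gamma> I c \<theta> M L M' L' \<omega>"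
begin

abbreviation "F \<equiv> black_box G I c"
abbreviation "T \<equiv> comp_set \<theta> s G \<Gamma> I"
abbreviation "P \<equiv> prefix_set \<theta> s G \<Gamma> I"
abbreviation "cand \<equiv> cand_set \<theta> s G \<Gamma> I"

lemma len_all: "\<forall>k\<in>\<Gamma>. length k = d"
  using len by blast

lemmas fam_props = sparse_family_props[OF fin len_all fam]

text \<open>The \<open>K\<close> consecutive values from \<open>Min\<close> to \<open>Max\<close> of the \<open>t\<close>-th components are distinct modulo \<open>K\<close>, so no
  aliasing occurs.\<close>

lemma comp_coeff_dft:
  assumes g: "g < G" and t: "t < d" and k: "k \<in> proj t \<Gamma>"
    and K: "K = nat (Max (proj t \<Gamma>) - Min (proj t \<Gamma>) + 1)"
  shows "result (fft (map (\<lambda>l. trig_poly (I g) (c g) ((map (\<lambda>j. \<omega> (Shift1 t 0 j)) [0..<d])[t := real l / real K])) [0..<K])) F'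
    ! nat (k mod int K) / of_nat K = comp_coeff d (I g) (c g) \<omega> t k"
proof -
  have fp: "finite (proj t \<Gamma>)" using fin by (simp add: proj_def)
  have range: "Min (proj t \<Gamma>) \<le> x" "x \<le> Max (proj t \<Gamma>)" if "x \<in> proj t \<Gamma>" for x
    using that fp by auto
  have K0: "K > 0" and Kint: "int K = Max (proj t \<Gamma>) - Min (proj t \<Gamma>) + 1"
    using range[OF k] by (auto simp: K)
  let ?b = "\<lambda>\<kappa>. c g \<kappa> * cis (2 * pi * (\<Sum>j\<in>{..<d} - {t}. of_int (\<kappa> ! j) * \<omega> (Shift1 t 0 j)))"
  have "map (\<lambda>l. trig_poly (I g) (c g) ((map (\<lambda>j. \<omega> (Shift1 t 0 j)) [0..<d])[t := real l / real K])) [0..<K] =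
    map (\<lambda>l. \<Sum>\<kappa>\<in>I g. ?b \<kappa> * cis (2 * pi * (real l * of_int (\<kappa> ! t) / real K))) [0..<K]"
    using fam_props[OF g] t by (simp add: trig_poly_line mult.commute)
  then have "result (fft (map (\<lambda>l. trig_poly (I g) (c g) ((map (\<lambda>j. \<omega> (Shift1 t 0 j)) [0..<d])[t := real l / real K])) [0..<K])) F'
    ! nat (k mod int K) / of_nat K = (\<Sum>\<kappa>\<in>{\<kappa> \<in> I g. \<kappa> ! t mod int K = int (nat (k mod int K))}. ?b \<kappa>)"
    using K0 fam_props(4)[OF g] by (simp only:) (rule dft_of_exponential_sum, auto simp: nat_less_iff)
  also have "{\<kappa> \<in> I g. \<kappa> ! t mod int K = int (nat (k mod int K))} = {\<kappa> \<in> I g. \<kappa> ! t = k}"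
  proof -
    have "\<kappa> ! t mod int K = k mod int K \<longleftrightarrow> \<kappa> ! t = k" if "\<kappa> \<in> I g" for \<kappa>
    proof
      assume "\<kappa> ! t mod int K = k mod int K"
      then have "int K dvd \<kappa> ! t - k" by (simp add: mod_eq_dvd_iff)
      moreover have "\<kappa> ! t \<in> proj t \<Gamma>" using that fam_props(1)[OF g] by (auto simp: proj_def)
      then have "\<bar>\<kappa> ! t - k\<bar> < int K" using range[OF k] range[of "\<kappa> ! t"] unfolding Kint by auto
      ultimately show "\<kappa> ! t = k" using dvd_imp_le_int[of "\<kappa> ! t - k" "int K"] by auto
    qed simp
    then show ?thesis using K0 by auto
  qed
  finally show ?thesis by (simp only: comp_coeff_def)
qed

lemma step1_result:
  assumes t: "t < d"
  shows "set (result (step1 d G \<Gamma> s \<theta> 1 \<omega> t) F) = T t" "distinct (result (step1 d G \<Gamma> s \<theta> 1 \<omega> t) F)"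
proof -
  define K where "K = nat (Max (proj t \<Gamma>) - Min (proj t \<Gamma>) + 1)"
  let ?ks = "sorted_list_of_set (proj t \<Gamma>)"
  have fp: "finite (proj t \<Gamma>)" using fin by (simp add: proj_def)
  let ?X = "\<lambda>g. result (fft (map (\<lambda>v. v ! g) (map (\<lambda>l. F ((map (\<lambda>j. \<omega> (Shift1 t 0 j)) [0..<d])[t := real l / real K])) [0..<K]))) F"
  let ?cs = "\<lambda>g. map (\<lambda>k. (k, ?X g ! nat (k mod int K) / of_nat K)) ?ks"
  have cs: "?cs g = map (\<lambda>k. (k, comp_coeff d (I g) (c g) \<omega> t k)) ?ks" if "g < G" for g
  proof (rule map_cong[OF refl])
    fix k assume "k \<in> set ?ks"
    then have "k \<in> proj t \<Gamma>" using fp by simp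
    from comp_coeff_dft[OF that t this K_def] that
    show "(k, ?X g ! nat (k mod int K) / of_nat K) = (k, comp_coeff d (I g) (c g) \<omega> t k)"
      by (simp add: comp_def)
  qed
  have sel: "set (result (select_largest s (\<lambda>a. a \<ge> \<theta>) (?cs g)) F) = proj t (I g) \<union> (if \<theta> = 0 then set (take (s - card (proj t (I g)))
     (filter (\<lambda>k. k \<notin> proj t (I g)) ?ks)) else {})" if g: "g < G" for g
  proof -
    have nz: "comp_coeff d (I g) (c g) \<omega> t k \<noteq> 0 \<longleftrightarrow> k \<in> proj t (I g)"
      and gap: "k \<in> proj t (I g) \<Longrightarrow> cmod (comp_coeff d (I g) (c g) \<omega> t k) > \<theta>" for k
    proof -
      show gap: "cmod (comp_coeff d (I g) (c g) \<omega> t k) > \<theta>" if "k \<in> proj t (I g)"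
        using good g t that unfolding good_seed_def by blast
      have "comp_coeff d (I g) (c g) \<omega> t k = 0" if "k \<notin> proj t (I g)"
      proof -
        have none: "{\<kappa> \<in> I g. \<kappa> ! t = k} = {}" using that by (auto simp: proj_def)
        show ?thesis unfolding comp_coeff_def none by (rule sum.empty)
      qed
      with gap \<theta> show "comp_coeff d (I g) (c g) \<omega> t k \<noteq> 0 \<longleftrightarrow> k \<in> proj t (I g)" by force
    qed
    have sub: "proj t (I g) \<subseteq> proj t \<Gamma>" using fam_props(1)[OF g] by (auto simp: proj_def)
    have f1: "filter (\<lambda>x. snd x \<noteq> 0) (?cs g) = map (\<lambda>k. (k, comp_coeff d (I g) (c g) \<omega> t k)) (filter (\<lambda>k. k \<in> proj t (I g)) ?ks)"
      unfolding cs[OF g] by (simp add: filter_map comp_def nz)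
    have f2: "map fst (filter (\<lambda>x. snd x = 0) (?cs g)) = filter (\<lambda>k. k \<notin> proj t (I g)) ?ks"
      unfolding cs[OF g] by (simp add: filter_map comp_def flip: nz)
    have fs: "set (filter (\<lambda>k. k \<in> proj t (I g)) ?ks) = proj t (I g)" using sub fp by auto
    have l: "length (filter (\<lambda>k. k \<in> proj t (I g)) ?ks) = card (proj t (I g))"
      using distinct_card[of "filter (\<lambda>k. k \<in> proj t (I g)) ?ks", unfolded fs] by simp
    have "set (result (select_largest s (\<lambda>a. a \<ge> \<theta>) (?cs g)) F) = fst ` set (filter (\<lambda>x. snd x \<noteq> 0) (?cs g)) \<union>
      (if \<theta> = 0 then set (take (s - length (filter (\<lambda>x. snd x \<noteq> 0) (?cs g)))
       (map fst (filter (\<lambda>x. snd x = 0) (?cs g)))) else {})"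
    proof (rule select_largest_weak[OF \<theta>])
      show "length (filter (\<lambda>x. snd x \<noteq> 0) (?cs g)) \<le> s"
        unfolding f1 using l fam_props(6)[OF g] by simp
      fix k x assume "(k, x) \<in> set (?cs g)" "x \<noteq> 0"
      then show "cmod x > \<theta>" unfolding cs[OF g] using gap nz by auto
    qed
    then show ?thesis
      unfolding f1 f2 length_map l set_map image_image fst_conv image_ident fs .
  qed
  have res: "result (step1 d G \<Gamma> s \<theta> 1 \<omega> t) F = remdups (concat (map (\<lambda>g. result (select_largest s (\<lambda>a. a \<ge> \<theta>) (?cs g)) F) [0..<G]))"
    unfolding step1_def K_def[symmetric] by (simp add: Let_def)
  have "set (result (step1 d G \<Gamma> s \<theta> 1 \<omega> t) F) = (\<Union>g<G. set (result (select_largest s (\<lambda>a. a \<ge> \<theta>) (?cs g)) F))"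
    unfolding res by (simp add: lessThan_atLeast0)
  also have "\<dots> = T t"
    unfolding comp_set_def using sel by (intro SUP_cong) auto
  finally show "set (result (step1 d G \<Gamma> s \<theta> 1 \<omega> t) F) = T t" .
  show "distinct (result (step1 d G \<Gamma> s \<theta> 1 \<omega> t) F)" unfolding res by simp
qed

lemma comp_set_contains: "g < G \<Longrightarrow> k \<in> I g \<Longrightarrow> k ! t \<in> T t"
  by (auto simp: comp_set_def proj_def)

lemma prefix_set_contains:
  assumes "g < G" "k \<in> I g" "n \<ge> 1"
  shows "take n k \<in> P n"
proof (cases "n = 1")
  case True
  have "length k = d" using fam_props[OF assms(1)] assms(2) by blast
  then have "take 1 k = [k ! 0]" using d by (cases k) auto
  then show ?thesis using True comp_set_contains[OF assms(1,2)] by (auto simp: prefix_set_def)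
next
  case False
  then show ?thesis using assms by (auto simp: prefix_set_def proj_prefix_def)
qed

lemma cand_set_contains:
  assumes "g < G" "n \<in> {2..d}"
  shows "proj_prefix n (I g) \<subseteq> cand n"
proof
  fix k assume "k \<in> proj_prefix n (I g)"
  then obtain \<kappa> where \<kappa>: "\<kappa> \<in> I g" "k = take n \<kappa>" by (auto simp: proj_prefix_def)
  have l: "length \<kappa> = d" "\<kappa> \<in> \<Gamma>" using fam_props[OF assms(1)] \<kappa> by blast+
  have "k = take (n - 1) \<kappa> @ [\<kappa> ! (n - 1)]"
  proof -
    have "Suc (n - 1) = n" "n - 1 < length \<kappa>" using assms(2) l by auto
    then show ?thesis using take_Suc_conv_app_nth[of "n - 1" \<kappa>] \<kappa>(2) by (simp only:)
  qed
  moreover have "take (n - 1) \<kappa> \<in> P (n - 1)"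
    using assms \<kappa> by (intro prefix_set_contains) auto
  moreover have "\<kappa> ! (n - 1) \<in> T (n - 1)" by (rule comp_set_contains[OF assms(1) \<kappa>(1)])
  moreover have "k \<in> proj_prefix n \<Gamma>" using l \<kappa> by (auto simp: proj_prefix_def)
  ultimately show "k \<in> cand n" by (auto simp: cand_set_def)
qed

text \<open>Every decoded value is exact: the projected coefficient for prefixes of the true frequencies and 0 for
  all other candidates.  There are at most \<open>s\<close> nonzero values, all of them above the threshold, so
  the selection returns exactly the prefixes of the true frequencies.\<close>

lemma step2_result:
  assumes n: "n \<in> {2..d}" and I': "set I' = P (n - 1)" "distinct I'" and I1: "set I1 = T (n - 1)" "distinct I1"
  shows "set (result (step2 d G \<Gamma> s s \<theta> 1 (random_rank1_method M L) \<omega> n I1 I') F) = P n"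
    "distinct (result (step2 d G \<Gamma> s s \<theta> 1 (random_rank1_method M L) \<omega> n I1 I') F)"
proof -
  define J where "J = [k @ [l]. k \<leftarrow> I', l \<leftarrow> I1, k @ [l] \<in> proj_prefix n \<Gamma>]"
  have J: "J = filter (\<lambda>k. k \<in> proj_prefix n \<Gamma>) (map (\<lambda>(k, l). k @ [l]) (List.product I' I1))"
    unfolding J_def by (rule candidate_list_filter)
  have Jset: "set J = cand n" unfolding J cand_set_def using I' I1 by auto
  have Jdist: "distinct J"
    unfolding J using I'(2) I1(2)
    by (intro distinct_filter) (auto simp: distinct_map distinct_product inj_on_def)
  have Jlen: "length k = n" if "k \<in> set J" for k
  proof -
    have "k \<in> proj_prefix n \<Gamma>" using that unfolding J by auto
    then show ?thesis using n len by (auto simp: proj_prefix_def)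
  qed
  define zs where "zs = lattice_gens M L n (\<lambda>l j. \<omega> (GenA n l j))"
  let ?vals = "map (\<lambda>y. F (y @ map (\<lambda>j. \<omega> (Shift2 n 0 j)) [n..<d])) (lattice_points M zs)"
  let ?dec = "\<lambda>g. result (majority_decoder M L J (lattice_bins M zs J) (map (\<lambda>v. v ! g) ?vals)) F"
  have dec: "?dec g = map (\<lambda>k. (k, if k \<in> proj_prefix n (I g) then prefix_coeff d (I g) (c g) \<omega> n k else 0)) J"
    if g: "g < G" for g
  proof (rule majority_decoder_result[where gen = "GenA n" and \<sigma> = \<omega> and n = n])
    show "finite (proj_prefix n (I g))" by (rule fam_props(9)[OF g])
    show "length k = n" if "k \<in> proj_prefix n (I g)" for k
      using that fam_props(5)[OF g] n by (auto simp: proj_prefix_def)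
    show "2 * card {l. l < L \<and> collides M n (GenA n) (proj_prefix n (I g)) k \<omega> l} < L" if "k \<in> set J" for k
      using good g n that unfolding good_seed_def Jset by blast
    have "trig_poly (I g) (c g) (y @ map (\<lambda>j. \<omega> (Shift2 n 0 j)) [n..<d]) =
        trig_poly (proj_prefix n (I g)) (prefix_coeff d (I g) (c g) \<omega> n) y" if "y \<in> set (lattice_points M zs)" for y
    proof (rule trig_poly_append)
      have "set (lattice_points M zs) \<subseteq> torus n"
        by (rule lattice_points_torus) (simp add: zs_def)
      then show "length y = n" using that by (auto simp: torus_def)
    qed (use fam_props[OF g] n in auto)
    then show "map (\<lambda>v. v ! g) ?vals = map (trig_poly (proj_prefix n (I g)) (prefix_coeff d (I g) (c g) \<omega> n)) (lattice_points M zs)"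
      using g by simp
  qed (use M Jlen in \<open>auto simp: zs_def\<close>)
  have sel: "set (result (select_largest s (\<lambda>a. a > \<theta>) (?dec g)) F) = proj_prefix n (I g)" if g: "g < G" for g
  proof -
    have gap: "cmod (prefix_coeff d (I g) (c g) \<omega> n k) > \<theta>" if "k \<in> proj_prefix n (I g)" for k
      using good g n that unfolding good_seed_def by blast
    then have nz: "prefix_coeff d (I g) (c g) \<omega> n k \<noteq> 0" if "k \<in> proj_prefix n (I g)" for k
      using \<theta> that by force
    have f: "filter (\<lambda>x. snd x \<noteq> 0) (?dec g) = map (\<lambda>k. (k, if k \<in> proj_prefix n (I g) then prefix_coeff d (I g) (c g) \<omega> n k else 0))
        (filter (\<lambda>k. k \<in> proj_prefix n (I g)) J)"
      unfolding dec[OF g] filter_map comp_def using nz by (intro arg_cong[of _ _ "map _"] filter_cong) auto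
    have fs: "set (filter (\<lambda>k. k \<in> proj_prefix n (I g)) J) = proj_prefix n (I g)"
      using cand_set_contains[OF g n] Jset by auto
    have l: "length (filter (\<lambda>k. k \<in> proj_prefix n (I g)) J) = card (proj_prefix n (I g))"
      using distinct_card[OF distinct_filter[OF Jdist], of "\<lambda>k. k \<in> proj_prefix n (I g)", unfolded fs] by simp
    have "set (result (select_largest s (\<lambda>a. a > \<theta>) (?dec g)) F) = fst ` set (filter (\<lambda>x. snd x \<noteq> 0) (?dec g))"
    proof (rule select_largest_strict[OF \<theta>])
      show "length (filter (\<lambda>x. snd x \<noteq> 0) (?dec g)) \<le> s"
        unfolding f length_map l by (rule fam_props(7)[OF g])
      fix k x assume "(k, x) \<in> set (?dec g)" "x \<noteq> 0"
      then show "cmod x > \<theta>" unfolding dec[OF g] using gap by (auto split: if_splits)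
    qed
    also have "\<dots> = set (filter (\<lambda>k. k \<in> proj_prefix n (I g)) J)"
      unfolding f by (simp only: set_map image_image fst_conv image_ident)
    finally show ?thesis unfolding fs .
  qed
  have res: "result (step2 d G \<Gamma> s s \<theta> 1 (random_rank1_method M L) \<omega> n I1 I') F =
      remdups (concat (map (\<lambda>g. result (select_largest s (\<lambda>a. a > \<theta>) (?dec g)) F) [0..<G]))"
    unfolding step2_def J_def[symmetric]
    by (simp add: Let_def random_rank1_method_result[OF Jlen] zs_def)
  have "set (result (step2 d G \<Gamma> s s \<theta> 1 (random_rank1_method M L) \<omega> n I1 I') F) =
      (\<Union>g<G. set (result (select_largest s (\<lambda>a. a > \<theta>) (?dec g)) F))"
    unfolding res by (simp add: lessThan_atLeast0)
  also have "\<dots> = (\<Union>g<G. proj_prefix n (I g))" using sel by (intro SUP_cong) auto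
  also have "\<dots> = P n" using n by (simp add: prefix_set_def)
  finally show "set (result (step2 d G \<Gamma> s s \<theta> 1 (random_rank1_method M L) \<omega> n I1 I') F) = P n" .
  show "distinct (result (step2 d G \<Gamma> s s \<theta> 1 (random_rank1_method M L) \<omega> n I1 I') F)"
    unfolding res by simp
qed

lemma prefix_set_length: "k \<in> P d \<Longrightarrow> length k = d"
  using fam_props(5) d by (auto simp: prefix_set_def proj_prefix_def split: if_splits)

lemma frequencies_in_prefix_set: "g < G \<Longrightarrow> I g \<subseteq> P d"
proof
  fix k assume "g < G" "k \<in> I g"
  then show "k \<in> P d" using prefix_set_contains[of g k d] fam_props(5)[of g k] d by simp
qed

text \<open>A lattice in which no frequency of the detected set shares the bin of \<open>k\<close> is in particular free of
  collisions with the frequencies of each single polynomial.\<close>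

lemma step3_recovers:
  assumes J: "set J = P d" "distinct J"
  shows "recovers G I c (result (step3 d G M' L' \<omega> J) F)"
proof -
  define zs where "zs = lattice_gens M' L' d (\<lambda>l j. \<omega> (GenY l j))"
  define bins where "bins = lattice_bins M' zs J"
  define sel where "sel = map (\<lambda>a. find (alias_free bins a) [0..<L']) [0..<length J]"
  define vals where "vals = map F (lattice_points M' zs)"
  define cs where "cs g = result (lattice_ffts M' L' (map (\<lambda>v. v ! g) vals)) F" for g
  define cfs where "cfs = map (\<lambda>g. map (\<lambda>a. case sel ! a of None \<Rightarrow> 0 | Some l \<Rightarrow> cs g ! l ! (bins ! a ! l))
                 [0..<length J]) [0..<G]"
  have Jlen: "length k = d" if "k \<in> set J" for k using that J prefix_set_length by auto
  have bins_eq: "map (\<lambda>k. map (\<lambda>z. result (bin M' k z) F) (lattice_gens M' L' d (\<lambda>l j. \<omega> (GenY l j)))) J = bins"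
    unfolding bins_def lattice_bins_def zs_def by (intro map_cong refl) (use Jlen in auto)
  have res: "result (step3 d G M' L' \<omega> J) F = (J, cfs)"
    unfolding step3_def
    by (simp only: result_bind mapP_simps generators_simps lattice_gens_def[symmetric] lattice_union_simps
        charged_simps sample_simps bins_eq result.simps)
      (simp only: cfs_def sel_def cs_def vals_def zs_def lattice_points_def)
  have bins_nth: "bins ! a ! l = nat (dot (J ! a) (zs ! l) mod int M')" if "a < length J" "l < L'" for a l
    using that by (simp add: bins_def lattice_bins_def zs_def)
  have alias_iff: "alias_free bins a l \<longleftrightarrow> \<not> collides M' d GenY (P d) (J ! a) \<omega> l" if a: "a < length J" and l: "l < L'" for a l
  proof -
    have "bins ! b ! l = bins ! a ! l \<longleftrightarrow> int M' dvd (\<Sum>j<d. (J ! b ! j - J ! a ! j) * \<lfloor>real M' * \<omega> (GenY l j)\<rfloor>)"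
      if "b < length J" for b
      using that a l Jlen M(2) unfolding bins_nth[OF a l] bins_nth[OF that l] zs_def
      by (intro bins_collide_iff) auto
    moreover have "P d - {J ! a} = (\<lambda>b. J ! b) ` {b. b < length J \<and> b \<noteq> a}"
      using J a by (auto simp: set_conv_nth nth_eq_iff_index_eq)
    moreover have "length bins = length J" by (simp add: bins_def lattice_bins_def)
    ultimately show ?thesis unfolding alias_free_def collides_def by auto
  qed
  have coeff: "cfs ! g ! a = (if J ! a \<in> I g then c g (J ! a) else 0)" if g: "g < G" and a: "a < length J" for g a
  proof -
    have "J ! a \<in> P d" using nth_mem[OF a] J(1) by simp
    then have "2 * card {l. l < L' \<and> collides M' d GenY (P d) (J ! a) \<omega> l} < L'"
      using good unfolding good_seed_def by blast
    \<comment> \<open>Fewer than half of the lattices collide, hence not all of them do.\<close>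
    then have few: "card {l. l < L' \<and> collides M' d GenY (P d) (J ! a) \<omega> l} < card {..<L'}"
      unfolding card_lessThan by linarith
    have "\<exists>l<L'. \<not> collides M' d GenY (P d) (J ! a) \<omega> l"
    proof (rule ccontr)
      assume "\<not> ?thesis"
      then have "{l. l < L' \<and> collides M' d GenY (P d) (J ! a) \<omega> l} = {..<L'}" by blast
      with few show False by (simp only: less_irrefl)
    qed
    then obtain l0 where "l0 < L'" "alias_free bins a l0" using alias_iff[OF a] by auto
    then obtain l where l: "find (alias_free bins a) [0..<L'] = Some l"
      by (cases "find (alias_free bins a) [0..<L']") (auto simp: find_None_iff)
    then have l': "l < L'" "alias_free bins a l" by (auto simp: find_Some_iff)
    \<comment> \<open>The frequencies of polynomial g belong to the detected set.\<close>
    have nc: "\<not> collides M' d GenY (I g) (J ! a) \<omega> l"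
      using l' alias_iff[OF a l'(1)] frequencies_in_prefix_set[OF g] unfolding collides_def by auto
    have "cfs ! g ! a = cs g ! l ! nat (dot (J ! a) (zs ! l) mod int M')"
      using g a l l' by (simp add: cfs_def sel_def bins_nth)
    also have "\<dots> = (\<Sum>k\<in>{k \<in> I g. nat (dot k (zs ! l) mod int M') = nat (dot (J ! a) (zs ! l) mod int M')}. c g k)"
      unfolding cs_def
    proof (rule lattice_ffts_result[where n = d])
      show "map (\<lambda>v. v ! g) vals = concat (map (\<lambda>z. map (trig_poly (I g) (c g)) (rank1_lattice z M')) zs)"
        using g by (simp add: vals_def lattice_points_def map_concat comp_def)
    qed (use fam_props[OF g] M l' in \<open>auto simp: zs_def nat_less_iff\<close>)
    also have "\<dots> = (if J ! a \<in> I g then c g (J ! a) else 0)"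
      unfolding zs_def by (rule bin_coefficient) (use fam_props[OF g] M l' nc a Jlen in auto)
    finally show ?thesis .
  qed
  have "recovers G I c (J, cfs)"
    unfolding recovers_def prod.case
  proof (intro conjI allI impI J(2))
    fix g assume g: "g < G"
    show "I g = {J ! a |a. a < length J \<and> cfs ! g ! a \<noteq> 0}"
    proof (intro equalityI subsetI)
      fix k assume k: "k \<in> I g"
      then have "k \<in> set J" using frequencies_in_prefix_set[OF g] J by auto
      then obtain a where "a < length J" "J ! a = k" by (auto simp: in_set_conv_nth)
      then show "k \<in> {J ! a |a. a < length J \<and> cfs ! g ! a \<noteq> 0}"
        using coeff[OF g] k fam_props(3)[OF g k] by auto
    next
      fix k assume "k \<in> {J ! a |a. a < length J \<and> cfs ! g ! a \<noteq> 0}"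
      then show "k \<in> I g" using coeff[OF g] by (auto split: if_splits)
    qed
    fix a assume "a < length J" "J ! a \<in> I g"
    then show "cfs ! g ! a = c g (J ! a)" using coeff[OF g] by simp
  qed
  then show ?thesis by (simp only: res)
qed

theorem run_recovers:
  "recovers G I c (result (uniform_sparse_fft d G \<Gamma> s s \<theta> 1 (random_rank1_method M L) M' L' \<omega>) F)"
proof -
  define Is where "Is = map (\<lambda>t. result (step1 d G \<Gamma> s \<theta> 1 \<omega> t) F) [0..<d]"
  let ?step = "\<lambda>n. step2 d G \<Gamma> s s \<theta> 1 (random_rank1_method M L) \<omega> n (Is ! (n - 1))"
  let ?st = "\<lambda>n. result (foldP ?step [2..<n + 1] (map (\<lambda>k. [k]) (Is ! 0))) F"
  have Is: "set (Is ! t) = T t" "distinct (Is ! t)" if "t < d" for t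
    using step1_result[OF that] that by (auto simp: Is_def)
  have "set (?st n) = P n \<and> distinct (?st n)" if "1 \<le> n" "n \<le> d" for n
    using that
  proof (induction n rule: dec_induct)
    case base
    have "[2..<1 + 1] = []" by simp
    then show ?case using Is[of 0] d
      by (simp only: foldP.simps result.simps) (auto simp: prefix_set_def distinct_map inj_on_def)
  next
    case (step n)
    have "[2..<Suc n + 1] = [2..<n + 1] @ [Suc n]" using step by simp
    then have "?st (Suc n) = result (?step (Suc n) (?st n)) F"
      by (simp only: foldP_simps)
    moreover have "Suc n \<in> {2..d}" using step by auto
    ultimately show ?case
      using step2_result[of "Suc n" "?st n" "Is ! n"] step Is[of n] by simp
  qed
  from this[of d] have "set (?st d) = P d" "distinct (?st d)" using d by auto
  from step3_recovers[OF this] show ?thesis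
    by (simp add: uniform_sparse_fft_def Is_def)
qed

end


section \<open>Good seeds are likely\<close>

lemma seed_space_eq: "seed_space = uniform_seeds"
  by (simp add: seed_space_def)

lemma with_prob_mono:
  "with_prob_at_least M p Q \<Longrightarrow> q \<le> p \<Longrightarrow> (\<And>x. x \<in> space M \<Longrightarrow> Q x \<Longrightarrow> R x) \<Longrightarrow> with_prob_at_least M q R"
  unfolding with_prob_at_least_def by (meson order_trans sets.sets_into_space subsetD)

lemma with_prob_complement:
  assumes "{x \<in> space uniform_seeds. B x} \<in> sets uniform_seeds" "measure uniform_seeds {x \<in> space uniform_seeds. B x} \<le> p"
  shows "with_prob_at_least uniform_seeds (1 - p) (\<lambda>x. \<not> B x)"
  unfolding with_prob_at_least_def
proof (intro bexI conjI ballI)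
  let ?E = "space uniform_seeds - {x \<in> space uniform_seeds. B x}"
  show "?E \<in> sets uniform_seeds" using assms(1) by auto
  show "1 - p \<le> measure uniform_seeds ?E"
    using assms(2) uniform_seeds.prob_compl[OF assms(1)] by simp
qed auto

lemma with_prob_conj:
  assumes "with_prob_at_least uniform_seeds (1 - p) Q" "with_prob_at_least uniform_seeds (1 - q) R"
  shows "with_prob_at_least uniform_seeds (1 - (p + q)) (\<lambda>x. Q x \<and> R x)"
proof -
  obtain A B where A: "A \<in> sets uniform_seeds" "measure uniform_seeds A \<ge> 1 - p" "\<forall>x\<in>A. Q x"
    and B: "B \<in> sets uniform_seeds" "measure uniform_seeds B \<ge> 1 - q" "\<forall>x\<in>B. R x"
    using assms unfolding with_prob_at_least_def by blast
  have "measure uniform_seeds (A \<union> B) \<le> 1" by (rule uniform_seeds.prob_le_1)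
  then have "measure uniform_seeds (A \<inter> B) \<ge> 1 - (p + q)"
    using uniform_seeds.finite_measure_Union'[OF A(1) B(1)] uniform_seeds.finite_measure_Diff'[OF B(1) A(1)] A B
    by (simp add: Int_commute)
  then show ?thesis
    unfolding with_prob_at_least_def using A B by (intro bexI[of _ "A \<inter> B"]) auto
qed

lemma with_prob_ball:
  assumes "finite A" "\<And>a. a \<in> A \<Longrightarrow> with_prob_at_least uniform_seeds (1 - p) (Q a)" "p \<ge> 0" "real (card A) \<le> n"
  shows "with_prob_at_least uniform_seeds (1 - n * p) (\<lambda>x. \<forall>a\<in>A. Q a x)"
proof -
  have "with_prob_at_least uniform_seeds (1 - real (card A) * p) (\<lambda>x. \<forall>a\<in>A. Q a x)"
    using assms(1,2)
  proof (induction A rule: finite_induct)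
    case empty
    show ?case unfolding with_prob_at_least_def
      by (intro bexI[of _ "space uniform_seeds"]) (simp_all add: uniform_seeds.prob_space)
  next
    case (insert a A)
    have "with_prob_at_least uniform_seeds (1 - (p + real (card A) * p)) (\<lambda>x. Q a x \<and> (\<forall>a\<in>A. Q a x))"
      using insert by (intro with_prob_conj) auto
    then show ?case using insert.hyps by (simp add: algebra_simps)
  qed
  moreover have "real (card A) * p \<le> n * p" using assms by (intro mult_right_mono) auto
  ultimately show ?thesis by (elim with_prob_mono) auto
qed

text \<open>This is where the width of \<open>\<Gamma>\<close> enters the lattice size.\<close>

lemma component_diff_le_width:
  assumes "finite \<Gamma>" "k \<in> \<Gamma>" "k' \<in> \<Gamma>" "t < d"
  shows "\<bar>k ! t - k' ! t\<bar> \<le> width d \<Gamma>"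
proof -
  have f: "finite (proj t \<Gamma>)" using assms by (simp add: proj_def)
  have "k ! t \<in> proj t \<Gamma>" "k' ! t \<in> proj t \<Gamma>" using assms by (auto simp: proj_def)
  then have "Min (proj t \<Gamma>) \<le> k ! t" "k ! t \<le> Max (proj t \<Gamma>)" "Min (proj t \<Gamma>) \<le> k' ! t" "k' ! t \<le> Max (proj t \<Gamma>)"
    using f by auto
  moreover have "Max (proj t \<Gamma>) - Min (proj t \<Gamma>) \<le> width d \<Gamma>"
    unfolding width_def using assms by (intro Max_ge) auto
  ultimately show ?thesis by linarith
qed

lemma distinct_prefixes_mod:
  assumes "finite \<Gamma>" "\<And>k. k \<in> \<Gamma> \<Longrightarrow> length k = d" "k \<in> proj_prefix n \<Gamma>" "k' \<in> proj_prefix n \<Gamma>" "k \<noteq> k'" "n \<le> d"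
    and M: "int M > width d \<Gamma>"
  shows "\<exists>j<n. \<not> int M dvd (k' ! j - k ! j)"
proof -
  obtain \<kappa> \<kappa>' where \<kappa>: "\<kappa> \<in> \<Gamma>" "k = take n \<kappa>" "\<kappa>' \<in> \<Gamma>" "k' = take n \<kappa>'"
    using assms by (auto simp: proj_prefix_def)
  have "length k = n" "length k' = n" using \<kappa> assms by auto
  then obtain j where j: "j < n" "k ! j \<noteq> k' ! j"
    using \<open>k \<noteq> k'\<close> by (metis nth_equalityI)
  have "k ! j = \<kappa> ! j" "k' ! j = \<kappa>' ! j" using \<kappa> j by auto
  then have "\<bar>k' ! j - k ! j\<bar> \<le> width d \<Gamma>"
    using component_diff_le_width[OF assms(1) \<kappa>(3,1), of j d] j assms by simp
  then have "\<not> int M dvd (k' ! j - k ! j)"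
    using dvd_imp_le_int[of "k' ! j - k ! j" "int M"] j M by auto
  with j show ?thesis by blast
qed

text \<open>Frequencies as integer-valued functions on the draws that a restricted polynomial depends on.\<close>

primrec draw_freq :: "freq \<Rightarrow> draw \<Rightarrow> int" where
  "draw_freq \<kappa> (Shift1 t i j) = \<kappa> ! j"
| "draw_freq \<kappa> (Shift2 n i j) = \<kappa> ! j"
| "draw_freq \<kappa> (GenA n l j) = 0"
| "draw_freq \<kappa> (GenY l j) = 0"

text \<open>Both kinds of projected coefficients have this form: the sum runs over the frequencies with property
  \<open>R\<close>, which determines the components in \<open>D'\<close>, and the components in \<open>D\<close> are random.  A threshold valid
  for all coefficient vectors on the frequencies of \<open>\<Gamma>\<close> with property \<open>R\<close> is valid for all subsets
  \<open>I\<close>, by extending the coefficients by zero.\<close>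

lemma restricted_small_ball:
  fixes sh :: "nat \<Rightarrow> draw"
  assumes "finite \<Gamma>" "\<And>k. k \<in> \<Gamma> \<Longrightarrow> length k = d" "m > 0" "\<epsilon> > 0" "inj sh" "\<And>\<kappa> j. draw_freq \<kappa> (sh j) = \<kappa> ! j"
    and "finite D" "{..<d} \<subseteq> D \<union> D'" and agree: "\<And>\<kappa> \<kappa>' j. \<kappa> \<in> \<Gamma> \<Longrightarrow> \<kappa>' \<in> \<Gamma> \<Longrightarrow> R \<kappa> \<Longrightarrow> R \<kappa>' \<Longrightarrow> j \<in> D' \<Longrightarrow> \<kappa> ! j = \<kappa>' ! j"
  shows "\<exists>\<theta>>0. \<forall>I c. I \<subseteq> \<Gamma> \<longrightarrow> (\<forall>\<kappa>\<in>I. cmod (c \<kappa>) \<ge> m) \<longrightarrow> (\<exists>\<kappa>\<in>I. R \<kappa>) \<longrightarrow>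
    measure uniform_seeds {\<omega> \<in> space uniform_seeds. cmod (\<Sum>\<kappa>\<in>{\<kappa> \<in> I. R \<kappa>}.
      c \<kappa> * cis (2 * pi * (\<Sum>j\<in>D. of_int (\<kappa> ! j) * \<omega> (sh j)))) \<le> \<theta>} \<le> \<epsilon>"
proof -
  define H where "H = {\<kappa> \<in> \<Gamma>. R \<kappa>}"
  have "\<exists>\<theta>>0. \<forall>c. (\<exists>\<kappa>\<in>H. cmod (c \<kappa>) \<ge> m) \<longrightarrow>
    measure uniform_seeds {\<omega> \<in> space uniform_seeds.
      cmod (\<Sum>\<kappa>\<in>H. c \<kappa> * cis (2 * pi * (\<Sum>i\<in>sh ` D. of_int (draw_freq \<kappa> i) * \<omega> i))) \<le> \<theta>} \<le> \<epsilon>"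
  proof (rule trig_poly_small_ball)
    fix \<kappa> \<kappa>' assume \<kappa>: "\<kappa> \<in> H" "\<kappa>' \<in> H" and eq: "\<And>i. i \<in> sh ` D \<Longrightarrow> draw_freq \<kappa> i = draw_freq \<kappa>' i"
    have "\<kappa> ! j = \<kappa>' ! j" if "j < d" for j
    proof (cases "j \<in> D")
      case True
      then show ?thesis using eq[of "sh j"] assms(6) by simp
    next
      case False
      then have "j \<in> D'" using that assms(8) by auto
      then show ?thesis using agree \<kappa> by (simp add: H_def)
    qed
    then show "\<kappa> = \<kappa>'" using \<kappa> assms(2) by (intro nth_equalityI) (auto simp: H_def)
  qed (use assms in \<open>auto simp: H_def\<close>)
  then obtain \<theta> where "\<theta> > 0" and \<theta>: "\<And>c. \<exists>\<kappa>\<in>H. cmod (c \<kappa>) \<ge> m \<Longrightarrow>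
    measure uniform_seeds {\<omega> \<in> space uniform_seeds.
      cmod (\<Sum>\<kappa>\<in>H. c \<kappa> * cis (2 * pi * (\<Sum>i\<in>sh ` D. of_int (draw_freq \<kappa> i) * \<omega> i))) \<le> \<theta>} \<le> \<epsilon>"
    by blast
  have "measure uniform_seeds {\<omega> \<in> space uniform_seeds. cmod (\<Sum>\<kappa>\<in>{\<kappa> \<in> I. R \<kappa>}.
      c \<kappa> * cis (2 * pi * (\<Sum>j\<in>D. of_int (\<kappa> ! j) * \<omega> (sh j)))) \<le> \<theta>} \<le> \<epsilon>"
    if I: "I \<subseteq> \<Gamma>" "\<forall>\<kappa>\<in>I. cmod (c \<kappa>) \<ge> m" "\<exists>\<kappa>\<in>I. R \<kappa>" for I c
  proof -
    define c' where "c' \<kappa> = (if \<kappa> \<in> I then c \<kappa> else 0)" for \<kappa>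
    have inner: "(\<Sum>i\<in>sh ` D. of_int (draw_freq \<kappa> i) * \<omega> i) = (\<Sum>j\<in>D. of_int (\<kappa> ! j) * \<omega> (sh j))" for \<kappa> and \<omega> :: seed
      using \<open>inj sh\<close> assms(6) by (subst sum.reindex) (auto intro: inj_on_subset simp: comp_def)
    have eq: "(\<Sum>\<kappa>\<in>H. c' \<kappa> * cis (2 * pi * (\<Sum>i\<in>sh ` D. of_int (draw_freq \<kappa> i) * \<omega> i))) =
      (\<Sum>\<kappa>\<in>{\<kappa> \<in> I. R \<kappa>}. c \<kappa> * cis (2 * pi * (\<Sum>j\<in>D. of_int (\<kappa> ! j) * \<omega> (sh j))))" for \<omega> :: seed
      unfolding inner
      by (rule sum.mono_neutral_cong_right) (use I \<open>finite \<Gamma>\<close> in \<open>auto simp: H_def c'_def\<close>)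
    have "\<exists>\<kappa>\<in>H. cmod (c' \<kappa>) \<ge> m" using I by (auto simp: H_def c'_def)
    from \<theta>[OF this] show ?thesis unfolding eq .
  qed
  with \<open>\<theta> > 0\<close> show ?thesis by blast
qed

lemma comp_coeff_small_ball:
  assumes "finite \<Gamma>" "\<And>k. k \<in> \<Gamma> \<Longrightarrow> length k = d" "m > 0" "\<epsilon> > 0"
  shows "\<exists>\<theta>>0. \<forall>I c. I \<subseteq> \<Gamma> \<longrightarrow> (\<forall>\<kappa>\<in>I. cmod (c \<kappa>) \<ge> m) \<longrightarrow> k \<in> proj t I \<longrightarrow>
    measure uniform_seeds {\<omega> \<in> space uniform_seeds. cmod (comp_coeff d I c \<omega> t k) \<le> \<theta>} \<le> \<epsilon>"
proof -
  have *: "(\<exists>\<kappa>\<in>I. \<kappa> ! t = k) \<longleftrightarrow> k \<in> proj t I" for I by (auto simp: proj_def)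
  show ?thesis unfolding comp_coeff_def *[symmetric]
    by (rule restricted_small_ball[where D' = "{t}" and d = d])
      (use assms in \<open>auto simp: inj_def\<close>)
qed

lemma prefix_coeff_small_ball:
  assumes "finite \<Gamma>" "\<And>k. k \<in> \<Gamma> \<Longrightarrow> length k = d" "m > 0" "\<epsilon> > 0"
  shows "\<exists>\<theta>>0. \<forall>I c. I \<subseteq> \<Gamma> \<longrightarrow> (\<forall>\<kappa>\<in>I. cmod (c \<kappa>) \<ge> m) \<longrightarrow> k \<in> proj_prefix n I \<longrightarrow>
    measure uniform_seeds {\<omega> \<in> space uniform_seeds. cmod (prefix_coeff d I c \<omega> n k) \<le> \<theta>} \<le> \<epsilon>"
proof -
  have *: "(\<exists>\<kappa>\<in>I. take n \<kappa> = k) \<longleftrightarrow> k \<in> proj_prefix n I" for I by (auto simp: proj_prefix_def)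
  show ?thesis unfolding prefix_coeff_def *[symmetric]
  proof (rule restricted_small_ball[where D' = "{..<n}" and d = d])
    fix \<kappa> \<kappa>' :: freq and j assume "take n \<kappa> = k" "take n \<kappa>' = k" "j \<in> {..<n}"
    then show "\<kappa> ! j = \<kappa>' ! j" by (metis lessThan_iff nth_take)
  qed (use assms in \<open>auto simp: inj_def\<close>)
qed

text \<open>Only finitely many components \<open>k\<close> of frequencies from \<open>\<Gamma>\<close> occur; take the least of their thresholds.\<close>

lemma uniform_threshold:
  assumes "finite \<Gamma>" "\<And>k. k \<in> \<Gamma> \<Longrightarrow> length k = d" "m > 0" "\<epsilon> > 0"
  shows "\<exists>\<theta>>0. \<forall>I c. I \<subseteq> \<Gamma> \<longrightarrow> (\<forall>\<kappa>\<in>I. cmod (c \<kappa>) \<ge> m) \<longrightarrow>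
    (\<forall>t<d. \<forall>k\<in>proj t I. measure uniform_seeds {\<omega> \<in> space uniform_seeds. cmod (comp_coeff d I c \<omega> t k) \<le> \<theta>} \<le> \<epsilon>) \<and>
    (\<forall>n\<in>{2..d}. \<forall>k\<in>proj_prefix n I. measure uniform_seeds {\<omega> \<in> space uniform_seeds. cmod (prefix_coeff d I c \<omega> n k) \<le> \<theta>} \<le> \<epsilon>)"
proof -
  let ?P = "uniform_seeds :: seed measure"
  have "\<forall>t k. \<exists>\<theta>. \<theta> > 0 \<and> (\<forall>I c. I \<subseteq> \<Gamma> \<longrightarrow> (\<forall>\<kappa>\<in>I. cmod (c \<kappa>) \<ge> m) \<longrightarrow> k \<in> proj t I \<longrightarrow>
    measure ?P {\<omega> \<in> space ?P. cmod (comp_coeff d I c \<omega> t k) \<le> \<theta>} \<le> \<epsilon>)"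
    using comp_coeff_small_ball[OF assms] by blast
  then obtain \<Theta>1 where \<Theta>1: "\<forall>t k. \<Theta>1 t k > 0 \<and> (\<forall>I c. I \<subseteq> \<Gamma> \<longrightarrow> (\<forall>\<kappa>\<in>I. cmod (c \<kappa>) \<ge> m) \<longrightarrow> k \<in> proj t I \<longrightarrow>
    measure ?P {\<omega> \<in> space ?P. cmod (comp_coeff d I c \<omega> t k) \<le> \<Theta>1 t k} \<le> \<epsilon>)"
    unfolding choice_iff by blast
  have "\<forall>n k. \<exists>\<theta>. \<theta> > 0 \<and> (\<forall>I c. I \<subseteq> \<Gamma> \<longrightarrow> (\<forall>\<kappa>\<in>I. cmod (c \<kappa>) \<ge> m) \<longrightarrow> k \<in> proj_prefix n I \<longrightarrow>
    measure ?P {\<omega> \<in> space ?P. cmod (prefix_coeff d I c \<omega> n k) \<le> \<theta>} \<le> \<epsilon>)"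
    using prefix_coeff_small_ball[OF assms] by blast
  then obtain \<Theta>2 where \<Theta>2: "\<forall>n k. \<Theta>2 n k > 0 \<and> (\<forall>I c. I \<subseteq> \<Gamma> \<longrightarrow> (\<forall>\<kappa>\<in>I. cmod (c \<kappa>) \<ge> m) \<longrightarrow> k \<in> proj_prefix n I \<longrightarrow>
    measure ?P {\<omega> \<in> space ?P. cmod (prefix_coeff d I c \<omega> n k) \<le> \<Theta>2 n k} \<le> \<epsilon>)"
    unfolding choice_iff by blast
  \<comment> \<open>The element 1 keeps the set nonempty.\<close>
  define S where "S = insert 1 ((\<lambda>(t, k). \<Theta>1 t k) ` (SIGMA t:{..<d}. proj t \<Gamma>) \<union> (\<lambda>(n, k). \<Theta>2 n k) ` (SIGMA n:{2..d}. proj_prefix n \<Gamma>))"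
  have "finite S" using assms(1) by (auto simp: S_def proj_def proj_prefix_def)
  have pos: "Min S > 0"
    using \<open>finite S\<close> \<Theta>1 \<Theta>2 by (subst Min_gr_iff) (auto simp: S_def)
  have mono: "measure ?P {\<omega> \<in> space ?P. cmod (f \<omega>) \<le> Min S} \<le> \<epsilon>"
    if "f \<in> borel_measurable ?P" "x \<in> S" "measure ?P {\<omega> \<in> space ?P. cmod (f \<omega>) \<le> x} \<le> \<epsilon>" for f x
  proof -
    have [measurable]: "f \<in> borel_measurable ?P" by fact
    have "Min S \<le> x" using \<open>finite S\<close> that by simp
    then have "measure ?P {\<omega> \<in> space ?P. cmod (f \<omega>) \<le> Min S} \<le> measure ?P {\<omega> \<in> space ?P. cmod (f \<omega>) \<le> x}"
      by (intro uniform_seeds.finite_measure_mono) auto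
    with that(3) show ?thesis by simp
  qed
  have m1: "(\<lambda>\<omega>. comp_coeff d I c \<omega> t k) \<in> borel_measurable ?P" for I c t k
    unfolding comp_coeff_def by measurable
  have m2: "(\<lambda>\<omega>. prefix_coeff d I c \<omega> n k) \<in> borel_measurable ?P" for I c n k
    unfolding prefix_coeff_def by measurable
  show ?thesis
  proof (rule exI[of _ "Min S"], intro conjI allI impI ballI pos)
    fix I c t k assume I: "I \<subseteq> \<Gamma>" "\<forall>\<kappa>\<in>I. cmod (c \<kappa>) \<ge> m" and t: "t < d" "k \<in> proj t I"
    then have "\<Theta>1 t k \<in> S" by (force simp: S_def proj_def)
    moreover have "measure ?P {\<omega> \<in> space ?P. cmod (comp_coeff d I c \<omega> t k) \<le> \<Theta>1 t k} \<le> \<epsilon>"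
      using \<Theta>1 I t by blast
    ultimately show "measure ?P {\<omega> \<in> space ?P. cmod (comp_coeff d I c \<omega> t k) \<le> Min S} \<le> \<epsilon>"
      by (rule mono[OF m1])
  next
    fix I c n k assume I: "I \<subseteq> \<Gamma>" "\<forall>\<kappa>\<in>I. cmod (c \<kappa>) \<ge> m" and n: "n \<in> {2..d}" "k \<in> proj_prefix n I"
    then have "\<Theta>2 n k \<in> S" by (force simp: S_def proj_prefix_def)
    moreover have "measure ?P {\<omega> \<in> space ?P. cmod (prefix_coeff d I c \<omega> n k) \<le> \<Theta>2 n k} \<le> \<epsilon>"
      using \<Theta>2 I n by blast
    ultimately show "measure ?P {\<omega> \<in> space ?P. cmod (prefix_coeff d I c \<omega> n k) \<le> Min S} \<le> \<epsilon>"
      by (rule mono[OF m2])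
  qed
qed

context
  fixes d s G :: nat and \<Gamma> :: "freq set" and I :: "nat \<Rightarrow> freq set" and c :: "nat \<Rightarrow> freq \<Rightarrow> complex"
  assumes d: "d \<ge> 1" and fin: "finite \<Gamma>" and len: "\<And>k. k \<in> \<Gamma> \<Longrightarrow> length k = d"
    and fam: "sparse_family s G \<Gamma> I c"
begin

lemma len_all: "\<forall>k\<in>\<Gamma>. length k = d"
  using len by blast

lemmas family_cards = sparse_family_props(1,8,9,6,7)[OF fin len_all fam]

lemma comp_set_card: "finite (comp_set \<theta> s G \<Gamma> I t)" "card (comp_set \<theta> s G \<Gamma> I t) \<le> G * s"
  "comp_set \<theta> s G \<Gamma> I t \<subseteq> proj t \<Gamma>"
proof -
  let ?f = "\<lambda>g. if \<theta> = 0 then set (take (s - card (proj t (I g)))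
     (filter (\<lambda>k. k \<notin> proj t (I g)) (sorted_list_of_set (proj t \<Gamma>)))) else {}"
  let ?T = "\<lambda>g. proj t (I g) \<union> ?f g"
  show "finite (comp_set \<theta> s G \<Gamma> I t)" using family_cards by (auto simp: comp_set_def)
  have "card (?T g) \<le> s" if "g < G" for g
  proof -
    have "card (?f g) \<le> s - card (proj t (I g))"
      by (auto intro: order_trans[OF card_length])
    then show ?thesis using card_Un_le[of "proj t (I g)" "?f g"] family_cards(4)[OF that, of t] by linarith
  qed
  then have "(\<Sum>g<G. card (?T g)) \<le> (\<Sum>g<G. s)" by (intro sum_mono) auto
  then show "card (comp_set \<theta> s G \<Gamma> I t) \<le> G * s"
    unfolding comp_set_def using card_UN_le[of "{..<G}" ?T] by simp
  have "finite (proj t \<Gamma>)" using fin by (simp add: proj_def)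
  then show "comp_set \<theta> s G \<Gamma> I t \<subseteq> proj t \<Gamma>"
    using family_cards(1) by (fastforce simp: comp_set_def proj_def dest: in_set_takeD split: if_splits)
qed

lemma prefix_set_card: "finite (prefix_set \<theta> s G \<Gamma> I n)" "card (prefix_set \<theta> s G \<Gamma> I n) \<le> G * s"
  "prefix_set \<theta> s G \<Gamma> I d \<subseteq> proj_prefix d \<Gamma>"
proof -
  show "finite (prefix_set \<theta> s G \<Gamma> I n)"
    using comp_set_card family_cards by (auto simp: prefix_set_def)
  have "card (\<Union>g<G. proj_prefix n (I g)) \<le> (\<Sum>g<G. card (proj_prefix n (I g)))"
    by (rule card_UN_le) simp
  also have "\<dots> \<le> (\<Sum>g<G. s)" using family_cards by (intro sum_mono) auto
  finally have "card (\<Union>g<G. proj_prefix n (I g)) \<le> G * s" by simp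
  moreover have "card ((\<lambda>k. [k]) ` comp_set \<theta> s G \<Gamma> I 0) \<le> G * s"
    using card_image_le[OF comp_set_card(1)] comp_set_card(2) le_trans by blast
  ultimately show "card (prefix_set \<theta> s G \<Gamma> I n) \<le> G * s" by (simp add: prefix_set_def)
  show "prefix_set \<theta> s G \<Gamma> I d \<subseteq> proj_prefix d \<Gamma>"
  proof
    fix k assume k: "k \<in> prefix_set \<theta> s G \<Gamma> I d"
    show "k \<in> proj_prefix d \<Gamma>"
    proof (cases "d = 1")
      case True
      then obtain a where a: "k = [a]" "a \<in> proj 0 \<Gamma>" using k comp_set_card(3) by (auto simp: prefix_set_def)
      then obtain \<kappa> where "\<kappa> \<in> \<Gamma>" "a = \<kappa> ! 0" by (auto simp: proj_def)
      then have "take d \<kappa> = k" using len[of \<kappa>] a True by (cases \<kappa>) auto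
      then show ?thesis using \<open>\<kappa> \<in> \<Gamma>\<close> by (auto simp: proj_prefix_def)
    next
      case False
      then show ?thesis using k d family_cards(1) by (fastforce simp: prefix_set_def proj_prefix_def)
    qed
  qed
qed

lemma cand_set_card: "finite (cand_set \<theta> s G \<Gamma> I n)" "card (cand_set \<theta> s G \<Gamma> I n) \<le> (G * s) * (G * s)"
proof -
  let ?A = "prefix_set \<theta> s G \<Gamma> I (n - 1) \<times> comp_set \<theta> s G \<Gamma> I (n - 1)"
  have f: "finite ?A" using comp_set_card prefix_set_card by auto
  then show "finite (cand_set \<theta> s G \<Gamma> I n)" by (simp add: cand_set_def)
  have "card (cand_set \<theta> s G \<Gamma> I n) \<le> card ((\<lambda>(k, l). k @ [l]) ` ?A)"
    unfolding cand_set_def using f by (intro card_mono) auto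
  also have "\<dots> \<le> card ?A" using f by (rule card_image_le)
  also have "\<dots> \<le> (G * s) * (G * s)"
    unfolding card_cartesian_product by (intro mult_le_mono comp_set_card prefix_set_card)
  finally show "card (cand_set \<theta> s G \<Gamma> I n) \<le> (G * s) * (G * s)" .
qed

lemma majority_with_prob:
  assumes "prime M" "int M > width d \<Gamma>" "16 * b \<le> M" "n \<le> d" "K \<subseteq> proj_prefix n \<Gamma>" "card K \<le> b" "k \<in> proj_prefix n \<Gamma>"
    and inj: "\<And>l j l' j'. gen l j = gen l' j' \<Longrightarrow> l = l' \<and> j = j'"
  shows "with_prob_at_least uniform_seeds (1 - (1 / 2) ^ L)
    (\<lambda>\<omega>. 2 * card {l. l < L \<and> collides M n gen K k \<omega> l} < L)"
proof -
  have finK: "finite K" using assms(5) fin finite_subset by (auto simp: proj_prefix_def)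
  have "with_prob_at_least uniform_seeds (1 - (1 / 2) ^ L)
    (\<lambda>\<omega>. \<not> L \<le> 2 * card {l. l < L \<and> collides M n gen K k \<omega> l})"
  proof (rule with_prob_complement)
    have "card (K - {k}) \<le> b" by (rule order_trans[OF card_Diff1_le assms(6)])
    then show "measure uniform_seeds {\<omega> \<in> space uniform_seeds. L \<le> 2 * card {l. l < L \<and> collides M n gen K k \<omega> l}} \<le> (1 / 2) ^ L"
    proof (intro majority_collisions_bound assms(1) finK inj)
      fix k' assume "k' \<in> K - {k}"
      then show "\<exists>j<n. \<not> int M dvd (k' ! j - k ! j)"
        using assms by (intro distinct_prefixes_mod[OF fin len]) auto
    qed (use assms in auto)
    have count: "card {l. l < L \<and> collides M n gen K k \<omega> l} = (\<Sum>l<L. if collides M n gen K k \<omega> l then 1 else 0)" for \<omega>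
    proof -
      have "{l. l < L \<and> collides M n gen K k \<omega> l} = {l \<in> {..<L}. collides M n gen K k \<omega> l}" by auto
      then show ?thesis by (simp only: card_eq_sum sum.inter_filter[OF finite_lessThan])
    qed
    have "(\<lambda>\<omega>. \<Sum>l<L. if collides M n gen K k \<omega> l then 1 else (0::nat)) \<in> measurable uniform_seeds (count_space UNIV)"
      using measurable_collides[OF finK] by measurable
    from measurable_sets[OF this, of "{x. L \<le> 2 * x}"]
    show "{\<omega> \<in> space uniform_seeds. L \<le> 2 * card {l. l < L \<and> collides M n gen K k \<omega> l}} \<in> sets uniform_seeds"
      unfolding count by (simp add: vimage_def Int_def conj_commute)
  qed
  then show ?thesis by (simp only: not_le)
qed

text \<open>Union bound; each summand of the failure probability belongs to one of the four conditions in the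
  definition of \<open>good_seed\<close>, the first two being equal.\<close>

lemma good_seed_probability:
  assumes M: "prime M" "int M > width d \<Gamma>" "16 * s \<le> M" and M': "prime M'" "int M' > width d \<Gamma>" "16 * (G * s) \<le> M'"
    and "\<epsilon> \<ge> 0"
    and small: "\<And>g t k. g < G \<Longrightarrow> t < d \<Longrightarrow> k \<in> proj t (I g) \<Longrightarrow>
      measure uniform_seeds {\<omega> \<in> space uniform_seeds. cmod (comp_coeff d (I g) (c g) \<omega> t k) \<le> \<theta>0} \<le> \<epsilon>"
      "\<And>g n k. g < G \<Longrightarrow> n \<in> {2..d} \<Longrightarrow> k \<in> proj_prefix n (I g) \<Longrightarrow>
      measure uniform_seeds {\<omega> \<in> space uniform_seeds. cmod (prefix_coeff d (I g) (c g) \<omega> n k) \<le> \<theta>0} \<le> \<epsilon>"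
    and "\<theta> \<le> \<theta>0"
  shows "with_prob_at_least uniform_seeds
     (1 - (2 * (real d * (real G * (real s * \<epsilon>))) + real d * (real G * ((real G * real s) ^ 2 * (1 / 2) ^ L)) + real G * real s * (1 / 2) ^ L))
     (good_seed d s G \<Gamma> I c \<theta> M L M' L)"
proof -
  have [measurable]: "(\<lambda>\<omega>. comp_coeff d J a \<omega> t k) \<in> borel_measurable uniform_seeds" for J a t k
    unfolding comp_coeff_def by measurable
  have [measurable]: "(\<lambda>\<omega>. prefix_coeff d J a \<omega> n k) \<in> borel_measurable uniform_seeds" for J a n k
    unfolding prefix_coeff_def by measurable
  let ?W = "with_prob_at_least (uniform_seeds :: seed measure)"
  have 1: "?W (1 - real d * (real G * (real s * \<epsilon>)))
     (\<lambda>\<omega>. \<forall>t\<in>{..<d}. \<forall>g\<in>{..<G}. \<forall>k\<in>proj t (I g). cmod (comp_coeff d (I g) (c g) \<omega> t k) > \<theta>)"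
  proof (intro with_prob_ball)
    fix t g k assume "t \<in> {..<d}" "g \<in> {..<G}" "k \<in> proj t (I g)"
    then have "?W (1 - \<epsilon>) (\<lambda>\<omega>. \<not> cmod (comp_coeff d (I g) (c g) \<omega> t k) \<le> \<theta>0)"
      by (intro with_prob_complement small) auto
    then show "?W (1 - \<epsilon>) (\<lambda>\<omega>. cmod (comp_coeff d (I g) (c g) \<omega> t k) > \<theta>)"
      using \<open>\<theta> \<le> \<theta>0\<close> by (elim with_prob_mono) auto
  qed (use family_cards \<open>\<epsilon> \<ge> 0\<close> in auto)
  have 2: "?W (1 - real d * (real G * (real s * \<epsilon>)))
     (\<lambda>\<omega>. \<forall>n\<in>{2..d}. \<forall>g\<in>{..<G}. \<forall>k\<in>proj_prefix n (I g). cmod (prefix_coeff d (I g) (c g) \<omega> n k) > \<theta>)"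
  proof (intro with_prob_ball)
    fix n g k assume "n \<in> {2..d}" "g \<in> {..<G}" "k \<in> proj_prefix n (I g)"
    then have "?W (1 - \<epsilon>) (\<lambda>\<omega>. \<not> cmod (prefix_coeff d (I g) (c g) \<omega> n k) \<le> \<theta>0)"
      by (intro with_prob_complement small) auto
    then show "?W (1 - \<epsilon>) (\<lambda>\<omega>. cmod (prefix_coeff d (I g) (c g) \<omega> n k) > \<theta>)"
      using \<open>\<theta> \<le> \<theta>0\<close> by (elim with_prob_mono) auto
  qed (use family_cards \<open>\<epsilon> \<ge> 0\<close> in auto)
  have 3: "?W (1 - real d * (real G * ((real G * real s) ^ 2 * (1 / 2) ^ L)))
     (\<lambda>\<omega>. \<forall>n\<in>{2..d}. \<forall>g\<in>{..<G}. \<forall>k\<in>cand_set \<theta> s G \<Gamma> I n.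
        2 * card {l. l < L \<and> collides M n (GenA n) (proj_prefix n (I g)) k \<omega> l} < L)"
  proof (intro with_prob_ball)
    fix n g k assume "n \<in> {2..d}" "g \<in> {..<G}" "k \<in> cand_set \<theta> s G \<Gamma> I n"
    then show "?W (1 - (1 / 2) ^ L) (\<lambda>\<omega>. 2 * card {l. l < L \<and> collides M n (GenA n) (proj_prefix n (I g)) k \<omega> l} < L)"
      using M family_cards[of g] by (intro majority_with_prob[where b = s]) (auto simp: cand_set_def proj_prefix_def)
  next
    fix n g
    show "real (card (cand_set \<theta> s G \<Gamma> I n)) \<le> (real G * real s)\<^sup>2"
      using cand_set_card(2)[of \<theta> n] by (simp only: of_nat_le_iff[symmetric, where 'a = real] of_nat_mult power2_eq_square)
  qed (use cand_set_card in auto)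
  have 4: "?W (1 - real G * real s * (1 / 2) ^ L) (\<lambda>\<omega>. \<forall>k\<in>prefix_set \<theta> s G \<Gamma> I d.
        2 * card {l. l < L \<and> collides M' d GenY (prefix_set \<theta> s G \<Gamma> I d) k \<omega> l} < L)"
  proof (rule with_prob_ball)
    fix k assume "k \<in> prefix_set \<theta> s G \<Gamma> I d"
    then show "?W (1 - (1 / 2) ^ L) (\<lambda>\<omega>. 2 * card {l. l < L \<and> collides M' d GenY (prefix_set \<theta> s G \<Gamma> I d) k \<omega> l} < L)"
      using M' prefix_set_card[of \<theta>] by (intro majority_with_prob[where b = "G * s"]) auto
  next
    show "real (card (prefix_set \<theta> s G \<Gamma> I d)) \<le> real G * real s"
      using prefix_set_card(2)[of \<theta> d] by (simp only: of_nat_le_iff[symmetric, where 'a = real] of_nat_mult)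
  qed (use prefix_set_card in auto)
  have "?W (1 - ((real d * (real G * (real s * \<epsilon>)) + real d * (real G * (real s * \<epsilon>))) +
     (real d * (real G * ((real G * real s) ^ 2 * (1 / 2) ^ L)) + real G * real s * (1 / 2) ^ L))) (\<lambda>\<omega>.
     ((\<forall>t\<in>{..<d}. \<forall>g\<in>{..<G}. \<forall>k\<in>proj t (I g). cmod (comp_coeff d (I g) (c g) \<omega> t k) > \<theta>) \<and>
     (\<forall>n\<in>{2..d}. \<forall>g\<in>{..<G}. \<forall>k\<in>proj_prefix n (I g). cmod (prefix_coeff d (I g) (c g) \<omega> n k) > \<theta>)) \<and>
     ((\<forall>n\<in>{2..d}. \<forall>g\<in>{..<G}. \<forall>k\<in>cand_set \<theta> s G \<Gamma> I n.
        2 * card {l. l < L \<and> collides M n (GenA n) (proj_prefix n (I g)) k \<omega> l} < L) \<and>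
     (\<forall>k\<in>prefix_set \<theta> s G \<Gamma> I d. 2 * card {l. l < L \<and> collides M' d GenY (prefix_set \<theta> s G \<Gamma> I d) k \<omega> l} < L)))"
    by (rule with_prob_conj[OF with_prob_conj[OF 1 2] with_prob_conj[OF 3 4]])
  then show ?thesis
    by (rule with_prob_mono) (simp, auto simp: good_seed_def)
qed

end


section \<open>Worst-case counts\<close>

lemma sum_list_le_length: "(\<And>x. x \<in> set xs \<Longrightarrow> f x \<le> (b::nat)) \<Longrightarrow> (\<Sum>x\<leftarrow>xs. f x) \<le> length xs * b"
  by (induction xs) (auto intro: add_mono)

lemma card_UN_list_le: "(\<And>x. x \<in> set xs \<Longrightarrow> card (f x) \<le> b) \<Longrightarrow> card (\<Union>x\<in>set xs. f x) \<le> length xs * b"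
proof (induction xs)
  case (Cons x xs)
  have "card (\<Union>x\<in>set (x # xs). f x) \<le> card (f x) + card (\<Union>x\<in>set xs. f x)"
    by (simp add: card_Un_le)
  also have "\<dots> \<le> b + length xs * b" using Cons by (intro add_mono) auto
  finally show ?case by simp
qed simp

lemma foldP_bounds:
  assumes "Inv b" and step: "\<And>x b. x \<in> set xs \<Longrightarrow> Inv b \<Longrightarrow> Inv (result (f x b) F) \<and>
    operations (f x b) F \<le> B \<and> locations (f x b) F \<subseteq> X \<and> card (locations (f x b) F) \<le> N"
  shows "Inv (result (foldP f xs b) F) \<and> operations (foldP f xs b) F \<le> length xs * B \<and>
    locations (foldP f xs b) F \<subseteq> X \<and> card (locations (foldP f xs b) F) \<le> length xs * N"
  using assms
proof (induction xs arbitrary: b)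
  case (Cons x xs)
  let ?b = "result (f x b) F"
  have 1: "Inv ?b" "operations (f x b) F \<le> B" "locations (f x b) F \<subseteq> X" "card (locations (f x b) F) \<le> N"
    using Cons.prems(2)[of x b] Cons.prems(1) by auto
  have 2: "Inv (result (foldP f xs ?b) F) \<and> operations (foldP f xs ?b) F \<le> length xs * B \<and>
    locations (foldP f xs ?b) F \<subseteq> X \<and> card (locations (foldP f xs ?b) F) \<le> length xs * N"
    by (rule Cons.IH[OF 1(1)]) (use Cons.prems(2) in simp)
  have "card (locations (f x b) F \<union> locations (foldP f xs ?b) F) \<le> N + length xs * N"
    using 1 2 by (intro order_trans[OF card_Un_le] add_mono) auto
  then show ?case using 1 2 by simp
qed simp

definition grid_size :: "nat \<Rightarrow> freq set \<Rightarrow> nat" where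
  "grid_size t \<Gamma> = nat (Max (proj t \<Gamma>) - Min (proj t \<Gamma>) + 1)"

lemma grid_size_bounds:
  assumes "finite \<Gamma>" "\<Gamma> \<noteq> {}"
  shows "card (proj t \<Gamma>) \<le> grid_size t \<Gamma>" "grid_size t \<Gamma> > 0"
    "t < d \<Longrightarrow> grid_size t \<Gamma> \<le> nat (width d \<Gamma>) + 1"
proof -
  have f: "finite (proj t \<Gamma>)" "proj t \<Gamma> \<noteq> {}" using assms by (auto simp: proj_def)
  have "proj t \<Gamma> \<subseteq> {Min (proj t \<Gamma>)..Max (proj t \<Gamma>)}" using f by auto
  then have "card (proj t \<Gamma>) \<le> card {Min (proj t \<Gamma>)..Max (proj t \<Gamma>)}" by (intro card_mono) auto
  then show "card (proj t \<Gamma>) \<le> grid_size t \<Gamma>" by (simp add: grid_size_def)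
  have "Min (proj t \<Gamma>) \<le> Max (proj t \<Gamma>)" using f by (meson Max_in Min_le)
  then show "grid_size t \<Gamma> > 0" by (simp add: grid_size_def)
  assume "t < d"
  then have "Max (proj t \<Gamma>) - Min (proj t \<Gamma>) \<le> width d \<Gamma>"
    unfolding width_def by (intro Max_ge) auto
  then show "grid_size t \<Gamma> \<le> nat (width d \<Gamma>) + 1" by (simp add: grid_size_def)
qed

text \<open>The bounds hold for an arbitrary oracle \<open>F\<close>, so for any course of the run; the exponent \<open>e\<close> bounds the
  number of levels in the transforms and in merge sort.\<close>

lemma step1_worst_case:
  fixes d s G t e :: nat and \<theta> :: real and \<omega> :: seed
  assumes "finite \<Gamma>" "\<Gamma> \<noteq> {}" "t < d" "\<And>i. \<omega> i \<in> {0..<1}" "2 * grid_size t \<Gamma> \<le> 2 ^ e"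
  defines "P \<equiv> step1 d G \<Gamma> s \<theta> 1 \<omega> t"
  shows "set (result P F) \<subseteq> proj t \<Gamma>" "length (result P F) \<le> grid_size t \<Gamma>" "length (result P F) \<le> G * s"
    "operations P F \<le> G * (grid_size t \<Gamma> * (25 * e + 34))"
    "locations P F \<subseteq> torus d" "card (locations P F) \<le> grid_size t \<Gamma>"
proof -
  define K where "K = grid_size t \<Gamma>"
  have K: "K > 0" "2 * K \<le> 2 ^ e" "card (proj t \<Gamma>) \<le> K" using grid_size_bounds[OF assms(1,2), of t] assms by (auto simp: K_def)
  let ?ks = "sorted_list_of_set (proj t \<Gamma>)"
  have fp: "finite (proj t \<Gamma>)" using assms(1) by (simp add: proj_def)
  have lks: "length ?ks \<le> K" using K fp by simp
  let ?vals = "map (\<lambda>l. F ((map (\<lambda>j. \<omega> (Shift1 t 0 j)) [0..<d])[t := real l / real K])) [0..<K]"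
  let ?cs = "\<lambda>g. map (\<lambda>k. (k, result (fft (map (\<lambda>v. v ! g) ?vals)) F ! nat (k mod int K) / of_nat K)) ?ks"
  let ?sel = "\<lambda>g. select_largest s (\<lambda>a. a \<ge> \<theta>) (?cs g)"
  have res: "result P F = remdups (concat (map (\<lambda>g. result (?sel g) F) [0..<G]))"
    unfolding P_def step1_def K_def[unfolded grid_size_def, symmetric] by (simp add: Let_def)
  have ssub: "set (result (?sel g) F) \<subseteq> proj t \<Gamma>" for g
    using select_largest_subset[of s "\<lambda>a. a \<ge> \<theta>" "?cs g" F] fp by auto
  then show sub: "set (result P F) \<subseteq> proj t \<Gamma>" unfolding res by auto
  have "length (result P F) = card (set (result P F))" unfolding res by (simp add: length_remdups_card_conv)
  also have "\<dots> \<le> card (proj t \<Gamma>)" using sub fp by (rule card_mono[rotated])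
  finally show "length (result P F) \<le> grid_size t \<Gamma>" using K(3) by (simp add: K_def)
  have "length (result P F) \<le> length (concat (map (\<lambda>g. result (?sel g) F) [0..<G]))"
    unfolding res by (rule length_remdups_leq)
  also have "\<dots> \<le> length [0..<G] * s"
    unfolding length_concat map_map comp_def by (rule sum_list_le_length) (rule select_largest_length)
  finally show "length (result P F) \<le> G * s" by simp
  have ops: "operations P F = (\<Sum>g\<leftarrow>[0..<G]. operations (fft (map (\<lambda>v. v ! g) ?vals)) F + (length ?ks * 2 + operations (?sel g) F))"
    unfolding P_def step1_def K_def[unfolded grid_size_def, symmetric] by (simp add: Let_def sum_list_triv)
  also have "\<dots> \<le> length [0..<G] * (K * (25 * e + 34))"
  proof (rule sum_list_le_length)
    fix g
    have "operations (fft (map (\<lambda>v. v ! g) ?vals)) F \<le> K * (24 * e + 30)"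
      using fft_operations[of "map (\<lambda>v. v ! g) ?vals" e F] K by simp
    moreover have "operations (?sel g) F \<le> length ?ks * (e + 2)"
      using select_largest_operations[of "?cs g" e s "\<lambda>a. a \<ge> \<theta>" F] lks K(2) by simp
    moreover have "length ?ks * (e + 2) \<le> K * (e + 2)" using lks by (rule mult_le_mono1)
    moreover have "K * (24 * e + 30) + (K * 2 + K * (e + 2)) = K * (25 * e + 34)" by (simp add: algebra_simps)
    ultimately show "operations (fft (map (\<lambda>v. v ! g) ?vals)) F + (length ?ks * 2 + operations (?sel g) F) \<le> K * (25 * e + 34)"
      using lks by linarith
  qed
  finally show "operations P F \<le> G * (grid_size t \<Gamma> * (25 * e + 34))" by (simp add: K_def)
  have locs: "locations P F = (\<lambda>l. (map (\<lambda>j. \<omega> (Shift1 t 0 j)) [0..<d])[t := real l / real K]) ` {..<K}"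
    unfolding P_def step1_def K_def[unfolded grid_size_def, symmetric] by (auto simp: Let_def)
  show "card (locations P F) \<le> grid_size t \<Gamma>"
    unfolding locs using card_image_le[of "{..<K}"] by (simp add: K_def)
  show "locations P F \<subseteq> torus d"
  proof
    fix y assume "y \<in> locations P F"
    then obtain l where l: "l < K" "y = (map (\<lambda>j. \<omega> (Shift1 t 0 j)) [0..<d])[t := real l / real K]"
      unfolding locs by auto
    have "set y \<subseteq> insert (real l / real K) (set (map (\<lambda>j. \<omega> (Shift1 t 0 j)) [0..<d]))"
      unfolding l(2) by (rule set_update_subset_insert)
    also have "\<dots> \<subseteq> {0..<1}" using l(1) assms(4) by auto
    finally show "y \<in> torus d" using l(2) by (simp add: torus_def)
  qed
qed

lemma lattice_points_card: "card (set (lattice_points M (lattice_gens M L n u))) \<le> L * M"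
  using card_length[of "lattice_points M (lattice_gens M L n u)"] by (simp add: lattice_points_length)

text \<open>\<open>J\<close> bounds the number of candidates.  The term \<open>5 * M * d * L\<close> pays for the generating vectors and
  the lattice points, the next one for the bins, and the last one, per polynomial, for the transforms,
  the votes and the selection.\<close>

lemma step2_worst_case:
  fixes d s G n M L J e :: nat and \<theta> :: real and \<omega> :: seed and I1 :: "int list" and I' :: "freq list"
  assumes "\<And>k. k \<in> \<Gamma> \<Longrightarrow> length k = d" "n \<le> d" "\<And>i. \<omega> i \<in> {0..<1}" "M > 0" "2 * M \<le> 2 ^ e"
    and J: "length I' * length I1 \<le> J" "J \<le> 2 ^ e"
  defines "P \<equiv> step2 d G \<Gamma> s s \<theta> 1 (random_rank1_method M L) \<omega> n I1 I'"
  shows "length (result P F) \<le> G * s"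
    "operations P F \<le> 5 * M * d * L + J * (L * (2 * d + 1)) + G * (L * (M * (24 * e + 31)) + J * (3 * L + e + 2))"
    "locations P F \<subseteq> torus d" "card (locations P F) \<le> L * M"
proof -
  define Js where "Js = [k @ [l]. k \<leftarrow> I', l \<leftarrow> I1, k @ [l] \<in> proj_prefix n \<Gamma>]"
  have Js: "Js = filter (\<lambda>k. k \<in> proj_prefix n \<Gamma>) (map (\<lambda>(k, l). k @ [l]) (List.product I' I1))"
    unfolding Js_def by (rule candidate_list_filter)
  have "length Js \<le> length I' * length I1"
    unfolding Js by (rule order_trans[OF length_filter_le]) (simp add: length_product)
  then have lJ: "length Js \<le> J" using J by simp
  have Jlen: "length k = n" if "k \<in> set Js" for k
    using that assms(1,2) unfolding Js by (auto simp: proj_prefix_def)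
  define zs where "zs = lattice_gens M L n (\<lambda>l j. \<omega> (GenA n l j))"
  let ?ext = "\<lambda>y. y @ map (\<lambda>j. \<omega> (Shift2 n 0 j)) [n..<d]"
  let ?vals = "map (\<lambda>y. F (?ext y)) (lattice_points M zs)"
  let ?D = "\<lambda>g. majority_decoder M L Js (lattice_bins M zs Js) (map (\<lambda>v. v ! g) ?vals)"
  let ?sel = "\<lambda>g. select_largest s (\<lambda>a. a > \<theta>) (result (?D g) F)"
  note unf = random_rank1_method_result[OF Jlen] zs_def[symmetric]
  have res: "result P F = remdups (concat (map (\<lambda>g. result (?sel g) F) [0..<G]))"
    unfolding P_def step2_def Js_def[symmetric] by (simp add: Let_def unf)
  have "length (result P F) \<le> length (concat (map (\<lambda>g. result (?sel g) F) [0..<G]))"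
    unfolding res by (rule length_remdups_leq)
  also have "\<dots> \<le> length [0..<G] * s"
    unfolding length_concat map_map comp_def by (rule sum_list_le_length) (rule select_largest_length)
  finally show "length (result P F) \<le> G * s" by simp
  have lv: "length (map (\<lambda>v. v ! g) ?vals) = L * M" for g
    by (simp add: lattice_points_length zs_def)
  have Dlen: "length (result (?D g) F) \<le> length Js" for g
    by (simp add: majority_decoder_def)
  have "operations P F = operations (random_rank1_method M L n Js (\<lambda>l j. \<omega> (GenA n l j))) F +
      (\<Sum>g\<leftarrow>[0..<G]. operations (?D g) F + operations (?sel g) F)"
    unfolding P_def step2_def Js_def[symmetric] by (simp add: Let_def unf sum_list_triv)
  also have "\<dots> \<le> (5 * M * d * L + J * (L * (2 * d + 1))) + length [0..<G] * (L * (M * (24 * e + 31)) + J * (3 * L + e + 2))"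
  proof (rule add_mono)
    have "n \<le> M * d" using \<open>M > 0\<close> by (intro order_trans[OF \<open>n \<le> d\<close>]) simp
    then have "2 * L * n \<le> 2 * L * (M * d)" by (rule mult_le_mono2)
    moreover have "3 * M * n * L \<le> 3 * M * d * L" using \<open>n \<le> d\<close> by (intro mult_le_mono order_refl)
    moreover have "2 * L * (M * d) + 3 * M * d * L = 5 * M * d * L" by (simp add: algebra_simps)
    moreover have "length Js * (L * (2 * n + 1)) \<le> J * (L * (2 * d + 1))"
      using lJ \<open>n \<le> d\<close> by (intro mult_le_mono) auto
    ultimately show "operations (random_rank1_method M L n Js (\<lambda>l j. \<omega> (GenA n l j))) F \<le> 5 * M * d * L + J * (L * (2 * d + 1))"
      using random_rank1_method_operations[of M L n Js "\<lambda>l j. \<omega> (GenA n l j)" F] by linarith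
    show "(\<Sum>g\<leftarrow>[0..<G]. operations (?D g) F + operations (?sel g) F) \<le>
        length [0..<G] * (L * (M * (24 * e + 31)) + J * (3 * L + e + 2))"
    proof (rule sum_list_le_length)
      fix g
      have "operations (?D g) F \<le> L * (M * (24 * e + 31)) + length Js * (3 * L)"
        by (rule majority_decoder_operations[OF lv \<open>M > 0\<close> assms(5)])
      moreover have "length Js * (3 * L) \<le> J * (3 * L)" using lJ by (rule mult_le_mono1)
      moreover have "operations (?sel g) F \<le> length (result (?D g) F) * (e + 2)"
        using Dlen[of g] lJ J(2) by (intro select_largest_operations) linarith
      moreover have "length (result (?D g) F) * (e + 2) \<le> J * (e + 2)"
        using Dlen[of g] lJ by (intro mult_le_mono1) linarith
      moreover have "J * (3 * L) + J * (e + 2) = J * (3 * L + e + 2)" by (simp add: algebra_simps)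
      ultimately show "operations (?D g) F + operations (?sel g) F \<le> L * (M * (24 * e + 31)) + J * (3 * L + e + 2)"
        by linarith
    qed
  qed
  finally show "operations P F \<le> 5 * M * d * L + J * (L * (2 * d + 1)) + G * (L * (M * (24 * e + 31)) + J * (3 * L + e + 2))"
    by simp
  have locs: "locations P F = ?ext ` set (lattice_points M zs)"
    unfolding P_def step2_def Js_def[symmetric] by (auto simp: Let_def unf)
  show "card (locations P F) \<le> L * M"
    unfolding locs zs_def by (rule order_trans[OF card_image_le[OF finite_set] lattice_points_card])
  show "locations P F \<subseteq> torus d"
  proof
    fix y assume "y \<in> locations P F"
    then obtain x where x: "x \<in> set (lattice_points M zs)" "y = ?ext x" unfolding locs by blast
    have "set (lattice_points M zs) \<subseteq> torus n" by (rule lattice_points_torus) (simp add: zs_def)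
    then have "x \<in> torus n" using x by blast
    then show "y \<in> torus d" using \<open>n \<le> d\<close> assms(3) unfolding x(2) torus_def by auto
  qed
qed

lemma step3_worst_case:
  fixes d s G M L e :: nat and \<omega> :: seed and Is :: "freq list"
  assumes "M > 0" "2 * M \<le> 2 ^ e" "length Is \<le> G * s"
  defines "P \<equiv> step3 d G M L \<omega> Is"
  shows "operations P F \<le> 5 * M * d * L + G * s * (L * (2 * d + 2)) + G * (L * (M * (24 * e + 31)))"
    "locations P F \<subseteq> torus d" "card (locations P F) \<le> L * M"
proof -
  define zs where "zs = lattice_gens M L d (\<lambda>l j. \<omega> (GenY l j))"
  let ?vals = "map F (lattice_points M zs)"
  note unf = generators_simps lattice_union_simps lattice_gens_def[symmetric] zs_def[symmetric] lattice_points_def[symmetric]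
  have locs: "locations P F = set (lattice_points M zs)"
    unfolding P_def step3_def by (auto simp: unf)
  show "card (locations P F) \<le> L * M" unfolding locs zs_def by (rule lattice_points_card)
  show "locations P F \<subseteq> torus d" unfolding locs by (rule lattice_points_torus) (simp add: zs_def)
  have ops: "operations P F = 2 * L * d + ((\<Sum>z\<leftarrow>zs. 3 * M * length z) + ((\<Sum>k\<leftarrow>Is. \<Sum>z\<leftarrow>zs. operations (bin M k z) F) +
      (L * length Is + (\<Sum>g\<leftarrow>[0..<G]. operations (lattice_ffts M L (map (\<lambda>v. v ! g) ?vals)) F))))"
    unfolding P_def step3_def by (simp add: unf sum_list_triv)
  have zlen: "length zs = L" by (simp add: zs_def)
  have "(\<Sum>z\<leftarrow>zs. 3 * M * length z) \<le> length zs * (3 * M * d)"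
    by (rule sum_list_le_length) (simp add: zs_def)
  then have 1: "(\<Sum>z\<leftarrow>zs. 3 * M * length z) \<le> L * (3 * M * d)" by (simp add: zs_def)
  have "(\<Sum>k\<leftarrow>Is. \<Sum>z\<leftarrow>zs. operations (bin M k z) F) \<le> length Is * (length zs * (2 * d + 1))"
  proof (intro sum_list_le_length)
    fix k z assume "z \<in> set zs"
    then show "operations (bin M k z) F \<le> 2 * d + 1" using bin_operations[of M k z F] by (simp add: zs_def)
  qed
  moreover have "length Is * (L * (2 * d + 1)) + L * length Is = length Is * (L * (2 * d + 2))" by (simp add: algebra_simps)
  moreover have "length Is * (L * (2 * d + 2)) \<le> G * s * (L * (2 * d + 2))" using assms(3) by (rule mult_le_mono1)
  ultimately have 2: "(\<Sum>k\<leftarrow>Is. \<Sum>z\<leftarrow>zs. operations (bin M k z) F) + L * length Is \<le> G * s * (L * (2 * d + 2))"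
    unfolding zlen by linarith
  have "(\<Sum>g\<leftarrow>[0..<G]. operations (lattice_ffts M L (map (\<lambda>v. v ! g) ?vals)) F) \<le> length [0..<G] * (L * (M * (24 * e + 31)))"
    by (intro sum_list_le_length lattice_ffts_operations assms) (simp add: lattice_points_length zs_def)
  then have 3: "(\<Sum>g\<leftarrow>[0..<G]. operations (lattice_ffts M L (map (\<lambda>v. v ! g) ?vals)) F) \<le> G * (L * (M * (24 * e + 31)))" by simp
  have "2 * L * d \<le> 2 * L * d * M" using \<open>M > 0\<close> by simp
  moreover have "2 * L * d * M + L * (3 * M * d) = 5 * M * d * L" by (simp add: algebra_simps)
  ultimately show "operations P F \<le> 5 * M * d * L + G * s * (L * (2 * d + 2)) + G * (L * (M * (24 * e + 31)))"
    using ops 1 2 3 by linarith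
qed

text \<open>The induction over the prefix length keeps the invariant that at most \<open>G * s\<close> frequencies have been
  detected; together with at most \<open>K\<close> components this bounds the candidates by \<open>G * s * K\<close>.\<close>

theorem worst_case:
  fixes d s G M L M' L' e :: nat and \<theta> :: real and \<omega> :: seed
  assumes fin: "finite \<Gamma>" "\<Gamma> \<noteq> {}" and len: "\<And>k. k \<in> \<Gamma> \<Longrightarrow> length k = d" and d: "d \<ge> 1"
    and \<omega>: "\<And>i. \<omega> i \<in> {0..<1}" and M: "M > 0" "M' > 0"
  defines "K \<equiv> nat (width d \<Gamma>) + 1" and "P \<equiv> uniform_sparse_fft d G \<Gamma> s s \<theta> 1 (random_rank1_method M L) M' L' \<omega>"
  assumes e: "2 * K \<le> 2 ^ e" "2 * M \<le> 2 ^ e" "2 * M' \<le> 2 ^ e" "G * s * K \<le> 2 ^ e"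
  shows "operations P F \<le> d * (G * (K * (25 * e + 34))) +
     d * (5 * M * d * L + G * s * K * (L * (2 * d + 1)) + G * (L * (M * (24 * e + 31)) + G * s * K * (3 * L + e + 2))) +
     (5 * M' * d * L' + G * s * (L' * (2 * d + 2)) + G * (L' * (M' * (24 * e + 31))))"
    "locations P F \<subseteq> torus d" "card (locations P F) \<le> d * K + d * (L * M) + L' * M'"
proof -
  define Is where "Is = map (\<lambda>t. result (step1 d G \<Gamma> s \<theta> 1 \<omega> t) F) [0..<d]"
  have grid: "grid_size t \<Gamma> \<le> K" if "t < d" for t
    using grid_size_bounds(3)[OF fin that] by (simp add: K_def)
  have grid2: "2 * grid_size t \<Gamma> \<le> 2 ^ e" if "t < d" for t
    using grid[OF that] e(1) by linarith
  note s1 = step1_worst_case[where \<omega> = \<omega> and d = d and e = e and G = G and s = s and \<theta> = \<theta> and F = F, OF fin _ \<omega> grid2]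
  have Is_len: "length (Is ! t) \<le> K" "length (Is ! t) \<le> G * s" if "t < d" for t
    using s1(2,3)[of t] grid[OF that] that by (auto simp: Is_def intro: order_trans)
  let ?step = "\<lambda>n. step2 d G \<Gamma> s s \<theta> 1 (random_rank1_method M L) \<omega> n (Is ! (n - 1))"
  let ?init = "map (\<lambda>k. [k]) (Is ! 0)"
  let ?B = "5 * M * d * L + G * s * K * (L * (2 * d + 1)) + G * (L * (M * (24 * e + 31)) + G * s * K * (3 * L + e + 2))"
  have fold: "length (result (foldP ?step [2..<d + 1] ?init) F) \<le> G * s \<and>
    operations (foldP ?step [2..<d + 1] ?init) F \<le> length [2..<d + 1] * ?B \<and>
    locations (foldP ?step [2..<d + 1] ?init) F \<subseteq> torus d \<and>
    card (locations (foldP ?step [2..<d + 1] ?init) F) \<le> length [2..<d + 1] * (L * M)"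
  proof (rule foldP_bounds[where Inv = "\<lambda>J. length J \<le> G * s"])
    show "length ?init \<le> G * s" using Is_len(2)[of 0] d by simp
    fix n and J :: "freq list" assume n: "n \<in> set [2..<d + 1]" and J: "length J \<le> G * s"
    have "n - 1 < d" "n \<le> d" using n by auto
    have "length J * length (Is ! (n - 1)) \<le> G * s * K"
      by (intro mult_le_mono J Is_len \<open>n - 1 < d\<close>)
    note s2 = step2_worst_case[where \<omega> = \<omega>, OF len \<open>n \<le> d\<close> \<omega> M(1) e(2) this e(4)]
    show "length (result (?step n J) F) \<le> G * s \<and> operations (?step n J) F \<le> ?B \<and>
        locations (?step n J) F \<subseteq> torus d \<and> card (locations (?step n J) F) \<le> L * M"
      by (intro conjI s2)
  qed
  define R where "R = result (foldP ?step [2..<d + 1] ?init) F"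
  have R: "length R \<le> G * s" using fold by (simp add: R_def)
  note s3 = step3_worst_case[OF M(2) e(3) R]
  have ops1: "(\<Sum>t\<leftarrow>[0..<d]. operations (step1 d G \<Gamma> s \<theta> 1 \<omega> t) F) \<le> length [0..<d] * (G * (K * (25 * e + 34)))"
  proof (rule sum_list_le_length)
    fix t assume "t \<in> set [0..<d]"
    then have t: "t < d" by simp
    have "operations (step1 d G \<Gamma> s \<theta> 1 \<omega> t) F \<le> G * (grid_size t \<Gamma> * (25 * e + 34))" by (rule s1(4)) (use t in auto)
    also have "\<dots> \<le> G * (K * (25 * e + 34))" by (intro mult_le_mono grid t order_refl)
    finally show "operations (step1 d G \<Gamma> s \<theta> 1 \<omega> t) F \<le> G * (K * (25 * e + 34))" .
  qed
  have steps: "length [2..<d + 1] \<le> d" unfolding length_upt by linarith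
  have "operations P F = (\<Sum>t\<leftarrow>[0..<d]. operations (step1 d G \<Gamma> s \<theta> 1 \<omega> t) F) +
      (operations (foldP ?step [2..<d + 1] ?init) F + operations (step3 d G M' L' \<omega> R) F)"
    unfolding P_def uniform_sparse_fft_def by (simp add: Is_def R_def)
  also have "\<dots> \<le> d * (G * (K * (25 * e + 34))) + (d * ?B +
     (5 * M' * d * L' + G * s * (L' * (2 * d + 2)) + G * (L' * (M' * (24 * e + 31)))))"
  proof (rule add_mono[OF _ add_mono[OF _ s3(1)]])
    show "(\<Sum>t\<leftarrow>[0..<d]. operations (step1 d G \<Gamma> s \<theta> 1 \<omega> t) F) \<le> d * (G * (K * (25 * e + 34)))"
      using ops1 by (simp only: length_upt diff_zero)
    have "operations (foldP ?step [2..<d + 1] ?init) F \<le> length [2..<d + 1] * ?B" using fold by blast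
    also have "\<dots> \<le> d * ?B" by (rule mult_le_mono1[OF steps])
    finally show "operations (foldP ?step [2..<d + 1] ?init) F \<le> d * ?B" .
  qed
  finally show "operations P F \<le> d * (G * (K * (25 * e + 34))) + d * ?B +
     (5 * M' * d * L' + G * s * (L' * (2 * d + 2)) + G * (L' * (M' * (24 * e + 31))))"
    by (simp only: add.assoc)
  have locs: "locations P F = (\<Union>t\<in>set [0..<d]. locations (step1 d G \<Gamma> s \<theta> 1 \<omega> t) F) \<union>
      (locations (foldP ?step [2..<d + 1] ?init) F \<union> locations (step3 d G M' L' \<omega> R) F)"
    unfolding P_def uniform_sparse_fft_def by (simp add: Is_def R_def)
  have l1: "locations (step1 d G \<Gamma> s \<theta> 1 \<omega> t) F \<subseteq> torus d" if "t \<in> set [0..<d]" for t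
    by (rule s1(5)) (use that in auto)
  have l2: "locations (foldP ?step [2..<d + 1] ?init) F \<subseteq> torus d" using fold by blast
  show "locations P F \<subseteq> torus d"
    unfolding locs by (rule Un_least[OF UN_least[OF l1] Un_least[OF l2 s3(2)]])
  have c1: "card (\<Union>t\<in>set [0..<d]. locations (step1 d G \<Gamma> s \<theta> 1 \<omega> t) F) \<le> length [0..<d] * K"
  proof (rule card_UN_list_le)
    fix t assume "t \<in> set [0..<d]"
    then have t: "t < d" by simp
    have "card (locations (step1 d G \<Gamma> s \<theta> 1 \<omega> t) F) \<le> grid_size t \<Gamma>" by (rule s1(6)) (use t in auto)
    then show "card (locations (step1 d G \<Gamma> s \<theta> 1 \<omega> t) F) \<le> K" using grid[OF t] by linarith
  qed
  have "length [2..<d + 1] * (L * M) \<le> d * (L * M)" by (rule mult_le_mono1[OF steps])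
  then have c2: "card (locations (foldP ?step [2..<d + 1] ?init) F) \<le> d * (L * M)" using fold by linarith
  have "card (locations P F) \<le> length [0..<d] * K + (d * (L * M) + L' * M')"
    unfolding locs
    by (intro order_trans[OF card_Un_le] add_mono c1 c2 s3(3))
  then show "card (locations P F) \<le> d * K + d * (L * M) + L' * M'" by simp
qed


section \<open>Recovery probability and complexity\<close>

text \<open>The four failure events get shares of \<open>\<delta>\<close>: with \<open>\<epsilon> = \<delta> / (6 * y)\<close> the two kinds of small coefficients
  together have probability at most \<open>\<delta> / 3\<close>, and by the choice of \<open>L\<close> each kind of collision at most
  \<open>y^3 / 2^L \<le> \<delta> / 3\<close>, where \<open>y = d * s * G\<close>.\<close>

lemma recovery_probability:
  fixes d s G M M' L :: nat and \<delta> m :: real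
  assumes pos: "d \<ge> 1" "s \<ge> 1" "G \<ge> 1" "0 < \<delta>" "\<delta> < 1" "m > 0"
    and fin: "finite \<Gamma>" and len: "\<And>k. k \<in> \<Gamma> \<Longrightarrow> length k = d"
    and M: "prime M" "int M > width d \<Gamma>" "16 * s \<le> M" and M': "prime M'" "int M' > width d \<Gamma>" "16 * (G * s) \<le> M'"
    and L: "3 * (real d * real s * real G / \<delta>) ^ 3 \<le> 2 ^ L"
  shows "\<exists>\<theta>0>0. \<forall>\<theta> I c. 0 \<le> \<theta> \<longrightarrow> \<theta> \<le> \<theta>0 \<longrightarrow>
    sparse_family s G \<Gamma> I c \<and> (\<forall>g<G. \<forall>k\<in>I g. cmod (c g k) \<ge> m) \<longrightarrow>
    with_prob_at_least seed_space (1 - \<delta>) (\<lambda>\<omega>. recovers G I c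
      (result (uniform_sparse_fft d G \<Gamma> s s \<theta> 1 (random_rank1_method M L) M' L \<omega>) (black_box G I c)))"
proof -
  define y where "y = real d * real s * real G"
  have "1 * 1 * 1 \<le> y" unfolding y_def using pos by (intro mult_mono) auto
  then have y: "y \<ge> 1" by simp
  define \<epsilon> where "\<epsilon> = \<delta> / (6 * y)"
  have "\<epsilon> > 0" using pos y by (simp add: \<epsilon>_def)
  obtain \<theta>0 where "\<theta>0 > 0" and \<theta>0: "\<And>I c. I \<subseteq> \<Gamma> \<Longrightarrow> (\<forall>\<kappa>\<in>I. cmod (c \<kappa>) \<ge> m) \<Longrightarrow>
    (\<forall>t<d. \<forall>k\<in>proj t I. measure uniform_seeds {\<omega> \<in> space uniform_seeds. cmod (comp_coeff d I c \<omega> t k) \<le> \<theta>0} \<le> \<epsilon>) \<and>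
    (\<forall>n\<in>{2..d}. \<forall>k\<in>proj_prefix n I. measure uniform_seeds {\<omega> \<in> space uniform_seeds. cmod (prefix_coeff d I c \<omega> n k) \<le> \<theta>0} \<le> \<epsilon>)"
    using uniform_threshold[OF fin len \<open>m > 0\<close> \<open>\<epsilon> > 0\<close>] by blast
  have bound: "2 * (real d * (real G * (real s * \<epsilon>))) + real d * (real G * ((real G * real s) ^ 2 * (1 / 2) ^ L)) +
      real G * real s * (1 / 2) ^ L \<le> \<delta>"
  proof -
    have 1: "2 * (real d * (real G * (real s * \<epsilon>))) = \<delta> / 3"
    proof -
      have "2 * (real d * (real G * (real s * \<epsilon>))) = 2 * (y * \<epsilon>)" by (simp add: y_def)
      then show ?thesis using y by (simp add: \<epsilon>_def)
    qed
    have half: "y ^ 3 * (1 / 2) ^ L \<le> \<delta> / 3"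
    proof -
      have "3 * (y / \<delta>) ^ 3 \<le> 2 ^ L" using L by (simp only: y_def)
      then have "3 * y ^ 3 \<le> \<delta> ^ 3 * 2 ^ L"
        using \<open>0 < \<delta>\<close> by (simp add: power_divide field_simps)
      also have "\<dots> \<le> \<delta> * 2 ^ L"
        using pos power_decreasing[of 1 3 \<delta>] by (intro mult_right_mono) auto
      finally show ?thesis by (simp add: power_divide field_simps)
    qed
    have r: "real d \<ge> 1" "real s \<ge> 1" "real G \<ge> 1" using pos by auto
    have p1: "real d * (real G * (real G * real s)\<^sup>2) \<le> y ^ 3"
    proof -
      have "real d ^ 1 * (real G ^ 3 * real s ^ 2) \<le> real d ^ 3 * (real G ^ 3 * real s ^ 3)"
        using r by (intro mult_mono power_increasing) auto
      then show ?thesis by (simp add: y_def power_mult_distrib mult_ac power2_eq_square power3_eq_cube)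
    qed
    have p2: "real G * real s \<le> y ^ 3"
    proof -
      have "real d ^ 0 * (real G ^ 1 * real s ^ 1) \<le> real d ^ 3 * (real G ^ 3 * real s ^ 3)"
        using r by (intro mult_mono power_increasing) auto
      then show ?thesis by (simp add: y_def power_mult_distrib mult_ac)
    qed
    have "real d * (real G * ((real G * real s) ^ 2 * (1 / 2) ^ L)) \<le> y ^ 3 * (1 / 2) ^ L"
      using mult_right_mono[OF p1, of "(1 / 2) ^ L"] by (simp add: mult.assoc)
    moreover have "real G * real s * (1 / 2) ^ L \<le> y ^ 3 * (1 / 2) ^ L"
      by (intro mult_right_mono p2) simp
    ultimately show ?thesis using 1 half by linarith
  qed
  show ?thesis
  proof (rule exI[of _ \<theta>0], intro conjI allI impI \<open>\<theta>0 > 0\<close>)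
    fix \<theta> I c
    assume \<theta>: "0 \<le> \<theta>" "\<theta> \<le> \<theta>0" and "sparse_family s G \<Gamma> I c \<and> (\<forall>g<G. \<forall>k\<in>I g. cmod (c g k) \<ge> m)"
    then have fam: "sparse_family s G \<Gamma> I c" and low: "\<And>g. g < G \<Longrightarrow> \<forall>k\<in>I g. cmod (c g k) \<ge> m" by auto
    have sub: "I g \<subseteq> \<Gamma>" if "g < G" for g using fam that by (auto simp: sparse_family_def)
    have "with_prob_at_least uniform_seeds
     (1 - (2 * (real d * (real G * (real s * \<epsilon>))) + real d * (real G * ((real G * real s) ^ 2 * (1 / 2) ^ L)) + real G * real s * (1 / 2) ^ L))
     (good_seed d s G \<Gamma> I c \<theta> M L M' L)"
    proof (rule good_seed_probability[OF pos(1) fin len fam M M' _ _ _ \<theta>(2)])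
      show "\<epsilon> \<ge> 0" using \<open>\<epsilon> > 0\<close> by simp
    qed (use \<theta>0[OF sub low] in blast)+
    then show "with_prob_at_least seed_space (1 - \<delta>) (\<lambda>\<omega>. recovers G I c
      (result (uniform_sparse_fft d G \<Gamma> s s \<theta> 1 (random_rank1_method M L) M' L \<omega>) (black_box G I c)))"
      unfolding seed_space_eq
    proof (rule with_prob_mono)
      fix \<omega> assume "good_seed d s G \<Gamma> I c \<theta> M L M' L \<omega>"
      then interpret good_run d s G \<Gamma> I c \<theta> M L M' L \<omega>
        using pos fin len fam \<theta> prime_gt_0_nat[OF M(1)] prime_gt_0_nat[OF M'(1)]
        by unfold_locales auto
      show "recovers G I c
      (result (uniform_sparse_fft d G \<Gamma> s s \<theta> 1 (random_rank1_method M L) M' L \<omega>) (black_box G I c))"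
        by (rule run_recovers)
    qed (use bound in simp)
  qed
qed

text \<open>The factor 4 compensates for logarithms \<open>l\<close> below 1: \<open>l \<ge> 1 / 2\<close> gives \<open>l \<le> 4 * l^3\<close>.\<close>

lemma monomial_bound:
  fixes d s G N l :: real
  assumes "d \<ge> 1" "s \<ge> 1" "G \<ge> 1" "N \<ge> 1" "l \<ge> 1 / 2" "i \<le> 2" "j \<le> 2" "k \<le> 2" "1 \<le> p" "p \<le> 3"
  shows "d ^ i * s ^ j * G ^ k * N * l ^ p \<le> 4 * (d ^ 2 * s ^ 2 * G ^ 2 * N * l ^ 3)"
proof -
  have "2 * l ^ p \<le> 2 ^ p * l ^ p"
    using assms power_increasing[of 1 p "2::real"] by (intro mult_right_mono) auto
  also have "\<dots> = (2 * l) ^ p" by (simp add: power_mult_distrib)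
  also have "\<dots> \<le> (2 * l) ^ 3" using assms by (intro power_increasing) auto
  finally have l: "l ^ p \<le> 4 * l ^ 3" by (simp add: power_mult_distrib)
  have "d ^ i * s ^ j * G ^ k * N \<le> d ^ 2 * s ^ 2 * G ^ 2 * N"
    using assms by (intro mult_mono power_increasing mult_nonneg_nonneg) auto
  then have "d ^ i * s ^ j * G ^ k * N * l ^ p \<le> d ^ 2 * s ^ 2 * G ^ 2 * N * (4 * l ^ 3)"
    by (rule mult_mono[OF _ l]) (use assms in auto)
  then show ?thesis by simp
qed

text \<open>Each of the eight terms of the worst-case count is a constant times a monomial covered by
  \<open>monomial_bound\<close>.\<close>

lemma operations_estimate:
  fixes d s G K M M' L e :: nat and N l A E :: real
  assumes pos: "d \<ge> 1" "s \<ge> 1" "G \<ge> 1" "N \<ge> 1" "l \<ge> 1 / 2" "A \<ge> 0" "E \<ge> 0"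
    and K: "real K \<le> 2 * N" and M: "real M \<le> A * (s * N)" and M': "real M' \<le> A * (s * G * N)"
    and L: "real L \<le> 9 * l" and e: "real e \<le> E * l"
  shows "real (d * (G * (K * (25 * e + 34))) +
     d * (5 * M * d * L + G * s * K * (L * (2 * d + 1)) + G * (L * (M * (24 * e + 31)) + G * s * K * (3 * L + e + 2))) +
     (5 * M' * d * L + G * s * (L * (2 * d + 2)) + G * (L * (M' * (24 * e + 31)))))
    \<le> (1152 + 4824 * A + 208 * E + 1728 * A * E) * (real d ^ 2 * real s ^ 2 * real G ^ 2 * N * l ^ 3)"
proof -
  let ?d = "real d" and ?s = "real s" and ?G = "real G"
  let ?X = "?d ^ 2 * ?s ^ 2 * ?G ^ 2 * N * l ^ 3"
  have r: "?d \<ge> 1" "?s \<ge> 1" "?G \<ge> 1" using pos by auto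
  have mb: "?d ^ i * ?s ^ j * ?G ^ k * N * l ^ p \<le> 4 * ?X" if "i \<le> 2" "j \<le> 2" "k \<le> 2" "1 \<le> p" "p \<le> 3" for i j k p
    using that by (intro monomial_bound r pos)
  have one: "1 \<le> 2 * l" using pos by simp
  have e1: "25 * real e + 34 \<le> (25 * E + 68) * l" and e2: "24 * real e + 31 \<le> (24 * E + 62) * l"
    and e3: "3 * real L + real e + 2 \<le> (31 + E) * l"
    using e one L by (auto simp: distrib_right)
  have dd: "2 * ?d + 1 \<le> 3 * ?d" "2 * ?d + 2 \<le> 4 * ?d" using r by auto
  have t1: "?d * (?G * (K * (25 * real e + 34))) \<le> (2 * (25 * E + 68)) * (4 * ?X)"
  proof -
    have "?d * (?G * (K * (25 * real e + 34))) \<le> ?d * (?G * (2 * N * ((25 * E + 68) * l)))"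
      using e1 K pos by (intro mult_left_mono mult_mono) auto
    also have "\<dots> = (2 * (25 * E + 68)) * (?d ^ 1 * ?s ^ 0 * ?G ^ 1 * N * l ^ 1)" by simp
    also have "\<dots> \<le> (2 * (25 * E + 68)) * (4 * ?X)" using pos by (intro mult_left_mono mb) auto
    finally show ?thesis .
  qed
  have t2: "?d * (5 * M * ?d * L) \<le> (45 * A) * (4 * ?X)"
  proof -
    have "?d * (5 * M * ?d * L) \<le> ?d * (5 * (A * (s * N)) * ?d * (9 * l))"
      using M L pos by (intro mult_left_mono mult_mono mult_right_mono) auto
    also have "\<dots> = (45 * A) * (?d ^ 2 * ?s ^ 1 * ?G ^ 0 * N * l ^ 1)" by (simp add: power2_eq_square)
    also have "\<dots> \<le> (45 * A) * (4 * ?X)" using pos by (intro mult_left_mono mb) auto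
    finally show ?thesis .
  qed
  have t3: "?d * (?G * ?s * K * (L * (2 * ?d + 1))) \<le> 54 * (4 * ?X)"
  proof -
    have "?d * (?G * ?s * K * (L * (2 * ?d + 1))) \<le> ?d * (?G * ?s * (2 * N) * (9 * l * (3 * ?d)))"
      using K L dd pos by (intro mult_left_mono mult_mono) auto
    also have "\<dots> = 54 * (?d ^ 2 * ?s ^ 1 * ?G ^ 1 * N * l ^ 1)" by (simp add: power2_eq_square)
    also have "\<dots> \<le> 54 * (4 * ?X)" using pos by (intro mult_left_mono mb) auto
    finally show ?thesis .
  qed
  have t4: "?d * (?G * (L * (M * (24 * real e + 31)))) \<le> (9 * A * (24 * E + 62)) * (4 * ?X)"
  proof -
    have "?d * (?G * (L * (M * (24 * real e + 31)))) \<le> ?d * (?G * (9 * l * (A * (s * N) * ((24 * E + 62) * l))))"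
      using M L e2 pos by (intro mult_left_mono mult_mono) auto
    also have "\<dots> = (9 * A * (24 * E + 62)) * (?d ^ 1 * ?s ^ 1 * ?G ^ 1 * N * l ^ 2)" by (simp add: power2_eq_square)
    also have "\<dots> \<le> (9 * A * (24 * E + 62)) * (4 * ?X)" using pos by (intro mult_left_mono mb) auto
    finally show ?thesis .
  qed
  have t5: "?d * (?G * (?G * ?s * K * (3 * real L + real e + 2))) \<le> (2 * (31 + E)) * (4 * ?X)"
  proof -
    have "?d * (?G * (?G * ?s * K * (3 * real L + real e + 2))) \<le> ?d * (?G * (?G * ?s * (2 * N) * ((31 + E) * l)))"
      using K e3 pos by (intro mult_left_mono mult_mono) auto
    also have "\<dots> = (2 * (31 + E)) * (?d ^ 1 * ?s ^ 1 * ?G ^ 2 * N * l ^ 1)" by (simp add: power2_eq_square)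
    also have "\<dots> \<le> (2 * (31 + E)) * (4 * ?X)" using pos by (intro mult_left_mono mb) auto
    finally show ?thesis .
  qed
  have t6: "5 * M' * ?d * L \<le> (45 * A) * (4 * ?X)"
  proof -
    have "5 * M' * ?d * L \<le> 5 * (A * (s * G * N)) * ?d * (9 * l)"
      using M' L pos by (intro mult_left_mono mult_mono mult_right_mono) auto
    also have "\<dots> = (45 * A) * (?d ^ 1 * ?s ^ 1 * ?G ^ 1 * N * l ^ 1)" by simp
    also have "\<dots> \<le> (45 * A) * (4 * ?X)" using pos by (intro mult_left_mono mb) auto
    finally show ?thesis .
  qed
  have t7: "?G * ?s * (L * (2 * ?d + 2)) \<le> 36 * (4 * ?X)"
  proof -
    have "?G * ?s * (L * (2 * ?d + 2)) \<le> ?G * ?s * (9 * l * (4 * ?d))"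
      using L dd pos by (intro mult_left_mono mult_mono) auto
    also have "\<dots> \<le> 36 * (?d ^ 1 * ?s ^ 1 * ?G ^ 1 * N * l ^ 1)"
      using pos mult_left_mono[of 1 N "?G * ?s * (9 * l * (4 * ?d))"] by (simp add: mult_ac)
    also have "\<dots> \<le> 36 * (4 * ?X)" using pos by (intro mult_left_mono mb) auto
    finally show ?thesis .
  qed
  have t8: "?G * (L * (M' * (24 * real e + 31))) \<le> (9 * A * (24 * E + 62)) * (4 * ?X)"
  proof -
    have "?G * (L * (M' * (24 * real e + 31))) \<le> ?G * (9 * l * (A * (s * G * N) * ((24 * E + 62) * l)))"
      using M' L e2 pos by (intro mult_left_mono mult_mono) auto
    also have "\<dots> = (9 * A * (24 * E + 62)) * (?d ^ 0 * ?s ^ 1 * ?G ^ 2 * N * l ^ 2)" by (simp add: power2_eq_square)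
    also have "\<dots> \<le> (9 * A * (24 * E + 62)) * (4 * ?X)" using pos by (intro mult_left_mono mb) auto
    finally show ?thesis .
  qed
  have X: "?X \<ge> 0" using pos by auto
  have "real (d * (G * (K * (25 * e + 34))) +
     d * (5 * M * d * L + G * s * K * (L * (2 * d + 1)) + G * (L * (M * (24 * e + 31)) + G * s * K * (3 * L + e + 2))) +
     (5 * M' * d * L + G * s * (L * (2 * d + 2)) + G * (L * (M' * (24 * e + 31)))))
    = ?d * (?G * (K * (25 * real e + 34))) + (?d * (5 * M * ?d * L) + ?d * (?G * ?s * K * (L * (2 * ?d + 1))) +
      ?d * (?G * (L * (M * (24 * real e + 31)))) + ?d * (?G * (?G * ?s * K * (3 * real L + real e + 2)))) +
      (5 * M' * ?d * L + ?G * ?s * (L * (2 * ?d + 2)) + ?G * (L * (M' * (24 * real e + 31))))"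
    by (simp add: distrib_left)
  also have "\<dots> \<le> (2 * (25 * E + 68)) * (4 * ?X) + ((45 * A) * (4 * ?X) + 54 * (4 * ?X) + (9 * A * (24 * E + 62)) * (4 * ?X) +
      (2 * (31 + E)) * (4 * ?X)) + ((45 * A) * (4 * ?X) + 36 * (4 * ?X) + (9 * A * (24 * E + 62)) * (4 * ?X))"
    by (intro add_mono t1 t2 t3 t4 t5 t6 t7 t8)
  also have "\<dots> = (4 * (2 * (25 * E + 68) + 45 * A + 54 + 9 * A * (24 * E + 62) + 2 * (31 + E) + 45 * A + 36 + 9 * A * (24 * E + 62))) * ?X"
    by (simp add: algebra_simps)
  also have "\<dots> \<le> (1152 + 4824 * A + 208 * E + 1728 * A * E) * ?X"
    by (intro mult_right_mono X) (simp add: algebra_simps)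
  finally show ?thesis .
qed

text \<open>The factor is \<open>1 / ln 2 \<le> 3 / 2\<close>.\<close>

lemma ceiling_power_of_two:
  assumes "Q \<ge> 1"
  shows "\<exists>e::nat. Q \<le> 2 ^ e \<and> real e \<le> 3 / 2 * ln Q + 1"
proof (intro exI conjI)
  let ?e = "nat \<lceil>log 2 Q\<rceil>"
  have l0: "log 2 Q \<ge> 0" using assms by simp
  have "Q = 2 powr (log 2 Q)" using assms by simp
  also have "\<dots> \<le> 2 powr real ?e" using l0 by (intro powr_mono) linarith+
  finally show "Q \<le> 2 ^ ?e" by (simp add: powr_realpow)
  have "real ?e \<le> log 2 Q + 1" using l0 by linarith
  also have "log 2 Q \<le> 3 / 2 * ln Q"
  proof -
    have "ln Q \<ge> 0" using assms by simp
    then have "ln Q * 1 \<le> ln Q * (3 / 2 * ln 2)" using ln2_ge_two_thirds by (intro mult_left_mono) auto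
    then show ?thesis by (simp add: log_def field_simps)
  qed
  finally show "real ?e \<le> 3 / 2 * ln Q + 1" by simp
qed

text \<open>\<open>Cp\<close> is the constant from \<open>prime_in_multiplicative_interval\<close>.  The number \<open>Q\<close> below exceeds all transform
  lengths and list lengths of a run, so that its logarithm bounds the exponent \<open>e\<close> of the worst-case
  counts.\<close>

lemma complexity_estimates:
  fixes d s G M M' L Cp :: nat and \<delta> \<theta> :: real and \<omega> :: seed
  assumes fin: "finite \<Gamma>" "\<Gamma> \<noteq> {}" and len: "\<And>k. k \<in> \<Gamma> \<Longrightarrow> length k = d"
    and pos: "d \<ge> 1" "s \<ge> 1" "G \<ge> 1" "0 < \<delta>" "\<delta> < 1"
    and Cp: "Cp \<ge> 1" and M: "M \<ge> 1" "M \<le> Cp * max (16 * s) (nat (width d \<Gamma>))"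
    and M': "M' \<ge> 1" "M' \<le> Cp * max (16 * (G * s)) (nat (width d \<Gamma>))"
    and L: "real L \<le> 3 / 2 * ln (3 * (real d * real s * real G / \<delta>) ^ 3) + 1"
    and seeds: "\<And>i. \<omega> i \<in> {0..<1}"
    and nd: "real_of_int (width d \<Gamma>) \<ge> 1" "real d * real s * real G / \<delta> \<ge> 2"
  defines "A \<equiv> 16 * real Cp" and "E \<equiv> 3 * ln (64 * real Cp) + 7 / 2" and "N \<equiv> real_of_int (width d \<Gamma>)"
    and "P \<equiv> uniform_sparse_fft d G \<Gamma> s s \<theta> 1 (random_rank1_method M L) M' L \<omega>"
  shows "real (card (locations P F)) \<le> (8 + 27 * A) * (real d * real s * max (real s) N * ln (real d * real s * real G * N / \<delta>) ^ 2
      + max (real s * real G) N * ln (real d * real s * real G / \<delta>))"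
    "real (operations P F) \<le> (1152 + 4824 * A + 208 * E + 1728 * A * E) *
      (real d ^ 2 * real s ^ 2 * real G ^ 2 * N * ln (real d * real s * real G * N / \<delta>) ^ 3)"
proof -
  define x where "x = real d * real s * real G / \<delta>"
  define Nn where "Nn = nat (width d \<Gamma>)"
  let ?K = "nat (width d \<Gamma>) + 1"
  have "A \<ge> 16" using \<open>Cp \<ge> 1\<close> by (simp add: A_def)
  have "E \<ge> 0" using \<open>Cp \<ge> 1\<close> by (simp add: E_def)
  have N1: "N \<ge> 1" and x2: "x \<ge> 2" using nd by (auto simp: x_def N_def)
  have Nn: "real Nn = N" using N1 by (simp add: Nn_def N_def)
  have xN: "real d * real s * real G * N / \<delta> = x * N" by (simp add: x_def)
  have l1: "ln x \<ge> 2 / 3" using x2 ln2_ge_two_thirds ln_le_cancel_iff[of 2 x] by linarith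
  have l12: "ln x \<le> ln (x * N)" using x2 N1 by simp
  define l where "l = ln (x * N)"
  have l: "l \<ge> 1 / 2" "ln x \<le> l" using l1 l12 by (auto simp: l_def)
  \<comment> \<open>Here \<open>3 / 2 * (2 + 3) * ln x + 1\<close> is at most \<open>9 * ln x\<close> since \<open>ln x \<ge> 2 / 3\<close>.\<close>
  have Lx: "real L \<le> 9 * ln x"
  proof -
    have "ln (3::real) \<le> ln (2 ^ 2)" by simp
    also have "\<dots> = 2 * ln 2" by (subst ln_realpow) auto
    also have "\<dots> \<le> 2 * ln x" using x2 by simp
    finally have "ln 3 \<le> 2 * ln x" .
    moreover have "ln (3 * x ^ 3) = ln 3 + 3 * ln x"
      using x2 by (simp add: ln_mult ln_realpow)
    ultimately show ?thesis using L[folded x_def] l1 by linarith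
  qed
  have Ms: "real M \<le> A * max (real s) N"
  proof -
    have "real M \<le> real Cp * max (16 * real s) N"
      using M(2)[folded Nn_def] Nn by (metis of_nat_max of_nat_mono of_nat_mult of_nat_numeral)
    also have "\<dots> \<le> real Cp * (16 * max (real s) N)" using N1 by (intro mult_left_mono) auto
    finally show ?thesis by (simp add: A_def)
  qed
  have Ms': "real M' \<le> A * max (real s * real G) N"
  proof -
    have "real M' \<le> real Cp * max (16 * (real G * real s)) N"
      using M'(2)[folded Nn_def] Nn by (metis of_nat_max of_nat_mono of_nat_mult of_nat_numeral)
    also have "\<dots> \<le> real Cp * (16 * max (real s * real G) N)" using N1 by (intro mult_left_mono) (auto simp: mult.commute)
    finally show ?thesis by (simp add: A_def)
  qed
  have r: "real d \<ge> 1" "real s \<ge> 1" "real G \<ge> 1" using pos by auto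
  have sG1: "real s * real G \<ge> 1" using r mult_mono[of 1 "real s" 1 "real G"] by simp
  have m1: "max (real s) N \<le> real s * N" and m2: "max (real s * real G) N \<le> real s * real G * N"
    using N1 r sG1 mult_mono[of 1 "real s" N N] mult_mono[of "real s" "real s" 1 N]
      mult_mono[of 1 "real s * real G" N N] mult_mono[of "real s * real G" "real s * real G" 1 N] by auto
  have MsN: "real M \<le> A * (real s * N)" "real M' \<le> A * (real s * real G * N)"
    using order_trans[OF Ms mult_left_mono[OF m1]] order_trans[OF Ms' mult_left_mono[OF m2]] \<open>A \<ge> 16\<close> by auto
  have K2: "real ?K \<le> 2 * N" using N1 by (simp add: N_def)
  \<comment> \<open>The largest quantity to be covered is \<open>2 * M' \<le> 32 * Cp * s * G * N\<close>.\<close>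
  define Q where "Q = 64 * real Cp * (real s * real G * N)"
  have sGN: "real s * real G * N \<ge> 1" using sG1 N1 mult_mono[of 1 "real s * real G" 1 N] by simp
  have "Q \<ge> 1"
  proof -
    have "1 * 1 \<le> (64 * real Cp) * (real s * real G * N)" using \<open>Cp \<ge> 1\<close> sGN by (intro mult_mono) auto
    then show ?thesis by (simp add: Q_def)
  qed
  then obtain e where e: "Q \<le> 2 ^ e" "real e \<le> 3 / 2 * ln Q + 1"
    using ceiling_power_of_two by blast
  have el: "real e \<le> E * l"
  proof -
    have "ln Q = ln (64 * real Cp) + ln (real s * real G * N)"
      unfolding Q_def using \<open>Cp \<ge> 1\<close> sGN by (intro ln_mult_pos) auto
    moreover have "ln (real s * real G * N) \<le> l"
    proof -
      have "real s * real G * 1 \<le> real s * real G * (real d / \<delta>)"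
        using r pos by (intro mult_left_mono) (auto simp: field_simps)
      then have "real s * real G \<le> x" by (simp add: x_def mult_ac)
      then have "real s * real G * N \<le> x * N" using N1 by (intro mult_right_mono) auto
      then show ?thesis unfolding l_def using sGN by (subst ln_le_cancel_iff) auto
    qed
    ultimately have "real e \<le> 3 / 2 * ln (64 * real Cp) + 3 / 2 * l + 1" using e(2) by linarith
    moreover have "3 / 2 * ln (64 * real Cp) * 1 \<le> 3 / 2 * ln (64 * real Cp) * (2 * l)"
      using \<open>Cp \<ge> 1\<close> l by (intro mult_left_mono) auto
    ultimately show ?thesis using l by (simp add: E_def algebra_simps)
  qed
  have ge: "a \<le> 2 ^ e" if "real a \<le> Q" for a :: nat
  proof -
    have "real a \<le> real (2 ^ e)"
        unfolding of_nat_power of_nat_numeral by (rule order_trans[OF that e(1)])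
    then show ?thesis by (simp only: of_nat_le_iff)
  qed
  have AQ: "2 * A * (real s * real G * N) \<le> Q" unfolding A_def Q_def using sGN by (intro mult_right_mono) auto
  have GsN: "real s * N \<le> real s * real G * N"
    using r N1 by (intro mult_right_mono) auto
  have es: "2 * ?K \<le> 2 ^ e" "2 * M \<le> 2 ^ e" "2 * M' \<le> 2 ^ e" "G * s * ?K \<le> 2 ^ e"
  proof -
    have c: "4 * (real s * real G * N) \<le> Q"
      unfolding Q_def using \<open>Cp \<ge> 1\<close> sGN by (intro mult_right_mono) auto
    have "N \<le> real s * real G * N" using sG1 N1 mult_right_mono[of 1 "real s * real G" N] by simp
    then have "2 * N \<le> 2 * (real s * real G * N)" by simp
      then have "2 * real ?K \<le> 2 * (2 * (real s * real G * N))"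
        by (intro mult_left_mono order_trans[OF K2]) auto
      then have "real (2 * ?K) \<le> Q" unfolding of_nat_mult of_nat_numeral using c by simp
    then show "2 * ?K \<le> 2 ^ e" by (rule ge)
    have "A * (real s * N) \<le> A * (real s * real G * N)" using GsN \<open>A \<ge> 16\<close> by (intro mult_left_mono) auto
    then have "real (2 * M) \<le> Q" using MsN(1) AQ by simp
    then show "2 * M \<le> 2 ^ e" by (rule ge)
    have "real (2 * M') \<le> Q" using MsN(2) AQ by simp
    then show "2 * M' \<le> 2 ^ e" by (rule ge)
    have "real (G * s * ?K) \<le> real G * real s * (2 * N)"
      unfolding of_nat_mult by (intro mult_left_mono K2) simp
    also have "\<dots> \<le> Q" using c sGN by (simp add: mult_ac)
    finally show "G * s * ?K \<le> 2 ^ e" by (rule ge)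
  qed
  have M0: "M > 0" "M' > 0" using M(1) M'(1) by auto
  note wc = worst_case[where \<omega> = \<omega> and \<theta> = \<theta> and F = F and L = L and L' = L, OF fin len pos(1) seeds M0 es]
  have "real (operations (P) F) \<le> real (d * (G * (?K * (25 * e + 34))) +
     d * (5 * M * d * L + G * s * ?K * (L * (2 * d + 1)) + G * (L * (M * (24 * e + 31)) + G * s * ?K * (3 * L + e + 2))) +
     (5 * M' * d * L + G * s * (L * (2 * d + 2)) + G * (L * (M' * (24 * e + 31)))))"
    unfolding P_def by (intro of_nat_mono wc(1))
  also have "\<dots> \<le> (1152 + 4824 * A + 208 * E + 1728 * A * E) * (real d ^ 2 * real s ^ 2 * real G ^ 2 * N * l ^ 3)"
    by (rule operations_estimate) (use pos N1 l K2 MsN Lx el \<open>A \<ge> 16\<close> \<open>E \<ge> 0\<close> in auto)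
  finally show "real (operations (P) F) \<le> (1152 + 4824 * A + 208 * E + 1728 * A * E) * (real d ^ 2 * real s ^ 2 * real G ^ 2 * N * ln (real d * real s * real G * N / \<delta>) ^ 3)"
    by (simp only: xN l_def)
  have "real (card (locations (P) F)) \<le> real (d * ?K + d * (L * M) + L * M')"
    unfolding P_def by (intro of_nat_mono wc(3))
  also have "\<dots> = real d * real ?K + real d * (real L * real M) + real L * real M'" by (simp only: of_nat_add of_nat_mult)
  also have "\<dots> \<le> real d * (2 * N) + real d * (9 * l * (A * max (real s) N)) + 9 * ln x * (A * max (real s * real G) N)"
    using Lx l Ms Ms' K2 l1 by (intro add_mono mult_left_mono mult_mono) auto
  also have "\<dots> \<le> (8 + 27 * A) * (real d * real s * max (real s) N * l ^ 2 + max (real s * real G) N * ln x)"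
  proof -
    let ?X = "real d * real s * max (real s) N * l ^ 2" and ?Y = "max (real s * real G) N * ln x"
    have ll: "1 \<le> 4 * l ^ 2" "l \<le> 2 * l ^ 2"
      using l mult_mono[of "1/2" l "1/2" l] mult_right_mono[of "1/2" l l] by (auto simp: power2_eq_square)
    have 1: "real d * (2 * N) \<le> 8 * ?X"
    proof -
      have "real d * N * 1 \<le> (real d * (real s * max (real s) N)) * (4 * l ^ 2)"
      proof (intro mult_mono[OF mult_left_mono ll(1)])
        show "N \<le> real s * max (real s) N"
          using r N1 mult_mono[of 1 "real s" N "max (real s) N"] by simp
      qed (use r N1 in auto)
      then show ?thesis by (simp add: mult_ac)
    qed
    have 2: "real d * (9 * l * (A * max (real s) N)) \<le> 18 * A * ?X"
    proof -
      have "(real d * max (real s) N * A) * (1 * l) \<le> (real d * max (real s) N * A) * (real s * (2 * l ^ 2))"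
        using ll l r N1 \<open>A \<ge> 16\<close> by (intro mult_left_mono mult_mono) auto
      then show ?thesis by (simp add: mult_ac)
    qed
    have Y: "?Y \<ge> 0" "?X \<ge> 0" using l1 N1 r by auto
    have "8 * ?X + 18 * A * ?X + 9 * A * ?Y \<le> (8 + 27 * A) * (?X + ?Y)"
      using Y \<open>A \<ge> 16\<close> mult_nonneg_nonneg[of A ?X] mult_nonneg_nonneg[of A ?Y] by (simp add: algebra_simps)
    moreover have "9 * ln x * (A * max (real s * real G) N) = 9 * A * ?Y" by simp
    ultimately show ?thesis using 1 2 by linarith
  qed
  finally show "real (card (locations (P) F)) \<le> (8 + 27 * A) * (real d * real s * max (real s) N * ln (real d * real s * real G * N / \<delta>) ^ 2
                  + max (real s * real G) N * ln (real d * real s * real G / \<delta>))"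
    by (simp only: xN l_def x_def)
qed

theorem theorem1p1:
  "\<exists>C>0. \<forall>(d::nat) (s::nat) (\<Gamma>::freq set) (G::nat) (\<delta>::real).
     d \<ge> 1 \<longrightarrow> s \<ge> 1 \<longrightarrow> G \<ge> 1 \<longrightarrow> 0 < \<delta> \<longrightarrow> \<delta> < 1 \<longrightarrow>
     finite \<Gamma> \<longrightarrow> \<Gamma> \<noteq> {} \<longrightarrow> (\<forall>k\<in>\<Gamma>. length k = d) \<longrightarrow>
     (\<exists>s_loc r M L M' L'. s_loc \<ge> s \<and> r \<ge> 1 \<and> M \<ge> 1 \<and> L \<ge> 1 \<and> M' \<ge> 1 \<and> L' \<ge> 1 \<and>
       (let N = real_of_int (width d \<Gamma>);
            log1 = ln (real d * real s * real G / \<delta>);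
            log2 = ln (real d * real s * real G * N / \<delta>);
            nondegenerate = (N \<ge> 1 \<and> real d * real s * real G / \<delta> \<ge> 2);
            alg = (\<lambda>\<theta>. uniform_sparse_fft d G \<Gamma> s s_loc \<theta> r (random_rank1_method M L) M' L')
        in
        \<comment> \<open>the sampling sets\<close>
        (\<forall>\<theta>\<ge>0. \<forall>I c. sparse_family s G \<Gamma> I c \<longrightarrow> (\<forall>\<omega>\<in>space seed_space.
           locations (alg \<theta> \<omega>) (black_box G I c) \<subseteq> torus d \<and>
           (nondegenerate \<longrightarrow>
             real (card (locations (alg \<theta> \<omega>) (black_box G I c)))
               \<le> C * (real d * real s * max (real s) N * log2 ^ 2
                      + max (real s * real G) N * log1)))) \<and>
        \<comment> \<open>one sampling strategy for arbitrary polynomials\<close>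
        (\<forall>I c. sparse_family s G \<Gamma> I c \<longrightarrow>
           with_prob_at_least seed_space (1 - \<delta>)
             (\<lambda>\<omega>. recovers G I c (result (alg 0 \<omega>) (black_box G I c)))) \<and>
        \<comment> \<open>the algorithm, with a threshold adapted to a lower bound of the coefficients\<close>
        (\<forall>m>0. \<exists>\<theta>0>0. \<forall>\<theta>. 0 < \<theta> \<and> \<theta> \<le> \<theta>0 \<longrightarrow>
           (\<forall>I c. sparse_family s G \<Gamma> I c \<and> (\<forall>g<G. \<forall>k\<in>I g. cmod (c g k) \<ge> m) \<longrightarrow>
              with_prob_at_least seed_space (1 - \<delta>)
                (\<lambda>\<omega>. recovers G I c (result (alg \<theta> \<omega>) (black_box G I c))) \<and>
              (nondegenerate \<longrightarrow>
                 with_prob_at_least seed_space (1 - \<delta>)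
                   (\<lambda>\<omega>. real (operations (alg \<theta> \<omega>) (black_box G I c))
                      \<le> C * (real d ^ 2 * real s ^ 2 * real G ^ 2 * N * log2 ^ 3)) \<and>
                 (\<forall>\<omega>\<in>space seed_space.
                    real (operations (alg \<theta> \<omega>) (black_box G I c))
                      \<le> C * (real d ^ 2 * real s ^ 3 * real G ^ 2 * N * log2 ^ 3)))))))"
proof -
  obtain Cp :: nat where "Cp \<ge> 1" and Cp: "\<And>n. n \<ge> 1 \<Longrightarrow> \<exists>p. prime p \<and> n < p \<and> p \<le> Cp * n"
    using prime_in_multiplicative_interval by blast
  define A where "A = 16 * real Cp"
  define E where "E = 3 * ln (64 * real Cp) + 7 / 2"
  define Cops where "Cops = 1152 + 4824 * A + 208 * E + 1728 * A * E"
  define Cloc where "Cloc = 8 + 27 * A"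
  have "A \<ge> 16" using \<open>Cp \<ge> 1\<close> by (simp add: A_def)
  have "E \<ge> 0" using \<open>Cp \<ge> 1\<close> by (simp add: E_def)
  have "Cops \<ge> 0" "Cloc > 0" using \<open>A \<ge> 16\<close> \<open>E \<ge> 0\<close> by (simp_all add: Cops_def Cloc_def)
  show ?thesis
  proof (rule exI[of _ "Cops + Cloc"], intro conjI allI impI)
    show "Cops + Cloc > 0" using \<open>Cops \<ge> 0\<close> \<open>Cloc > 0\<close> by simp
    fix d s :: nat and \<Gamma> :: "freq set" and G :: nat and \<delta> :: real
    assume pos: "d \<ge> 1" "s \<ge> 1" "G \<ge> 1" "0 < \<delta>" "\<delta> < 1"
      and fin: "finite \<Gamma>" "\<Gamma> \<noteq> {}" and "\<forall>k\<in>\<Gamma>. length k = d"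
    then have len: "\<And>k. k \<in> \<Gamma> \<Longrightarrow> length k = d" by blast
    define x where "x = real d * real s * real G / \<delta>"
    have dsG: "real d * real s * real G \<ge> 1"
    proof -
      have "1 * 1 * 1 \<le> real d * real s * real G" using pos by (intro mult_mono) auto
      then show ?thesis by simp
    qed
    then have "x \<ge> 1" using pos by (simp add: x_def field_simps)
    define Nn where "Nn = nat (width d \<Gamma>)"
    have n1: "max (16 * s) Nn \<ge> 1" using pos by (intro order_trans[OF _ max.cobounded1]) simp
    have "G * s \<ge> 1" using mult_le_mono[of 1 G 1 s] pos by simp
    then have n2: "max (16 * (G * s)) Nn \<ge> 1" by (intro order_trans[OF _ max.cobounded1]) simp
    obtain M where M: "prime M" "max (16 * s) Nn < M" "M \<le> Cp * max (16 * s) Nn"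
      using Cp[OF n1] by blast
    obtain M' where M': "prime M'" "max (16 * (G * s)) Nn < M'" "M' \<le> Cp * max (16 * (G * s)) Nn"
      using Cp[OF n2] by blast
    have "3 * x ^ 3 \<ge> 1" using \<open>x \<ge> 1\<close> one_le_power[of x 3] by linarith
    then obtain L where L: "3 * x ^ 3 \<le> 2 ^ L" "real L \<le> 3 / 2 * ln (3 * x ^ 3) + 1"
      using ceiling_power_of_two by blast
    have "L \<ge> 1"
    proof (rule ccontr)
      assume "\<not> L \<ge> 1"
      then have "L = 0" by simp
      with L(1) have "3 * x ^ 3 \<le> 1" by simp
      with \<open>x \<ge> 1\<close> one_le_power[of x 3] show False by linarith
    qed
    have Mw: "int M > width d \<Gamma>" "16 * s \<le> M" "int M' > width d \<Gamma>" "16 * (G * s) \<le> M'"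
      using M(2) M'(2) by (auto simp: Nn_def)
    have "M \<ge> 1" "M' \<ge> 1" using M(1) M'(1) prime_ge_1_nat by auto
    let ?N = "real_of_int (width d \<Gamma>)"
    let ?log1 = "ln (real d * real s * real G / \<delta>)" and ?log2 = "ln (real d * real s * real G * ?N / \<delta>)"
    let ?nd = "?N \<ge> 1 \<and> real d * real s * real G / \<delta> \<ge> 2"
    let ?alg = "\<lambda>\<theta>. uniform_sparse_fft d G \<Gamma> s s \<theta> 1 (random_rank1_method M L) M' L"
    let ?K = "nat (width d \<Gamma>) + 1"
    have recov: "\<exists>\<theta>0>0. \<forall>\<theta> I c. 0 \<le> \<theta> \<longrightarrow> \<theta> \<le> \<theta>0 \<longrightarrow>
        sparse_family s G \<Gamma> I c \<and> (\<forall>g<G. \<forall>k\<in>I g. cmod (c g k) \<ge> m) \<longrightarrow>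
        with_prob_at_least seed_space (1 - \<delta>) (\<lambda>\<omega>. recovers G I c (result (?alg \<theta> \<omega>) (black_box G I c)))"
      if "m > 0" for m :: real
      using pos that fin len M M' Mw L(1) unfolding x_def
      by (intro recovery_probability) auto
    have seeds: "\<omega> i \<in> {0..<1}" if "\<omega> \<in> space seed_space" for \<omega> :: seed and i
      using that unfolding seed_space_eq space_uniform_seeds by auto
    \<comment> \<open>Containment in the torus follows from \<open>worst_case\<close> with any exponent for which \<open>2 ^ e\<close> exceeds all lengths.\<close>
    have torus: "locations (?alg \<theta> \<omega>) F \<subseteq> torus d" if \<omega>: "\<omega> \<in> space seed_space" for \<theta> \<omega> F
    proof -
      define e where "e = 2 * ?K + 2 * M + 2 * M' + G * s * ?K"
      have "e \<le> 2 ^ e" by (simp add: less_imp_le)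
      then have "2 * ?K \<le> 2 ^ e" "2 * M \<le> 2 ^ e" "2 * M' \<le> 2 ^ e" "G * s * ?K \<le> 2 ^ e"
        unfolding e_def by linarith+
      then show ?thesis
        using \<open>M \<ge> 1\<close> \<open>M' \<ge> 1\<close> seeds[OF \<omega>] by (intro worst_case(2)[OF fin len pos(1)]) auto
    qed
    have bounds: "real (card (locations (?alg \<theta> \<omega>) F)) \<le> Cloc * (real d * real s * max (real s) ?N * ?log2 ^ 2
                      + max (real s * real G) ?N * ?log1)"
        "real (operations (?alg \<theta> \<omega>) F) \<le> Cops * (real d ^ 2 * real s ^ 2 * real G ^ 2 * ?N * ?log2 ^ 3)"
      if nd: ?nd and \<omega>: "\<omega> \<in> space seed_space" for \<theta> \<omega> F
    proof -
      note estimates = complexity_estimates[where \<omega> = \<omega> and \<theta> = \<theta> and F = F and L = L,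
          OF fin len pos \<open>Cp \<ge> 1\<close> \<open>M \<ge> 1\<close> M(3)[unfolded Nn_def] \<open>M' \<ge> 1\<close> M'(3)[unfolded Nn_def]
            L(2)[unfolded x_def] seeds[OF \<omega>] conjunct1[OF nd] conjunct2[OF nd]]
      show "real (card (locations (?alg \<theta> \<omega>) F)) \<le> Cloc * (real d * real s * max (real s) ?N * ?log2 ^ 2
                      + max (real s * real G) ?N * ?log1)"
        unfolding Cloc_def A_def by (rule estimates(1))
      show "real (operations (?alg \<theta> \<omega>) F) \<le> Cops * (real d ^ 2 * real s ^ 2 * real G ^ 2 * ?N * ?log2 ^ 3)"
        unfolding Cops_def A_def E_def by (rule estimates(2))
    qed
    have pos_logs: "0 \<le> real d * real s * max (real s) ?N * ?log2 ^ 2 + max (real s * real G) ?N * ?log1"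
      "0 \<le> real d ^ 2 * real s ^ 2 * real G ^ 2 * ?N * ?log2 ^ 3" "0 \<le> ?N * ?log2 ^ 3" if ?nd
    proof -
      have "?log1 \<ge> 0" using that by simp
      moreover have "real d * real s * real G * ?N / \<delta> = x * ?N" by (simp add: x_def)
      moreover have "1 * 1 \<le> x * ?N" using that \<open>x \<ge> 1\<close> by (intro mult_mono) auto
      ultimately show "0 \<le> real d * real s * max (real s) ?N * ?log2 ^ 2 + max (real s * real G) ?N * ?log1"
        "0 \<le> real d ^ 2 * real s ^ 2 * real G ^ 2 * ?N * ?log2 ^ 3" "0 \<le> ?N * ?log2 ^ 3"
        using that by (auto intro!: add_nonneg_nonneg mult_nonneg_nonneg simp: le_max_iff_disj)
    qed
    have locs: "real (card (locations (?alg \<theta> \<omega>) F)) \<le> (Cops + Cloc) * (real d * real s * max (real s) ?N * ?log2 ^ 2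
                      + max (real s * real G) ?N * ?log1)" if "?nd" "\<omega> \<in> space seed_space" for \<theta> \<omega> F
      by (rule order_trans[OF bounds(1)[OF that] mult_right_mono[OF _ pos_logs(1)[OF that(1)]]])
        (use \<open>Cops \<ge> 0\<close> in simp)
    have ops2: "real (operations (?alg \<theta> \<omega>) F) \<le> (Cops + Cloc) * (real d ^ 2 * real s ^ 2 * real G ^ 2 * ?N * ?log2 ^ 3)"
      if "?nd" "\<omega> \<in> space seed_space" for \<theta> \<omega> F
      by (rule order_trans[OF bounds(2)[OF that] mult_right_mono[OF _ pos_logs(2)[OF that(1)]]])
        (use \<open>Cloc > 0\<close> in simp)
    have ops3: "real (operations (?alg \<theta> \<omega>) F) \<le> (Cops + Cloc) * (real d ^ 2 * real s ^ 3 * real G ^ 2 * ?N * ?log2 ^ 3)"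
      if "?nd" "\<omega> \<in> space seed_space" for \<theta> \<omega> F
    proof (rule order_trans[OF ops2[OF that] mult_left_mono])
      have "real s ^ 2 \<le> real s ^ 3" using pos by (intro power_increasing) auto
      then have "real d ^ 2 * real s ^ 2 * real G ^ 2 * (?N * ?log2 ^ 3) \<le> real d ^ 2 * real s ^ 3 * real G ^ 2 * (?N * ?log2 ^ 3)"
        by (intro mult_right_mono mult_left_mono pos_logs(3)[OF that(1)]) auto
      then show "real d ^ 2 * real s ^ 2 * real G ^ 2 * ?N * ?log2 ^ 3 \<le> real d ^ 2 * real s ^ 3 * real G ^ 2 * ?N * ?log2 ^ 3"
        by (simp only: mult.assoc)
      show "0 \<le> Cops + Cloc" using \<open>Cops \<ge> 0\<close> \<open>Cloc > 0\<close> by simp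
    qed
    have certain: "with_prob_at_least seed_space (1 - \<delta>) Q" if "\<And>\<omega>. \<omega> \<in> space seed_space \<Longrightarrow> Q \<omega>" for Q
      unfolding with_prob_at_least_def seed_space_eq
      using pos that by (intro bexI[of _ "space uniform_seeds"]) (auto simp: uniform_seeds.prob_space seed_space_eq)
    \<comment> \<open>The strategy with threshold 0 is independent of the coefficients, so for a given family the
    probability bound may use its smallest coefficient modulus as \<open>m\<close>.\<close>
    have zero: "with_prob_at_least seed_space (1 - \<delta>) (\<lambda>\<omega>. recovers G I c (result (?alg 0 \<omega>) (black_box G I c)))"
      if fam: "sparse_family s G \<Gamma> I c" for I c
    proof -
      define S where "S = insert 1 (\<Union>g<G. (\<lambda>k. cmod (c g k)) ` I g)"
      have fI: "finite (I g)" if "g < G" for g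
      proof (rule finite_subset[OF _ fin(1)])
        show "I g \<subseteq> \<Gamma>" using fam that by (auto simp: sparse_family_def)
      qed
      then have S: "finite S" "S \<noteq> {}" by (auto simp: S_def)
      have "Min S > 0" using S fam by (subst Min_gr_iff) (auto simp: S_def sparse_family_def)
      have low: "\<forall>g<G. \<forall>k\<in>I g. cmod (c g k) \<ge> Min S" using S by (auto simp: S_def intro!: Min_le)
      from recov[OF \<open>Min S > 0\<close>] obtain \<theta>0 where \<theta>0: "\<theta>0 > 0" and rec: "\<forall>\<theta> I c. 0 \<le> \<theta> \<longrightarrow> \<theta> \<le> \<theta>0 \<longrightarrow>
          sparse_family s G \<Gamma> I c \<and> (\<forall>g<G. \<forall>k\<in>I g. cmod (c g k) \<ge> Min S) \<longrightarrow>
          with_prob_at_least seed_space (1 - \<delta>) (\<lambda>\<omega>. recovers G I c (result (?alg \<theta> \<omega>) (black_box G I c)))"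
        by (elim exE conjE)
      show ?thesis
        by (intro rec[THEN spec, THEN spec, THEN spec, THEN mp, THEN mp, THEN mp] conjI fam low) (use \<theta>0 in auto)
    qed
    show "\<exists>s_loc r M L M' L'. s_loc \<ge> s \<and> r \<ge> 1 \<and> M \<ge> 1 \<and> L \<ge> 1 \<and> M' \<ge> 1 \<and> L' \<ge> 1 \<and>
       (let N = real_of_int (width d \<Gamma>);
            log1 = ln (real d * real s * real G / \<delta>);
            log2 = ln (real d * real s * real G * N / \<delta>);
            nondegenerate = (N \<ge> 1 \<and> real d * real s * real G / \<delta> \<ge> 2);
            alg = (\<lambda>\<theta>. uniform_sparse_fft d G \<Gamma> s s_loc \<theta> r (random_rank1_method M L) M' L')
        in
        (\<forall>\<theta>\<ge>0. \<forall>I c. sparse_family s G \<Gamma> I c \<longrightarrow> (\<forall>\<omega>\<in>space seed_space.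
           locations (alg \<theta> \<omega>) (black_box G I c) \<subseteq> torus d \<and>
           (nondegenerate \<longrightarrow>
             real (card (locations (alg \<theta> \<omega>) (black_box G I c)))
               \<le> (Cops + Cloc) * (real d * real s * max (real s) N * log2 ^ 2
                      + max (real s * real G) N * log1)))) \<and>
        (\<forall>I c. sparse_family s G \<Gamma> I c \<longrightarrow>
           with_prob_at_least seed_space (1 - \<delta>)
             (\<lambda>\<omega>. recovers G I c (result (alg 0 \<omega>) (black_box G I c)))) \<and>
        (\<forall>m>0. \<exists>\<theta>0>0. \<forall>\<theta>. 0 < \<theta> \<and> \<theta> \<le> \<theta>0 \<longrightarrow>
           (\<forall>I c. sparse_family s G \<Gamma> I c \<and> (\<forall>g<G. \<forall>k\<in>I g. cmod (c g k) \<ge> m) \<longrightarrow>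
              with_prob_at_least seed_space (1 - \<delta>)
                (\<lambda>\<omega>. recovers G I c (result (alg \<theta> \<omega>) (black_box G I c))) \<and>
              (nondegenerate \<longrightarrow>
                 with_prob_at_least seed_space (1 - \<delta>)
                   (\<lambda>\<omega>. real (operations (alg \<theta> \<omega>) (black_box G I c))
                      \<le> (Cops + Cloc) * (real d ^ 2 * real s ^ 2 * real G ^ 2 * N * log2 ^ 3)) \<and>
                 (\<forall>\<omega>\<in>space seed_space.
                    real (operations (alg \<theta> \<omega>) (black_box G I c))
                      \<le> (Cops + Cloc) * (real d ^ 2 * real s ^ 3 * real G ^ 2 * N * log2 ^ 3))))))"
      unfolding Let_def
    proof (rule exI[of _ s], rule exI[of _ 1], rule exI[of _ M], rule exI[of _ L], rule exI[of _ M'], rule exI[of _ L],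
        intro conjI)
      show "\<forall>m>0. \<exists>\<theta>0>0. \<forall>\<theta>. 0 < \<theta> \<and> \<theta> \<le> \<theta>0 \<longrightarrow>
           (\<forall>I c. sparse_family s G \<Gamma> I c \<and> (\<forall>g<G. \<forall>k\<in>I g. cmod (c g k) \<ge> m) \<longrightarrow>
              with_prob_at_least seed_space (1 - \<delta>)
                (\<lambda>\<omega>. recovers G I c (result (?alg \<theta> \<omega>) (black_box G I c))) \<and>
              (?nd \<longrightarrow>
                 with_prob_at_least seed_space (1 - \<delta>)
                   (\<lambda>\<omega>. real (operations (?alg \<theta> \<omega>) (black_box G I c))
                      \<le> (Cops + Cloc) * (real d ^ 2 * real s ^ 2 * real G ^ 2 * ?N * ?log2 ^ 3)) \<and>
                 (\<forall>\<omega>\<in>space seed_space.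
                    real (operations (?alg \<theta> \<omega>) (black_box G I c))
                      \<le> (Cops + Cloc) * (real d ^ 2 * real s ^ 3 * real G ^ 2 * ?N * ?log2 ^ 3))))"
      proof (intro allI impI)
        fix m :: real assume "m > 0"
        from recov[OF this] obtain \<theta>0 where \<theta>0: "\<theta>0 > 0" and rec: "\<forall>\<theta> I c. 0 \<le> \<theta> \<longrightarrow> \<theta> \<le> \<theta>0 \<longrightarrow>
          sparse_family s G \<Gamma> I c \<and> (\<forall>g<G. \<forall>k\<in>I g. cmod (c g k) \<ge> m) \<longrightarrow>
          with_prob_at_least seed_space (1 - \<delta>) (\<lambda>\<omega>. recovers G I c (result (?alg \<theta> \<omega>) (black_box G I c)))"
          by (elim exE conjE)
        show "\<exists>\<theta>0>0. \<forall>\<theta>. 0 < \<theta> \<and> \<theta> \<le> \<theta>0 \<longrightarrow>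
           (\<forall>I c. sparse_family s G \<Gamma> I c \<and> (\<forall>g<G. \<forall>k\<in>I g. cmod (c g k) \<ge> m) \<longrightarrow>
              with_prob_at_least seed_space (1 - \<delta>)
                (\<lambda>\<omega>. recovers G I c (result (?alg \<theta> \<omega>) (black_box G I c))) \<and>
              (?nd \<longrightarrow>
                 with_prob_at_least seed_space (1 - \<delta>)
                   (\<lambda>\<omega>. real (operations (?alg \<theta> \<omega>) (black_box G I c))
                      \<le> (Cops + Cloc) * (real d ^ 2 * real s ^ 2 * real G ^ 2 * ?N * ?log2 ^ 3)) \<and>
                 (\<forall>\<omega>\<in>space seed_space.
                    real (operations (?alg \<theta> \<omega>) (black_box G I c))
                      \<le> (Cops + Cloc) * (real d ^ 2 * real s ^ 3 * real G ^ 2 * ?N * ?log2 ^ 3))))"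
          by (rule exI[of _ \<theta>0], intro conjI \<theta>0 allI impI ballI)
            (use rec in \<open>meson less_imp_le\<close>, rule certain, erule (1) ops2, erule (1) ops3)
      qed
    qed (use torus locs zero \<open>M \<ge> 1\<close> \<open>M' \<ge> 1\<close> \<open>L \<ge> 1\<close> in simp_all)
  qed
qed

end
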